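(* Let $K$ be a dyadic non-Archimedean local field of characteristic zero and $E/K$ a ramified quadratic field extension. Then the unitary group of every (non-degenerate) hermitian lattice $L$ over $E$ is generated by symmetries (i.e. $U(L)=S(L)$ for all such $L$) if and only if the residue field of $E$ is not $\mathbb{F}_2$.
   Context: Dyadic means $2$ is not a unit in the valuation ring $\mathfrak{o}$ of $K$. $E$ has non-trivial $K$-automorphism $x\mapsto\bar x$ and trace $\mathrm{Tr}(\alpha)=\alpha+\bar\alpha$; $\mathcal{O}$ is the ring of integers of $E$. A hermitian space is a finitely generated free $E$-module $V$ with a map $\langle\cdot,\cdot\rangle:V\times V\to E$, $E$-linear in the first argument, with $\langle x,y\rangle=\overline{\langle y,x\rangle}$. A hermitian lattice is a finitely generated $\mathcal{O}$-submodule $L$ of such $V$, non-degenerate if no nonzero element of $L$ is orthogonal to all of $L$. $U(V)$ is the group of form-preserving $E$-linear automorphisms of $V$ and $U(L)=\{f\in U(V):f(L)=L\}$. For $s\in V$, $\sigma\in E^\times$ with $\langle s,s\rangle=\mathrm{Tr}(\sigma)$, the symmetry is $S_{s,\sigma}(x)=x-\langle x,s\rangle\sigma^{-1}s$; $S(L)$ is the subgroup of $U(L)$ generated by symmetries lying in $U(L)$.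
   Formalization: The ambient hermitian space V is also assumed non-degenerate: otherwise scaling its radical gives elements of U(L) outside S(L) (e.g. L=0, V=E with zero form). V ranges over finite-dimensional subspaces of the space of sequences over E, which covers all V up to isomorphism. *)

theory Defs
  imports
    Complex_Main
    "HOL-Computational_Algebra.Polynomial"
    "HOL-Library.Function_Algebras"
    "HOL-Algebra.Bij"
    "HOL-Algebra.Generated_Groups"
begin

definition nonunits :: "'a::comm_ring_1 set \<Rightarrow> 'a set" where
  "nonunits R = {x \<in> R. \<not> (\<exists>y\<in>R. x * y = 1)}"

text \<open>For a local ring \<open>R\<close> inside a field the non-units form the maximal ideal, and the residue
  field is the set of its cosets in \<open>R\<close>.\<close>

definition residue_field :: "'a::comm_ring_1 set \<Rightarrow> 'a set set" where
  "residue_field R = R // {(x, y) \<in> R \<times> R. x - y \<in> nonunits R}"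

definition span_over ::
  "('a \<Rightarrow> 'v \<Rightarrow> 'v) \<Rightarrow> 'a set \<Rightarrow> 'v::ab_group_add set \<Rightarrow> 'v set" where
  "span_over scale R S =
     {\<Sum>s\<in>T. scale (r s) s | T r. finite T \<and> T \<subseteq> S \<and> (\<forall>s\<in>T. r s \<in> R)}"


section \<open>Local fields and quadratic extensions\<close>

text \<open>Valuations are additive and integer-valued. The value \<open>v 0\<close> is junk, so \<open>0\<close> is treated
  separately wherever \<open>v 0 = \<infinity>\<close> is meant.\<close>

definition valuation_ring :: "('k::field \<Rightarrow> int) \<Rightarrow> 'k set" where
  "valuation_ring v = {x. x = 0 \<or> 0 \<le> v x}"

locale discrete_valuation =
  fixes v :: "'k::field \<Rightarrow> int"
  assumes val_mult: "x \<noteq> 0 \<Longrightarrow> y \<noteq> 0 \<Longrightarrow> v (x * y) = v x + v y"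
    and val_add: "x \<noteq> 0 \<Longrightarrow> y \<noteq> 0 \<Longrightarrow> x + y \<noteq> 0 \<Longrightarrow> min (v x) (v y) \<le> v (x + y)"
    and val_normalized: "\<exists>\<pi>. \<pi> \<noteq> 0 \<and> v \<pi> = 1"

definition val_Cauchy :: "('k::field \<Rightarrow> int) \<Rightarrow> (nat \<Rightarrow> 'k) \<Rightarrow> bool" where
  "val_Cauchy v X \<longleftrightarrow> (\<forall>N. \<exists>M. \<forall>m\<ge>M. \<forall>n\<ge>M. X m = X n \<or> N \<le> v (X m - X n))"

definition val_converges :: "('k::field \<Rightarrow> int) \<Rightarrow> (nat \<Rightarrow> 'k) \<Rightarrow> 'k \<Rightarrow> bool" where
  "val_converges v X l \<longleftrightarrow> (\<forall>N. \<exists>M. \<forall>n\<ge>M. X n = l \<or> N \<le> v (X n - l))"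

locale nonarch_local_field = discrete_valuation v
  for v :: "'k::field \<Rightarrow> int" +
  assumes complete: "val_Cauchy v X \<Longrightarrow> \<exists>l. val_converges v X l"
    and finite_residue_field: "finite (residue_field (valuation_ring v))"

definition dyadic :: "('k::field \<Rightarrow> int) \<Rightarrow> bool" where
  "dyadic v \<longleftrightarrow> (2::'k) \<in> nonunits (valuation_ring v)"

locale field_embedding =
  fixes \<iota> :: "'k::field \<Rightarrow> 'e::field"
  assumes emb_one: "\<iota> 1 = 1"
    and emb_add: "\<iota> (x + y) = \<iota> x + \<iota> y"
    and emb_mult: "\<iota> (x * y) = \<iota> x * \<iota> y"

locale quadratic_extension = field_embedding \<iota>
  for \<iota> :: "'k::field \<Rightarrow> 'e::field" +
  assumes degree_two: "vector_space.dim (\<lambda>a x. \<iota> a * x) (UNIV :: 'e set) = 2"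

locale nontrivial_automorphism = field_embedding bar
  for \<iota> :: "'k::field \<Rightarrow> 'e::field" and bar :: "'e \<Rightarrow> 'e" +
  assumes bar_bij: "bij bar"
    and bar_fixes_base: "bar (\<iota> a) = \<iota> a"
    and bar_nontrivial: "bar \<noteq> id"

definition tr :: "('e::field \<Rightarrow> 'e) \<Rightarrow> 'e \<Rightarrow> 'e" where
  "tr bar \<alpha> = \<alpha> + bar \<alpha>"

text \<open>The ring of integers of the extension is the integral closure of the valuation ring
  of the base field.\<close>

definition ring_of_integers :: "('k::field \<Rightarrow> int) \<Rightarrow> ('k \<Rightarrow> 'e::field) \<Rightarrow> 'e set" where
  "ring_of_integers v \<iota> =
     {x. \<exists>p. lead_coeff p = 1 \<and> (\<forall>i. coeff p i \<in> valuation_ring v) \<and> poly (map_poly \<iota> p) x = 0}"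

text \<open>An extension of local fields is unramified when the maximal ideal of the base generates
  the maximal ideal upstairs (separability of the residue extension is automatic, the residue
  fields being finite), and ramified otherwise.\<close>

definition ramified :: "('k::field \<Rightarrow> int) \<Rightarrow> ('k \<Rightarrow> 'e::field) \<Rightarrow> bool" where
  "ramified v \<iota> \<longleftrightarrow>
     span_over (*) (ring_of_integers v \<iota>) (\<iota> ` nonunits (valuation_ring v))
       \<noteq> nonunits (ring_of_integers v \<iota>)"


section \<open>Hermitian spaces and lattices\<close>

text \<open>A hermitian space is a finite-dimensional subspace \<open>V\<close> of an ambient vector space; the
  values of the form \<open>h\<close> outside \<open>V\<close> are irrelevant.\<close>

locale hermitian_space = vector_space scale
  for scale :: "'e::field \<Rightarrow> 'v::ab_group_add \<Rightarrow> 'v"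
    and bar :: "'e \<Rightarrow> 'e" and V :: "'v set" and h :: "'v \<Rightarrow> 'v \<Rightarrow> 'e" +
  assumes V_subspace: "subspace V"
    and V_finitely_generated: "\<exists>B. finite B \<and> span B = V"
    and form_add: "x \<in> V \<Longrightarrow> y \<in> V \<Longrightarrow> z \<in> V \<Longrightarrow> h (x + y) z = h x z + h y z"
    and form_scale: "x \<in> V \<Longrightarrow> y \<in> V \<Longrightarrow> h (scale a x) y = a * h x y"
    and form_hermitian: "x \<in> V \<Longrightarrow> y \<in> V \<Longrightarrow> h x y = bar (h y x)"

definition nondegenerate :: "('v::zero \<Rightarrow> 'v \<Rightarrow> 'e::zero) \<Rightarrow> 'v set \<Rightarrow> bool" where
  "nondegenerate h M \<longleftrightarrow> (\<forall>x\<in>M. (\<forall>y\<in>M. h x y = 0) \<longrightarrow> x = 0)"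

text \<open>A lattice in \<open>V\<close> is a finitely generated submodule over the ring \<open>R\<close> of integers; it is not
  required to span \<open>V\<close>.\<close>

definition lattice_in ::
  "('e \<Rightarrow> 'v \<Rightarrow> 'v) \<Rightarrow> 'e set \<Rightarrow> 'v::ab_group_add set \<Rightarrow> 'v set \<Rightarrow> bool" where
  "lattice_in scale R V L \<longleftrightarrow> (\<exists>S. finite S \<and> S \<subseteq> V \<and> L = span_over scale R S)"

text \<open>Automorphisms of \<open>V\<close> are elements of \<^term>\<open>BijGroup V\<close>, that is, bijections of \<open>V\<close> that are
  \<^const>\<open>undefined\<close> outside \<open>V\<close>.\<close>

definition unitary_group ::
  "('e \<Rightarrow> 'v \<Rightarrow> 'v) \<Rightarrow> 'v::ab_group_add set \<Rightarrow> ('v \<Rightarrow> 'v \<Rightarrow> 'e) \<Rightarrow> ('v \<Rightarrow> 'v) set" where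
  "unitary_group scale V h =
     {f \<in> carrier (BijGroup V).
        (\<forall>x\<in>V. \<forall>y\<in>V. f (x + y) = f x + f y) \<and>
        (\<forall>a. \<forall>x\<in>V. f (scale a x) = scale a (f x)) \<and>
        (\<forall>x\<in>V. \<forall>y\<in>V. h (f x) (f y) = h x y)}"

definition lattice_unitary_group ::
  "('e \<Rightarrow> 'v \<Rightarrow> 'v) \<Rightarrow> 'v::ab_group_add set \<Rightarrow> ('v \<Rightarrow> 'v \<Rightarrow> 'e) \<Rightarrow> 'v set \<Rightarrow> ('v \<Rightarrow> 'v) set" where
  "lattice_unitary_group scale V h L = {f \<in> unitary_group scale V h. f ` L = L}"

definition symmetry ::
  "('e::field \<Rightarrow> 'v \<Rightarrow> 'v) \<Rightarrow> 'v::ab_group_add set \<Rightarrow> ('v \<Rightarrow> 'v \<Rightarrow> 'e) \<Rightarrow> 'v \<Rightarrow> 'e \<Rightarrow> 'v \<Rightarrow> 'v" where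
  "symmetry scale V h s \<sigma> = (\<lambda>x\<in>V. x - scale (h x s * inverse \<sigma>) s)"

definition symmetries ::
  "('e::field \<Rightarrow> 'v \<Rightarrow> 'v) \<Rightarrow> ('e \<Rightarrow> 'e) \<Rightarrow> 'v::ab_group_add set \<Rightarrow> ('v \<Rightarrow> 'v \<Rightarrow> 'e) \<Rightarrow> ('v \<Rightarrow> 'v) set"
  where
  "symmetries scale bar V h =
     {symmetry scale V h s \<sigma> | s \<sigma>. s \<in> V \<and> \<sigma> \<noteq> 0 \<and> h s s = tr bar \<sigma>}"

definition symmetry_group ::
  "('e::field \<Rightarrow> 'v \<Rightarrow> 'v) \<Rightarrow> ('e \<Rightarrow> 'e) \<Rightarrow> 'v::ab_group_add set \<Rightarrow> ('v \<Rightarrow> 'v \<Rightarrow> 'e) \<Rightarrow> 'v set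
     \<Rightarrow> ('v \<Rightarrow> 'v) set" where
  "symmetry_group scale bar V h L =
     generate (BijGroup V) (symmetries scale bar V h \<inter> lattice_unitary_group scale V h L)"

text \<open>The ambient space of all sequences over \<open>E\<close>: every finite-dimensional vector space over \<open>E\<close>,
  of whatever dimension, is isomorphic to a subspace of it. Quantifying over the
  finite-dimensional subspaces of this one type thus covers all hermitian spaces over \<open>E\<close>.\<close>

definition seq_scale :: "'e::field \<Rightarrow> (nat \<Rightarrow> 'e) \<Rightarrow> (nat \<Rightarrow> 'e)" where
  "seq_scale a x = (\<lambda>i. a * x i)"

lemma vector_space_seq_scale: "vector_space (seq_scale :: 'e::field \<Rightarrow> _)"
  by unfold_locales (auto simp: seq_scale_def fun_eq_iff algebra_simps)

end

theory Submission
  imports Defs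
begin

text \<open>Write \<open>P\<close> for the maximal ideal of the extension and \<open>D f = 1 - f\<close>. If \<open>x\<close> is a vector with
  \<open>\<sigma> = h x (D f x) \<noteq> 0\<close>, then the symmetry at \<open>D f x\<close> with parameter \<open>\<sigma>\<close> maps \<open>x\<close> to \<open>f x\<close>, and
  removing it from \<open>f\<close> lowers the dimension of the image of \<open>D f\<close> (Wall's parametrization of
  isometries). It preserves the lattice \<open>L\<close> if \<open>\<sigma>\<close> generates the ideal \<open>P\<^sup>l\<close> spanned by all
  \<open>h x (D f y)\<close>. Such an \<open>x\<close> in \<open>L\<close> exists unless \<open>h x (D f y)\<close> is alternating modulo \<open>P\<^sup>l\<^sup>+\<^sup>1\<close>; in
  that case \<open>f\<close> is first multiplied by a further symmetry of \<open>L\<close>, after which two vectors can be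
  removed in succession, provided that the residue field has more than two elements.

  Over a residue field with two elements, take four-dimensional \<open>L\<close> with a form that reduces to the
  sum of two hyperbolic planes, scaled so that \<open>h x x\<close> reduces to the quadratic form
  \<open>x\<^sub>0x\<^sub>1 + x\<^sub>2x\<^sub>3\<close>. The reflections of this quadratic form preserve each of two anisotropic planes,
  which are exchanged by the isometry that swaps the two hyperbolic planes.\<close>

section \<open>The extension field\<close>

text \<open>Ramification makes the involution trivial on each quotient P^n/P^(n+1), and 2 acts there
  as 0 in the dyadic case. Modulo the next power of P a hermitian form therefore becomes a symmetric
  form in characteristic two, which may be alternating without being zero. The parameter \<tau> of a
  symmetry at t is bound by \<open>h t t = tr bar \<tau>\<close> and can be varied only by elements
  of trace zero. These have valuations of a single parity, so level l may offer no parameter at all;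
  level l + 1 then serves instead, and this splits the argument into a regular and an irregular
  case. The number of elements of the residue field enters through general position: a vector space
  over a field with q elements is not a union of q proper subspaces, up to four conditions occur at
  once, and q > 2 means q >= 4 because q is a power of two. For q = 2 the counterexample lifts the
  classical exception O_4^+(2), in which reflections generate only a subgroup of index two.
  Completeness enters once, for the integrality of traces, which turns the valuation of the norm
  into a valuation of the extension.\<close>

context discrete_valuation
begin

lemma val_1 [simp]: "v 1 = 0"
  using val_mult[of 1 1] by simp

lemma val_uminus [simp]: "v (- x) = v x"
proof (cases "x = 0")
  case False
  have "v ((-1) * (-1)) = v (-1) + v (-1)" by (rule val_mult) auto
  then have "v (-1) = 0" by simp
  then show ?thesis using val_mult[of "-1" x] False by simp
qed simp

lemma val_inverse: "x \<noteq> 0 \<Longrightarrow> v (inverse x) = - v x"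
  using val_mult[of x "inverse x"] by simp

lemma val_divide: "x \<noteq> 0 \<Longrightarrow> y \<noteq> 0 \<Longrightarrow> v (x / y) = v x - v y"
  by (simp add: divide_inverse val_mult val_inverse)

lemma val_power: "x \<noteq> 0 \<Longrightarrow> v (x ^ n) = int n * v x"
  by (induction n) (auto simp: val_mult algebra_simps)

lemma val_powi: "x \<noteq> 0 \<Longrightarrow> v (x powi n) = n * v x"
  by (cases "n \<ge> 0") (auto simp: power_int_def val_power val_inverse)

text \<open>The fractional ideal P^n. Estimates are stated as membership in it, which covers 0 and
  keeps the junk value \<open>v 0\<close> out of the computations.\<close>

definition F :: "int \<Rightarrow> 'k set" where
  "F n = {x. x = 0 \<or> n \<le> v x}"

lemma F_0 [simp, intro]: "0 \<in> F n"
  by (simp add: F_def)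

lemma F_add [intro]: "x \<in> F n \<Longrightarrow> y \<in> F n \<Longrightarrow> x + y \<in> F n"
  using val_add[of x y] by (cases "x = 0 \<or> y = 0 \<or> x + y = 0") (auto simp: F_def)

lemma F_uminus_iff [simp]: "- x \<in> F n \<longleftrightarrow> x \<in> F n"
  by (auto simp: F_def)

lemma F_diff [intro]: "x \<in> F n \<Longrightarrow> y \<in> F n \<Longrightarrow> x - y \<in> F n"
  using F_add[of x n "- y"] by simp

lemma F_minus_commute: "x - y \<in> F n \<longleftrightarrow> y - x \<in> F n"
  using F_uminus_iff[of "x - y" n] by simp

lemma F_mono: "x \<in> F n \<Longrightarrow> m \<le> n \<Longrightarrow> x \<in> F m"
  by (auto simp: F_def)

lemma F_Suc: "x \<in> F (n + 1) \<Longrightarrow> x \<in> F n"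
  by (erule F_mono) simp

lemma F_mult: "x \<in> F m \<Longrightarrow> y \<in> F n \<Longrightarrow> k \<le> m + n \<Longrightarrow> x * y \<in> F k"
  using val_mult[of x y] by (cases "x = 0 \<or> y = 0") (auto simp: F_def)

lemma F_smult [intro]: "a \<in> F 0 \<Longrightarrow> x \<in> F n \<Longrightarrow> a * x \<in> F n"
  by (rule F_mult) auto

lemma F_1 [simp, intro]: "1 \<in> F 0"
  by (simp add: F_def)

definition has_val :: "int \<Rightarrow> 'k \<Rightarrow> bool" where
  "has_val n x \<longleftrightarrow> x \<noteq> 0 \<and> v x = n"

lemma has_val_iff: "has_val n x \<longleftrightarrow> x \<in> F n \<and> x \<notin> F (n + 1)"
  by (auto simp: has_val_def F_def)

lemma has_val_neq_0: "has_val n x \<Longrightarrow> x \<noteq> 0"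
  by (simp add: has_val_def)

lemma has_val_F: "has_val n x \<Longrightarrow> x \<in> F n"
  by (simp add: has_val_iff)

lemma has_val_mult: "has_val m x \<Longrightarrow> has_val n y \<Longrightarrow> k = m + n \<Longrightarrow> has_val k (x * y)"
  by (simp add: has_val_def val_mult)

lemma has_val_inverse: "has_val m x \<Longrightarrow> k = - m \<Longrightarrow> has_val k (inverse x)"
  by (simp add: has_val_def val_inverse)

lemma has_val_divide: "has_val m x \<Longrightarrow> has_val n y \<Longrightarrow> k = m - n \<Longrightarrow> has_val k (x / y)"
  by (simp add: has_val_def val_divide)

lemma has_val_uminus_iff [simp]: "has_val n (- x) \<longleftrightarrow> has_val n x"
  by (simp add: has_val_def)

lemma F_divide: "x \<in> F m \<Longrightarrow> has_val n y \<Longrightarrow> k \<le> m - n \<Longrightarrow> x / y \<in> F k"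
  unfolding divide_inverse
  by (rule F_mult[of x m _ "- n"]) (auto intro: has_val_F has_val_inverse)

lemma has_val_add: "has_val n x \<Longrightarrow> y \<in> F (n + 1) \<Longrightarrow> has_val n (x + y)"
  unfolding has_val_iff using F_diff[of "x + y" "n + 1" y] F_Suc[of y n] by auto

end

text \<open>The base field is present only as the fixed field of \<open>bar\<close>. Ramification is
  expressed by \<open>fixed_even\<close>, residue characteristic two by
  \<open>w_two\<close>.\<close>

locale ramified_involution = discrete_valuation w
  for w :: "'e::field \<Rightarrow> int" +
  fixes bar :: "'e \<Rightarrow> 'e" and \<pi> :: 'e
  assumes bar_add [simp]: "bar (x + y) = bar x + bar y"
    and bar_mult [simp]: "bar (x * y) = bar x * bar y"
    and bar_bar [simp]: "bar (bar x) = x"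
    and w_bar [simp]: "w (bar x) = w x"
    and fixed_even: "bar x = x \<Longrightarrow> x \<noteq> 0 \<Longrightarrow> even (w x)"
    and w_pi [simp]: "w \<pi> = 1"
    and pi_neq_0 [simp]: "\<pi> \<noteq> 0"
    and two_neq_0 [simp]: "(2::'e) \<noteq> 0"
    and w_two: "0 < w 2"
begin

lemma bar_0 [simp]: "bar 0 = 0"
  using bar_add[of 0 0] by (metis add.right_neutral add_cancel_left_right)

lemma bar_eq_0_iff [simp]: "bar x = 0 \<longleftrightarrow> x = 0"
  by (metis bar_0 bar_bar)

lemma bar_1 [simp]: "bar 1 = 1"
proof -
  have "bar 1 * bar 1 = bar 1" using bar_mult[of 1 1] by simp
  moreover have "bar 1 \<noteq> 0" by simp
  ultimately show ?thesis by simp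
qed

lemma bar_uminus [simp]: "bar (- x) = - bar x"
  by (metis add.right_inverse add_eq_0_iff bar_0 bar_add)

lemma bar_diff [simp]: "bar (x - y) = bar x - bar y"
  using bar_add[of x "- y"] by simp

lemma bar_inverse [simp]: "bar (inverse x) = inverse (bar x)"
proof (cases "x = 0")
  case False
  then have "bar x * bar (inverse x) = 1" by (simp flip: bar_mult)
  then show ?thesis by (metis inverse_unique)
qed simp

lemma bar_divide [simp]: "bar (x / y) = bar x / bar y"
  by (simp add: divide_inverse)

lemma bar_power [simp]: "bar (x ^ n) = bar x ^ n"
  by (induction n) auto

lemma bar_powi [simp]: "bar (x powi n) = bar x powi n"
  by (simp add: power_int_def)

lemma F_bar_iff [simp]: "bar x \<in> F n \<longleftrightarrow> x \<in> F n"
  by (auto simp: F_def)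

lemma F_2: "2 \<in> F 1"
  using w_two by (simp add: F_def)

lemma F_pi [simp, intro]: "\<pi> \<in> F 1"
  by (simp add: F_def)

lemma F_double: "x \<in> F n \<Longrightarrow> x + x \<in> F (n + 1)"
  using F_mult[OF F_2, of x n "n + 1"] by (metis add.commute mult_2 order_refl)

lemma F_pi_iff: "x / \<pi> \<in> F n \<longleftrightarrow> x \<in> F (n + 1)"
  by (cases "x = 0") (auto simp: F_def val_divide)

lemma has_val_bar_iff [simp]: "has_val n (bar x) \<longleftrightarrow> has_val n x"
  by (simp add: has_val_def)

text \<open>The integers are generated over the fixed integers by \<pi>, so this skew element
  generates the different.\<close>

definition \<delta> :: 'e where "\<delta> = \<pi> - bar \<pi>"

lemma delta_neq_0 [simp]: "\<delta> \<noteq> 0"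
  using fixed_even[of \<pi>] by (auto simp: \<delta>_def)

lemma bar_delta [simp]: "bar \<delta> = - \<delta>"
  by (simp add: \<delta>_def)

lemma fixed_F: "bar x = x \<Longrightarrow> x \<in> F n \<Longrightarrow> odd n \<Longrightarrow> x \<in> F (n + 1)"
  using fixed_even[of x] by (cases "w x = n") (auto simp: F_def)

lemma F_delta: "\<delta> \<in> F 2"
proof -
  have "\<pi> + bar \<pi> \<in> F (1 + 1)"
    by (rule fixed_F) (auto simp: add.commute)
  moreover have "2 * bar \<pi> \<in> F (1 + 1)"
    using F_mult[OF F_2, of "bar \<pi>" 1 2] by simp
  ultimately have "(\<pi> + bar \<pi>) - 2 * bar \<pi> \<in> F (1 + 1)" by (rule F_diff)
  then show ?thesis by (simp add: \<delta>_def algebra_simps)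
qed

text \<open>In \<open>x = a + b * \<pi>\<close> with a and b fixed, the two terms have valuations of
  different parity and cannot cancel, so b inherits its bound from x.\<close>

lemma decomposition:
  obtains b where "bar b = b" "x - bar x = b * \<delta>" "\<And>n. x \<in> F n \<Longrightarrow> b \<in> F (n - 1)"
proof -
  define b where "b = (x - bar x) / \<delta>"
  define a where "a = x - b * \<pi>"
  have bb: "bar b = b"
    by (simp add: b_def field_simps)
  have xb: "x - bar x = b * \<delta>"
    by (simp add: b_def)
  have "a - bar a = (x - bar x) - b * \<delta>"
    by (simp add: a_def bb \<delta>_def algebra_simps)
  then have aa: "bar a = a" using xb by simp
  have x: "x = a + b * \<pi>"
    by (simp add: a_def)
  have "b \<in> F (n - 1)" if "x \<in> F n" for n
  proof (rule ccontr)
    assume nb: "b \<notin> F (n - 1)"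
    then have b0: "b \<noteq> 0" "w b < n - 1" by (auto simp: F_def)
    have wb: "w (b * \<pi>) = w b + 1" using b0 by (simp add: val_mult)
    have evb: "even (w b)" using fixed_even bb b0 by auto
    have "a \<noteq> 0"
      using wb that b0 by (auto simp: x F_def)
    then have eva: "even (w a)" using fixed_even aa by auto
    have "has_val (w b + 1) (b * \<pi>)" "has_val (w a) a"
      using b0 wb \<open>a \<noteq> 0\<close> by (auto simp: has_val_def)
    then have "w x \<le> w b + 1 \<and> x \<noteq> 0"
    proof (cases "w a < w b + 1")
      case True
      then have "has_val (w a) (a + b * \<pi>)"
        using wb b0 by (intro has_val_add) (auto simp: \<open>a \<noteq> 0\<close> has_val_def F_def)
      then show ?thesis using True by (auto simp: x has_val_def)
    next
      case False
      then have "w a > w b + 1" using eva evb by presburger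
      then have "has_val (w b + 1) (b * \<pi> + a)"
        using wb b0 by (intro has_val_add) (auto simp: has_val_def F_def)
      then show ?thesis by (auto simp: x has_val_def add.commute)
    qed
    then show False using that b0 by (auto simp: F_def)
  qed
  with bb xb show thesis by (rule that)
qed

lemma F_bar_diff: "x \<in> F n \<Longrightarrow> x - bar x \<in> F (n + 1)"
proof -
  assume x: "x \<in> F n"
  obtain b where b: "x - bar x = b * \<delta>" "\<And>n. x \<in> F n \<Longrightarrow> b \<in> F (n - 1)"
    using decomposition[of x] by metis
  show ?thesis unfolding b(1) by (rule F_mult[OF b(2)[OF x] F_delta]) simp
qed

lemma F_tr: "x \<in> F n \<Longrightarrow> tr bar x \<in> F (n + 1)"
  using F_diff[OF F_double F_bar_diff, of x n x] by (simp add: tr_def)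

text \<open>Dividing \<pi> by the skew \<delta> produces trace one. Among the elements of trace one
  this has the largest possible valuation, \<open>1 - w \<delta>\<close>.\<close>

definition \<alpha> :: 'e where "\<alpha> = \<pi> / \<delta>"

lemma tr_alpha: "tr bar \<alpha> = 1"
  by (simp add: \<alpha>_def tr_def field_simps) (simp add: \<delta>_def)

lemma alpha_neq_0 [simp]: "\<alpha> \<noteq> 0"
  by (simp add: \<alpha>_def)

text \<open>This lets a hermitian norm carry a quadratic form. The error is
  \<open>(\<alpha> - 1) * (x - bar x)\<close>, where \<open>\<alpha> - 1 = - bar \<alpha>\<close>
  cancels the factor \<delta> of \<open>x - bar x\<close> up to a uniformizer.\<close>

lemma tr_alpha_mult: "x \<in> F 0 \<Longrightarrow> tr bar (\<alpha> * x) - x \<in> F 1"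
proof -
  assume x: "x \<in> F 0"
  obtain b where bb: "bar b = b" and b: "x - bar x = b * \<delta>" "\<And>n. x \<in> F n \<Longrightarrow> b \<in> F (n - 1)"
    using decomposition[of x] by metis
  have "b \<in> F 0" using fixed_F[OF bb b(2)[OF x]] by simp
  have "bar \<alpha> = 1 - \<alpha>" using tr_alpha by (simp add: tr_def algebra_simps)
  then have "tr bar (\<alpha> * x) - x = (\<alpha> - 1) * (x - bar x)"
    by (simp only: tr_def bar_mult) (simp add: algebra_simps)
  also have "\<dots> = - (bar \<alpha> * \<delta>) * b"
    unfolding b(1) \<open>bar \<alpha> = 1 - \<alpha>\<close> by (simp add: algebra_simps)
  also have "bar \<alpha> * \<delta> = - bar \<pi>"
    by (simp add: \<alpha>_def)
  finally show ?thesis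
    using F_mult[of "bar \<pi>" 1 b 0 1] \<open>b \<in> F 0\<close> by simp
qed

lemma bar_alpha_cong: "bar \<alpha> / \<alpha> - 1 \<in> F 1"
proof -
  have "bar \<alpha> / \<alpha> = - bar \<pi> / \<pi>" by (simp add: \<alpha>_def field_simps)
  then have "bar \<alpha> / \<alpha> - 1 = - (\<pi> + bar \<pi>) / \<pi>" by (simp add: field_simps)
  moreover have "\<pi> + bar \<pi> \<in> F (1 + 1)"
    by (rule fixed_F) (auto simp: add.commute)
  ultimately show ?thesis by (metis F_pi_iff F_uminus_iff)
qed

text \<open>Skew elements are fixed multiples of \<delta>, so their valuations form one parity
  class, filled by powers of \<open>\<pi> * bar \<pi>\<close>. The irregular case can arise only at
  levels of the other parity.\<close>

lemma trace_zero: "\<exists>\<theta>. tr bar \<theta> = 0 \<and> (has_val n \<theta> \<or> has_val (n + 1) \<theta>)"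
proof -
  define j where "j = (n + 1 - w \<delta>) div 2"
  define \<theta> where "\<theta> = (\<pi> * bar \<pi>) powi j * \<delta>"
  have "w \<theta> = 2 * j + w \<delta>" "\<theta> \<noteq> 0"
    by (auto simp: \<theta>_def val_mult val_powi)
  then have "has_val n \<theta> \<or> has_val (n + 1) \<theta>"
    unfolding j_def has_val_def by presburger
  moreover have "tr bar \<theta> = 0"
    by (simp add: \<theta>_def tr_def mult.commute)
  ultimately show ?thesis by blast
qed

lemma trace_zero':
  assumes "\<nexists>\<theta>. tr bar \<theta> = 0 \<and> has_val n \<theta>"
  obtains \<theta> where "tr bar \<theta> = 0" "has_val (n + 1) \<theta>"
  using trace_zero[of n] assms by blast

definition TrF :: "int \<Rightarrow> 'e set" where "TrF n = tr bar ` F n"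

lemma tr_add: "tr bar (x + y) = tr bar x + tr bar y"
  by (simp add: tr_def)

lemma tr_uminus: "tr bar (- x) = - tr bar x"
  by (simp add: tr_def)

lemma TrF_add: "x \<in> TrF n \<Longrightarrow> y \<in> TrF n \<Longrightarrow> x + y \<in> TrF n"
  unfolding TrF_def image_iff by (metis tr_add F_add)

lemma TrF_uminus: "x \<in> TrF n \<Longrightarrow> - x \<in> TrF n"
  unfolding TrF_def image_iff by (metis tr_uminus F_uminus_iff)

lemma TrF_smult: "x \<in> TrF n \<Longrightarrow> bar a = a \<Longrightarrow> a \<in> F 0 \<Longrightarrow> a * x \<in> TrF n"
proof -
  assume "x \<in> TrF n" and a: "bar a = a" "a \<in> F 0"
  then obtain y where y: "y \<in> F n" "x = tr bar y" by (auto simp: TrF_def)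
  then have "a * x = tr bar (a * y)" using a by (simp add: tr_def algebra_simps)
  then show ?thesis using y a by (auto simp: TrF_def)
qed

lemma TrF_I: "x \<in> F n \<Longrightarrow> tr bar x \<in> TrF n"
  by (simp add: TrF_def)

text \<open>Multiplication by \<alpha> is a section of the trace on fixed elements.\<close>

lemma TrF_large: "bar x = x \<Longrightarrow> x \<in> F (n - w \<alpha>) \<Longrightarrow> x \<in> TrF n"
proof -
  assume x: "bar x = x" "x \<in> F (n - w \<alpha>)"
  then have "x = tr bar (\<alpha> * x)"
    using tr_alpha by (simp add: tr_def flip: distrib_right)
  moreover have "\<alpha> * x \<in> F n"
    by (rule F_mult[of _ "w \<alpha>"]) (use x in \<open>auto simp: F_def\<close>)
  ultimately show ?thesis unfolding TrF_def by blast
qed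

text \<open>Equality of classes in the associated graded ring, a commutative ring of characteristic two
  on which the involution is trivial.\<close>

definition gr_eq :: "int \<Rightarrow> 'e \<Rightarrow> 'e \<Rightarrow> bool" where
  "gr_eq n x y \<longleftrightarrow> x \<in> F n \<and> y \<in> F n \<and> x - y \<in> F (n + 1)"

lemma gr_eq_refl: "x \<in> F n \<Longrightarrow> gr_eq n x x"
  by (simp add: gr_eq_def)

lemma gr_eq_sym: "gr_eq n x y \<Longrightarrow> gr_eq n y x"
  by (auto simp: gr_eq_def F_minus_commute)

lemma gr_eq_trans [trans]: "gr_eq n x y \<Longrightarrow> gr_eq n y z \<Longrightarrow> gr_eq n x z"
  unfolding gr_eq_def using F_add[of "x - y" "n + 1" "y - z"] by auto

lemma gr_eq_add: "gr_eq n x y \<Longrightarrow> gr_eq n x' y' \<Longrightarrow> gr_eq n (x + x') (y + y')"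
  unfolding gr_eq_def using F_add[of "x - y" "n + 1" "x' - y'"] by (auto simp: algebra_simps)

lemma gr_eq_uminus: "gr_eq n x y \<Longrightarrow> gr_eq n (- x) (- y)"
  unfolding gr_eq_def using F_uminus_iff[of "x - y" "n + 1"] by (auto simp: algebra_simps)

lemma gr_eq_diff: "gr_eq n x y \<Longrightarrow> gr_eq n x' y' \<Longrightarrow> gr_eq n (x - x') (y - y')"
  using gr_eq_add[OF _ gr_eq_uminus, of n x y x' y'] by simp

lemma gr_eq_mult: "gr_eq m x y \<Longrightarrow> gr_eq n x' y' \<Longrightarrow> k = m + n \<Longrightarrow> gr_eq k (x * x') (y * y')"
proof -
  assume *: "gr_eq m x y" "gr_eq n x' y'" and k: "k = m + n"
  have "(x - y) * x' \<in> F (k + 1)" "y * (x' - y') \<in> F (k + 1)"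
    using * F_mult[of "x - y" "m + 1" x' n "k + 1"] F_mult[of y m "x' - y'" "n + 1" "k + 1"] k
    by (auto simp: gr_eq_def)
  then have "(x - y) * x' + y * (x' - y') \<in> F (k + 1)" by (rule F_add)
  then show ?thesis using * k
    by (auto simp: gr_eq_def algebra_simps intro: F_mult)
qed

lemma gr_eq_ex: "gr_eq n x y \<Longrightarrow> has_val n x \<longleftrightarrow> has_val n y"
  unfolding gr_eq_def has_val_iff
  using F_diff[of x "n + 1" "x - y"] F_add[of y "n + 1" "x - y"] by auto

lemma gr_eq_bar: "x \<in> F n \<Longrightarrow> gr_eq n (bar x) x"
  using F_bar_diff[of x n] by (auto simp: gr_eq_def F_minus_commute)

lemma gr_eq_neg: "x \<in> F n \<Longrightarrow> gr_eq n (- x) x"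
  using F_double[of x n] F_uminus_iff[of "x + x" "n + 1"] by (auto simp: gr_eq_def)

lemma gr_eq_0_iff: "gr_eq n x 0 \<longleftrightarrow> x \<in> F (n + 1)"
  using F_Suc[of x n] by (auto simp: gr_eq_def)

lemma gr_eq_inverse:
  assumes "gr_eq n x y" "has_val n x"
  shows "gr_eq (- n) (inverse x) (inverse y)"
proof -
  have y: "has_val n y" using assms gr_eq_ex by blast
  have "(y - x) * (inverse x * inverse y) \<in> F (- n + 1)"
  proof (rule F_mult)
    show "y - x \<in> F (n + 1)" using assms by (simp add: gr_eq_def F_minus_commute)
    show "inverse x * inverse y \<in> F (- n - n)"
      by (rule has_val_F, rule has_val_mult[OF has_val_inverse[OF assms(2)] has_val_inverse[OF y]]) auto
  qed simp
  moreover have "(y - x) * (inverse x * inverse y) = inverse x - inverse y"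
    using assms y by (simp add: has_val_def field_simps)
  ultimately show ?thesis
    unfolding gr_eq_def using has_val_F has_val_inverse assms y by auto
qed

lemma gr_eq_divide:
  assumes "gr_eq m x y" "gr_eq n x' y'" "has_val n x'" "k = m - n"
  shows "gr_eq k (x / x') (y / y')"
  unfolding divide_inverse using gr_eq_mult[OF assms(1) gr_eq_inverse[OF assms(2,3)]] assms(4) by simp

lemma gr_eq_I: "x \<in> F n \<Longrightarrow> y \<in> F (n + 1) \<Longrightarrow> z = x + y \<Longrightarrow> gr_eq n z x"
  using F_Suc[of y n] by (auto simp: gr_eq_def)

end

text \<open>Modulo P the norm \<open>c * bar c\<close> is the square of c, so the assumption says
  that residues of fixed units are squares.\<close>

locale perfect_ramified_involution = ramified_involution +
  assumes perfect: "bar a = a \<Longrightarrow> w a = 0 \<Longrightarrow> \<exists>c. w c = 0 \<and> c * bar c - a \<in> F 1"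
begin

text \<open>Successive approximation. As \<open>a / e\<close> has even valuation, a power of
  \<open>\<pi> * bar \<pi>\<close> makes it a unit, and units are norms modulo P; this removes the
  leading term of a. Norms are not additive, but the cross term of \<open>c1 + c2\<close> is a trace
  from \<open>F l\<close>, which is allowed. Once a is deep enough, \<open>TrF_large\<close> ends
  the process.\<close>

lemma norm_approx:
  assumes "bar e = e" "e \<in> F l" "e \<noteq> 0"
  shows "bar a = a \<Longrightarrow> a \<in> F (w e) \<Longrightarrow> \<exists>c\<in>F 0. a + c * bar c * e \<in> TrF l"
proof (induction "nat (l - w \<alpha> - w a)" arbitrary: a rule: less_induct)
  case less
  show ?case
  proof (cases "a \<in> F (l - w \<alpha>)")
    case True
    then have "a \<in> TrF l" using TrF_large less.prems by blast
    then show ?thesis by (intro bexI[of _ 0]) auto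
  next
    case False
    then have a: "a \<noteq> 0" "w a < l - w \<alpha>" "w e \<le> w a" using less.prems by (auto simp: F_def)
    define j where "j = (w a - w e) div 2"
    have j: "w a - w e = 2 * j" "j \<ge> 0"
      using fixed_even[of a] fixed_even[of e] assms less.prems a by (auto simp: j_def)
    define b where "b = - (a / e) / (\<pi> * bar \<pi>) powi j"
    have bb: "bar b = b"
      using assms less.prems by (simp add: b_def mult.commute)
    have "w b = 0"
      using a assms(3) j(1) by (simp add: b_def val_divide val_powi val_mult)
    then obtain c where c: "w c = 0" "c * bar c - b \<in> F 1"
      using perfect bb by blast
    have cF: "c \<in> F 0" using c by (simp add: F_def)
    define c1 where "c1 = c * \<pi> powi j"
    have "w (\<pi> powi j) = j" by (simp add: val_powi)
    then have "\<pi> powi j \<in> F 0" using j by (simp add: F_def)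
    then have c1F: "c1 \<in> F 0" unfolding c1_def using cF by auto
    define a1 where "a1 = a + c1 * bar c1 * e"
    have be: "b * ((\<pi> * bar \<pi>) powi j * e) = - a"
      using assms(3) by (simp add: b_def)
    have "a1 = (c * bar c - b) * ((\<pi> * bar \<pi>) powi j * e)"
      by (simp only: left_diff_distrib be a1_def c1_def)
        (simp add: power_int_mult_distrib algebra_simps)
    moreover have "\<dots> \<in> F (w a + 1)"
      by (rule F_mult[OF c(2), of _ "w a"])
        (use a assms(3) j in \<open>auto simp: F_def val_mult val_powi\<close>)
    ultimately have a1F: "a1 \<in> F (w a + 1)" by simp
    have a1b: "bar a1 = a1" using less.prems assms by (simp add: a1_def mult.commute)
    have "\<exists>c\<in>F 0. a1 + c * bar c * e \<in> TrF l"
    proof (cases "a1 = 0")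
      case True
      then show ?thesis using TrF_I[of 0 l] by (intro bexI[of _ 0]) (auto simp: tr_def)
    next
      case False
      then have "w a < w a1" using a1F by (auto simp: F_def)
      then show ?thesis using less.hyps[of a1] a a1b a1F by (auto simp: F_def)
    qed
    then obtain c2 where c2: "c2 \<in> F 0" "a1 + c2 * bar c2 * e \<in> TrF l" by blast
    have "tr bar (c1 * bar c2 * e) \<in> TrF l"
      using F_mult[OF F_mult[OF c1F, of "bar c2" 0 0] assms(2)] c2(1) by (auto intro: TrF_I)
    with c2(2) have "a1 + c2 * bar c2 * e + tr bar (c1 * bar c2 * e) \<in> TrF l"
      by (rule TrF_add)
    then have "a + (c1 + c2) * bar (c1 + c2) * e \<in> TrF l"
      using assms by (simp add: a1_def tr_def algebra_simps)
    then show ?thesis using c1F c2 by blast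
  qed
qed

end

section \<open>Symmetries of a lattice\<close>

locale integral_hermitian_space =
  ramified_involution w bar \<pi> + hermitian_space scale bar V h
  for w :: "'e::field \<Rightarrow> int" and bar and \<pi>
    and scale :: "'e \<Rightarrow> 'v::ab_group_add \<Rightarrow> 'v" and V h
begin

lemmas V_add = subspace_add[OF V_subspace]
  and V_diff = subspace_diff[OF V_subspace]
  and V_scale = subspace_scale[OF V_subspace]
  and V_0 = subspace_0[OF V_subspace]

lemma form_add_right: "x \<in> V \<Longrightarrow> y \<in> V \<Longrightarrow> z \<in> V \<Longrightarrow> h x (y + z) = h x y + h x z"
  using form_hermitian[of x "y + z"] form_hermitian[of x y] form_hermitian[of x z]
  by (simp add: form_add V_add)

lemma form_scale_right: "x \<in> V \<Longrightarrow> y \<in> V \<Longrightarrow> h x (scale a y) = bar a * h x y"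
  using form_hermitian[of x "scale a y"] form_hermitian[of x y]
  by (simp add: form_scale V_scale)

lemma form_0_left: "x \<in> V \<Longrightarrow> h 0 x = 0"
  using form_scale[of x x 0] by simp

lemma form_0_right: "x \<in> V \<Longrightarrow> h x 0 = 0"
  using form_scale_right[of x x 0] by simp

lemma form_diff: "x \<in> V \<Longrightarrow> y \<in> V \<Longrightarrow> z \<in> V \<Longrightarrow> h (x - y) z = h x z - h y z"
  using form_add[of "x - y" y z] by (simp add: V_diff)

lemma form_diff_right: "x \<in> V \<Longrightarrow> y \<in> V \<Longrightarrow> z \<in> V \<Longrightarrow> h x (y - z) = h x y - h x z"
  using form_add_right[of x "y - z" z] by (simp add: V_diff)

lemmas V_closed = V_add V_diff V_scale V_0
lemmas form_simps = form_add form_add_right form_diff form_diff_right form_scale form_scale_right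
  form_0_left form_0_right

lemma form_self_fixed: "x \<in> V \<Longrightarrow> bar (h x x) = h x x"
  using form_hermitian[of x x] by simp

abbreviation ospan :: "'v set \<Rightarrow> 'v set" where
  "ospan \<equiv> span_over scale (F 0)"

lemma ospan_0: "0 \<in> ospan S"
  unfolding span_over_def by (intro CollectI exI[of _ "{}"]) auto

lemma ospan_base: "s \<in> S \<Longrightarrow> s \<in> ospan S"
  unfolding span_over_def by (intro CollectI exI[of _ "{s}"] exI[of _ "\<lambda>_. 1"]) auto

lemma ospan_scale: "x \<in> ospan S \<Longrightarrow> a \<in> F 0 \<Longrightarrow> scale a x \<in> ospan S"
proof -
  assume x: "x \<in> ospan S" and a: "a \<in> F 0"
  then obtain T r where T: "finite T" "T \<subseteq> S" "\<forall>s\<in>T. r s \<in> F 0" "x = (\<Sum>s\<in>T. scale (r s) s)"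
    by (auto simp: span_over_def)
  have "scale a x = (\<Sum>s\<in>T. scale (a * r s) s)"
    by (simp add: T(4) scale_sum_right)
  moreover have "\<forall>s\<in>T. a * r s \<in> F 0" using T a by auto
  ultimately show ?thesis unfolding span_over_def using T(1,2)
    by (intro CollectI exI[of _ T] exI[of _ "\<lambda>s. a * r s"]) auto
qed

lemma ospan_add: "x \<in> ospan S \<Longrightarrow> y \<in> ospan S \<Longrightarrow> x + y \<in> ospan S"
proof -
  assume "x \<in> ospan S" "y \<in> ospan S"
  then obtain T r T' r' where
    T: "finite T" "T \<subseteq> S" "\<forall>s\<in>T. r s \<in> F 0" "x = (\<Sum>s\<in>T. scale (r s) s)" and
    T': "finite T'" "T' \<subseteq> S" "\<forall>s\<in>T'. r' s \<in> F 0" "y = (\<Sum>s\<in>T'. scale (r' s) s)"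
    unfolding span_over_def by blast
  define q where "q s = (if s \<in> T then r s else 0) + (if s \<in> T' then r' s else 0)" for s
  have "x = (\<Sum>s\<in>T \<union> T'. scale (if s \<in> T then r s else 0) s)"
    unfolding T(4) by (rule sum.mono_neutral_cong_left) (use T T' in auto)
  moreover have "y = (\<Sum>s\<in>T \<union> T'. scale (if s \<in> T' then r' s else 0) s)"
    unfolding T'(4) by (rule sum.mono_neutral_cong_left) (use T T' in auto)
  ultimately have "x + y = (\<Sum>s\<in>T \<union> T'. scale (q s) s)"
    by (simp add: q_def scale_left_distrib sum.distrib)
  moreover have "\<forall>s\<in>T \<union> T'. q s \<in> F 0" using T T' by (auto simp: q_def)
  ultimately show ?thesis unfolding span_over_def using T(1,2) T'(1,2)
    by (intro CollectI exI[of _ "T \<union> T'"] exI[of _ q]) auto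
qed

lemma ospan_diff: "x \<in> ospan S \<Longrightarrow> y \<in> ospan S \<Longrightarrow> x - y \<in> ospan S"
  using ospan_add[of x S "scale (- 1) y"] ospan_scale[of y S "- 1"] by simp

lemma ospan_induct [consumes 1, case_names zero step]:
  assumes "x \<in> ospan S" "P 0"
    and step: "\<And>a s y. a \<in> F 0 \<Longrightarrow> s \<in> S \<Longrightarrow> y \<in> ospan S \<Longrightarrow> P y \<Longrightarrow> P (scale a s + y)"
  shows "P x"
proof -
  obtain T r where T: "finite T" "T \<subseteq> S" "\<forall>s\<in>T. r s \<in> F 0" "x = (\<Sum>s\<in>T. scale (r s) s)"
    using assms(1) by (auto simp: span_over_def)
  have "P (\<Sum>s\<in>T. scale (r s) s) \<and> (\<Sum>s\<in>T. scale (r s) s) \<in> ospan S"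
    using T(1-3)
  proof (induction T)
    case empty
    then show ?case using assms(2) ospan_0 by simp
  next
    case (insert t T)
    then show ?case by (auto intro!: step ospan_add[OF ospan_scale[OF ospan_base]])
  qed
  then show ?thesis by (simp add: T(4))
qed

lemma ospan_V: "S \<subseteq> V \<Longrightarrow> x \<in> ospan S \<Longrightarrow> x \<in> V"
proof -
  assume S: "S \<subseteq> V" and "x \<in> ospan S"
  from this(2) show "x \<in> V" by (induction rule: ospan_induct) (use S in \<open>auto intro: V_closed\<close>)
qed

lemma form_ospan_F:
  assumes "x \<in> ospan S" "S \<subseteq> V" "y \<in> V" "\<And>s. s \<in> S \<Longrightarrow> h s y \<in> F n"
  shows "h x y \<in> F n"
  using assms(1)
proof (induction rule: ospan_induct)
  case zero
  then show ?case using assms by (simp add: form_0_left)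
next
  case (step a s z)
  then have "s \<in> V" "z \<in> V" using assms(2) ospan_V by auto
  then show ?case using step assms by (simp add: form_simps V_closed) blast
qed

text \<open>This would be immediate from a diagonal form of the pairing between \<open>ospan S\<close> and \<open>B\<close>, with
  different bases on the two sides; the proof splits off one diagonal entry of minimal valuation at
  a time.\<close>

lemma residual_splitting:
  assumes "finite S" "S \<subseteq> V" "B \<subseteq> V"
    and "\<And>a y z. y \<in> B \<Longrightarrow> z \<in> B \<Longrightarrow> a \<in> F 0 \<Longrightarrow> y - scale a z \<in> B"
    and "\<And>s y. s \<in> S \<Longrightarrow> y \<in> B \<Longrightarrow> h s y \<in> F n"
    and "x \<in> ospan S" "\<And>y. y \<in> B \<Longrightarrow> h x y \<in> F l"
    and "\<And>y. y \<in> B \<Longrightarrow> (\<And>s. s \<in> S \<Longrightarrow> h s y \<in> F l) \<Longrightarrow> h x y \<in> F (l + 1)"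
  shows "\<exists>z\<in>ospan S. \<forall>y\<in>B. h (x - scale \<pi> z) y \<in> F (l + 1)"
  using assms
proof (induction "card S" arbitrary: S B x rule: less_induct)
  case (less S B x)
  have SV: "s \<in> V" if "s \<in> S" for s using less.prems that by auto
  have BV: "y \<in> V" if "y \<in> B" for y using less.prems that by auto
  have xV: "x \<in> V" using less.prems ospan_V by blast
  show ?case
  proof (cases "\<forall>s\<in>S. \<forall>y\<in>B. h s y \<in> F (l + 1)")
    case True
    then have "h x y \<in> F (l + 1)" if "y \<in> B" for y
      using form_ospan_F[OF less.prems(6,2)] that BV by blast
    then show ?thesis by (intro bexI[of _ 0] ospan_0) auto
  next
    case False
    then obtain s0 y0 where 0: "s0 \<in> S" "y0 \<in> B" "h s0 y0 \<notin> F (l + 1)" by blast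
    define Q where "Q p \<longleftrightarrow> fst p \<in> S \<and> snd p \<in> B \<and> h (fst p) (snd p) \<noteq> 0" for p
    \<comment> \<open>All these values lie in \<open>F n\<close>, so \<open>nat\<close> truncates
      nothing.\<close>
    define m where "m p = nat (w (h (fst p) (snd p)) - n)" for p
    have Q0: "Q (s0, y0)" using 0 by (auto simp: Q_def)
    obtain p where p: "Q p" "\<And>q. Q q \<Longrightarrow> m p \<le> m q"
      using arg_min_nat_lemma[of Q "(s0, y0)" m] Q0 by blast
    define e e' where "e = fst p" "e' = snd p"
    define i where "i = w (h e e')"
    have e: "e \<in> S" "e' \<in> B" "h e e' \<noteq> 0" using p by (auto simp: Q_def e_e'_def)
    have eV: "e \<in> V" "e' \<in> V" using e SV BV by auto
    have min: "h s y \<in> F i" if "s \<in> S" "y \<in> B" for s y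
    proof (cases "h s y = 0")
      case False
      then have "m p \<le> m (s, y)" using p that by (auto simp: Q_def)
      moreover have "n \<le> w (h s y)" using less.prems(5)[OF that] False by (simp add: F_def)
      ultimately show ?thesis unfolding m_def i_def e_e'_def F_def by auto
    qed simp
    have exi: "has_val i (h e e')" using e by (simp add: has_val_def i_def)
    have il: "i \<le> l"
      using min[OF 0(1,2)] 0(3) F_mono[of "h s0 y0" i "l + 1"] by force
    define c where "c g = h g e' / h e e'" for g
    define P where "P g = g - scale (c g) e" for g
    have cF: "c g \<in> F 0" if "g \<in> S" for g
      unfolding c_def using min[OF that e(2)] exi by (intro F_divide) auto
    have PV: "P g \<in> V" if "g \<in> V" for g using that eV by (simp add: P_def V_closed)
    have Pe': "h (P g) e' = 0" if "g \<in> V" for g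
      using that eV e by (simp add: P_def form_simps V_closed c_def)
    define S' where "S' = P ` (S - {e})"
    define B' where "B' = {y \<in> B. h e y = 0}"
    have hP: "h (P g) y = h g y" if "g \<in> V" "y \<in> B'" for g y
      using that BV eV by (simp add: P_def B'_def form_simps V_closed)
    have card: "card S' < card S"
      unfolding S'_def using card_image_le[of "S - {e}" P] less.prems(1) e(1)
      by (metis card_Diff1_less finite_Diff le_less_trans)
    have S'V: "S' \<subseteq> V" using SV PV by (auto simp: S'_def)
    have S'S: "z \<in> ospan S" if "z \<in> ospan S'" for z
      using that
    proof (induction rule: ospan_induct)
      case (step a s y)
      then have "s \<in> ospan S"
        by (auto simp: S'_def P_def intro!: ospan_diff[OF ospan_base ospan_scale[OF ospan_base]] cF e)
      then show ?case using step by (intro ospan_add ospan_scale)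
    qed (rule ospan_0)
    have Px: "P x \<in> ospan S'"
      using less.prems(6)
    proof (induction rule: ospan_induct)
      case zero
      then show ?case by (simp add: P_def c_def form_0_left eV ospan_0)
    next
      case (step a s y)
      then have sy: "s \<in> V" "y \<in> V" using SV less.prems(2) ospan_V by auto
      then have "P (scale a s + y) = scale a (P s) + P y"
        using eV by (simp add: P_def c_def form_simps V_closed add_divide_distrib
            scale_left_distrib scale_right_diff_distrib)
      moreover have "P s \<in> ospan S'"
      proof (cases "s = e")
        case True
        then have "P s = 0" using e by (simp add: P_def c_def)
        then show ?thesis using ospan_0 by simp
      qed (use step in \<open>auto simp: S'_def intro: ospan_base\<close>)
      ultimately show ?case using step by (auto intro: ospan_add ospan_scale)
    qed
    \<comment> \<open>For \<open>i < l\<close> the bound on \<open>h x e'\<close> suffices. For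
      \<open>i = l\<close> minimality puts every \<open>h s e'\<close> into \<open>F l\<close>, so
      the last hypothesis supplies the missing level.\<close>
    have cx: "c x \<in> F 1"
    proof (cases "i < l")
      case True
      then show ?thesis unfolding c_def
        by (intro F_divide[OF less.prems(7)[OF e(2)] exi]) auto
    next
      case False
      then have "h x e' \<in> F (l + 1)" using min e(2) il by (intro less.prems(8)) auto
      then show ?thesis unfolding c_def using False il by (intro F_divide[OF _ exi]) auto
    qed
    have "\<exists>z\<in>ospan S'. \<forall>y\<in>B'. h (P x - scale \<pi> z) y \<in> F (l + 1)"
    proof (rule less.hyps[OF card])
      show "finite S'" using less.prems(1) by (simp add: S'_def)
      show "S' \<subseteq> V" by (rule S'V)
      show "B' \<subseteq> V" using BV by (auto simp: B'_def)
      show "y - scale a z \<in> B'" if "y \<in> B'" "z \<in> B'" "a \<in> F 0" for a y z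
        using that less.prems(4) eV BV by (auto simp: B'_def form_simps V_closed)
      show "h s y \<in> F n" if "s \<in> S'" "y \<in> B'" for s y
        using that less.prems(5) hP SV by (auto simp: S'_def B'_def)
      show "P x \<in> ospan S'" by (rule Px)
      show "h (P x) y \<in> F l" if "y \<in> B'" for y
        using that less.prems(7) hP[OF xV] by (auto simp: B'_def)
      show "h (P x) y \<in> F (l + 1)" if y: "y \<in> B'" "\<And>s. s \<in> S' \<Longrightarrow> h s y \<in> F l" for y
      proof -
        have "h s y \<in> F l" if "s \<in> S" for s
        proof (cases "s = e")
          case True
          then show ?thesis using y by (simp add: B'_def)
        next
          case False
          then show ?thesis using y(2)[of "P s"] hP[of s y] y(1) SV that by (auto simp: S'_def)
        qed
        then show ?thesis using less.prems(8)[of y] y hP[OF xV y(1)] by (auto simp: B'_def)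
      qed
    qed
    then obtain z where z: "z \<in> ospan S'" "\<And>y. y \<in> B' \<Longrightarrow> h (P x - scale \<pi> z) y \<in> F (l + 1)"
      by blast
    have zV: "z \<in> V" using z S'V ospan_V by blast
    have ze': "h z e' = 0"
      using z(1)
    proof (induction rule: ospan_induct)
      case (step a s y)
      then have "h s e' = 0" "s \<in> V" "y \<in> V" using Pe' SV S'V ospan_V by (auto simp: S'_def)
      then show ?case using step eV by (simp add: form_simps V_closed)
    qed (simp add: form_0_left eV)
    \<comment> \<open>As \<open>c x\<close> lies in P, the component of x along e is \<pi> times an
      integral multiple of e, which moves into the new z.\<close>
    define z' where "z' = z + scale (c x / \<pi>) e"
    have eq: "x - scale \<pi> z' = P x - scale \<pi> z"
      by (simp add: z'_def P_def scale_right_distrib)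
    show ?thesis
    proof (intro bexI[of _ z'] ballI)
      show "z' \<in> ospan S"
        unfolding z'_def using cx F_pi_iff[of "c x" 0]
        by (auto intro!: ospan_add[OF S'S[OF z(1)] ospan_scale[OF ospan_base]] e)
      fix y assume y: "y \<in> B"
      define a where "a = bar (h e y / h e e')"
      have aF: "a \<in> F 0" unfolding a_def F_bar_iff using min[OF e(1) y] exi by (intro F_divide) auto
      have yV: "y \<in> V" using y BV by simp
      have "h e (y - scale a e') = 0"
        using eV yV e by (simp add: form_simps V_closed a_def)
      then have "y - scale a e' \<in> B'"
        using y e less.prems(4) aF by (auto simp: B'_def)
      moreover have "h (P x - scale \<pi> z) (y - scale a e') = h (P x - scale \<pi> z) y"
        using Pe'[OF xV] ze' yV eV zV PV[OF xV] by (simp add: form_simps V_closed)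
      ultimately show "h (x - scale \<pi> z') y \<in> F (l + 1)" using z(2) eq by metis
    qed
  qed
qed

end

section \<open>Symmetries, and the defect \<open>D f\<close> of an isometry\<close>

context integral_hermitian_space
begin

abbreviation U :: "'v set \<Rightarrow> ('v \<Rightarrow> 'v) set" where
  "U L \<equiv> lattice_unitary_group scale V h L"

abbreviation G :: "'v set \<Rightarrow> ('v \<Rightarrow> 'v) set" where
  "G L \<equiv> symmetry_group scale bar V h L"

abbreviation Sy :: "'v \<Rightarrow> 'e \<Rightarrow> 'v \<Rightarrow> 'v" where
  "Sy \<equiv> symmetry scale V h"

lemma U_iff:
  "f \<in> U L \<longleftrightarrow> f \<in> extensional V \<and> bij_betw f V V \<and>
     (\<forall>x\<in>V. \<forall>y\<in>V. f (x + y) = f x + f y) \<and> (\<forall>a. \<forall>x\<in>V. f (scale a x) = scale a (f x)) \<and>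
     (\<forall>x\<in>V. \<forall>y\<in>V. h (f x) (f y) = h x y) \<and> f ` L = L"
  by (auto simp: lattice_unitary_group_def unitary_group_def BijGroup_def Bij_def)

lemma U_V: "f \<in> U L \<Longrightarrow> x \<in> V \<Longrightarrow> f x \<in> V"
  by (auto simp: U_iff bij_betw_def)

lemma U_add: "f \<in> U L \<Longrightarrow> x \<in> V \<Longrightarrow> y \<in> V \<Longrightarrow> f (x + y) = f x + f y"
  by (simp add: U_iff)

lemma U_scale: "f \<in> U L \<Longrightarrow> x \<in> V \<Longrightarrow> f (scale a x) = scale a (f x)"
  by (simp add: U_iff)

lemma U_form: "f \<in> U L \<Longrightarrow> x \<in> V \<Longrightarrow> y \<in> V \<Longrightarrow> h (f x) (f y) = h x y"
  by (simp add: U_iff)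

lemma U_L: "f \<in> U L \<Longrightarrow> x \<in> L \<Longrightarrow> f x \<in> L"
  by (auto simp: U_iff)

lemma U_surj: "f \<in> U L \<Longrightarrow> y \<in> L \<Longrightarrow> \<exists>x\<in>L. f x = y"
  unfolding U_iff by (metis imageE)

lemma U_Bij: "f \<in> U L \<Longrightarrow> f \<in> Bij V"
  by (simp add: U_iff Bij_def)

lemma U_compose:
  assumes "f \<in> U L" "g \<in> U L" "L \<subseteq> V"
  shows "compose V f g \<in> U L"
proof -
  have "compose V f g \<in> Bij V" using assms by (intro compose_Bij U_Bij)
  moreover have "compose V f g ` L = f ` g ` L"
    using assms(3) by (auto simp: compose_def image_iff)
  ultimately show ?thesis
    using assms by (auto simp: U_iff Bij_def compose_def V_closed U_V)
qed

lemma Sy_apply: "x \<in> V \<Longrightarrow> Sy t \<tau> x = x - scale (h x t / \<tau>) t"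
  by (simp add: symmetry_def divide_inverse)

lemma Sy_V: "t \<in> V \<Longrightarrow> x \<in> V \<Longrightarrow> Sy t \<tau> x \<in> V"
  by (simp add: Sy_apply V_closed)

text \<open>The coefficient of t in the composite vanishes because
  \<open>h t t = \<tau> + bar \<tau>\<close>. Conjugating the parameter thus inverts a
  symmetry.\<close>

lemma Sy_Sy_bar:
  assumes t: "t \<in> V" "\<tau> \<noteq> 0" "h t t = tr bar \<tau>" and x: "x \<in> V"
  shows "Sy t \<tau> (Sy t (bar \<tau>) x) = x"
proof -
  have "Sy t \<tau> (Sy t (bar \<tau>) x) = x - scale (h x t / bar \<tau> + (h x t - h x t / bar \<tau> * h t t) / \<tau>) t"
    using t x by (simp add: Sy_apply V_closed form_simps scale_left_distrib)
  also have "h x t / bar \<tau> + (h x t - h x t / bar \<tau> * h t t) / \<tau> = 0"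
    using t by (simp add: tr_def divide_simps) (simp add: algebra_simps)
  finally show ?thesis by simp
qed

lemma Sy_bar_Sy:
  assumes "t \<in> V" "\<tau> \<noteq> 0" "h t t = tr bar \<tau>" "x \<in> V"
  shows "Sy t (bar \<tau>) (Sy t \<tau> x) = x"
  using Sy_Sy_bar[of t "bar \<tau>" x] assms by (simp add: tr_def add.commute)

lemma Sy_form:
  assumes t: "t \<in> V" "\<tau> \<noteq> 0" "h t t = tr bar \<tau>" and x: "x \<in> V" "y \<in> V"
  shows "h (Sy t \<tau> x) (Sy t \<tau> y) = h x y"
proof -
  define a b where ab: "a = h x t" "b = h y t"
  have b: "h t y = bar b" using form_hermitian[of t y] t x by (simp add: ab)
  show ?thesis
    using t x by (simp add: Sy_apply V_closed form_simps b flip: ab)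
      (simp add: tr_def divide_simps, simp add: algebra_simps)
qed

lemma Sy_bij:
  assumes "t \<in> V" "\<tau> \<noteq> 0" "h t t = tr bar \<tau>"
  shows "bij_betw (Sy t \<tau>) V V"
  by (rule bij_betwI[where g = "Sy t (bar \<tau>)"])
    (use assms in \<open>auto simp: Sy_V Sy_Sy_bar Sy_bar_Sy\<close>)

lemma Sy_U:
  assumes t: "t \<in> V" "\<tau> \<noteq> 0" "h t t = tr bar \<tau>" and L: "Sy t \<tau> ` L = L"
  shows "Sy t \<tau> \<in> U L"
  unfolding U_iff
  using t L Sy_bij[OF t] Sy_form[OF t]
  by (auto simp: Sy_apply V_closed form_simps add_divide_distrib scale_left_distrib
      scale_right_diff_distrib) (simp add: symmetry_def)

lemma Sy_bar_U:
  assumes t: "t \<in> V" "\<tau> \<noteq> 0" "h t t = tr bar \<tau>" and U: "Sy t \<tau> \<in> U L" and LV: "L \<subseteq> V"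
  shows "Sy t (bar \<tau>) \<in> U L"
proof (rule Sy_U)
  have "Sy t (bar \<tau>) ` L = Sy t (bar \<tau>) ` Sy t \<tau> ` L"
    using U by (simp add: U_iff)
  also have "\<dots> = L"
    using Sy_bar_Sy[OF t] LV by (force simp: image_iff)
  finally show "Sy t (bar \<tau>) ` L = L" .
qed (use t in \<open>auto simp: tr_def add.commute\<close>)

text \<open>Mapping L into itself is enough: the inverse has parameter \<open>bar \<tau>\<close>,
  which is \<tau> up to a unit, so it maps L into itself for the same reason.\<close>

lemma Sy_U':
  assumes t: "t \<in> V" "\<tau> \<noteq> 0" "h t t = tr bar \<tau>" and LV: "L \<subseteq> V"
    and L: "\<And>x y. x \<in> L \<Longrightarrow> y \<in> L \<Longrightarrow> x - y \<in> L" "\<And>a x. a \<in> F 0 \<Longrightarrow> x \<in> L \<Longrightarrow> scale a x \<in> L"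
    and St: "\<And>x. x \<in> L \<Longrightarrow> scale (h x t / \<tau>) t \<in> L"
  shows "Sy t \<tau> \<in> U L"
proof (rule Sy_U[OF t])
  have "Sy t (bar \<tau>) x \<in> L" if "x \<in> L" for x
  proof -
    have "\<tau> / bar \<tau> \<in> F 0"
      using t(2) by (simp add: F_def val_divide)
    then have "scale (\<tau> / bar \<tau>) (scale (h x t / \<tau>) t) \<in> L" using St[OF that] by (rule L(2))
    then have "scale (h x t / bar \<tau>) t \<in> L" using t(2) by simp
    then show ?thesis using L(1)[OF that] LV that by (auto simp: Sy_apply)
  qed
  moreover have "Sy t \<tau> x \<in> L" if "x \<in> L" for x
    using L(1)[OF that St[OF that]] LV that by (auto simp: Sy_apply)
  moreover have "x = Sy t \<tau> (Sy t (bar \<tau>) x)" if "x \<in> L" for x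
    using Sy_Sy_bar[OF t] LV that by (metis subsetD)
  ultimately show "Sy t \<tau> ` L = L" by blast
qed

lemma symmetries_iff:
  "f \<in> symmetries scale bar V h \<longleftrightarrow> (\<exists>t \<tau>. f = Sy t \<tau> \<and> t \<in> V \<and> \<tau> \<noteq> 0 \<and> h t t = tr bar \<tau>)"
  by (auto simp: symmetries_def)

lemma G_one: "(\<lambda>x\<in>V. x) \<in> G L"
  using generate.one[of "BijGroup V"] by (simp add: symmetry_group_def BijGroup_def)

lemma inv_Sy:
  assumes t: "t \<in> V" "\<tau> \<noteq> 0" "h t t = tr bar \<tau>" and U: "Sy t \<tau> \<in> U L" and LV: "L \<subseteq> V"
  shows "inv\<^bsub>BijGroup V\<^esub> Sy t \<tau> = Sy t (bar \<tau>)"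
proof -
  have *: "Sy t \<tau> \<in> U L" "Sy t (bar \<tau>) \<in> U L"
    using U Sy_bar_U[OF t U LV] by auto
  interpret group "BijGroup V" by (rule group_BijGroup)
  show ?thesis
  proof (rule inv_equality)
    show "Sy t (bar \<tau>) \<otimes>\<^bsub>BijGroup V\<^esub> Sy t \<tau> = \<one>\<^bsub>BijGroup V\<^esub>"
      using * t
      by (simp add: BijGroup_def U_Bij compose_def restrict_def Sy_bar_Sy fun_eq_iff)
  qed (use * t in \<open>auto simp: BijGroup_def U_Bij\<close>)
qed

lemma G_subset_U:
  assumes LV: "L \<subseteq> V"
  shows "G L \<subseteq> U L"
proof
  fix f assume "f \<in> G L"
  then show "f \<in> U L"
    unfolding symmetry_group_def
  proof (induction rule: generate.induct)
    case one
    have "(\<lambda>x\<in>V. x) ` L = L" using LV by (force simp: image_iff)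
    then show ?case
      by (simp add: U_iff BijGroup_def V_closed bij_betw_def inj_on_def extensional_def)
  next
    case (incl f)
    then show ?case by simp
  next
    case (inv f)
    then obtain t \<tau> where t: "f = Sy t \<tau>" "t \<in> V" "\<tau> \<noteq> 0" "h t t = tr bar \<tau>"
      by (auto simp: symmetries_iff)
    then show ?case using inv inv_Sy[OF t(2-4) _ LV] Sy_bar_U[OF t(2-4) _ LV] by simp
  next
    case (eng f g)
    then show ?case using U_compose LV by (simp add: BijGroup_def U_Bij)
  qed
qed

lemma G_compose:
  assumes "t \<in> V" "\<tau> \<noteq> 0" "h t t = tr bar \<tau>" "Sy t \<tau> \<in> U L" "L \<subseteq> V" "g \<in> G L"
  shows "compose V (Sy t \<tau>) g \<in> G L"
proof -
  have "Sy t \<tau> \<otimes>\<^bsub>BijGroup V\<^esub> g \<in> G L"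
    unfolding symmetry_group_def
    by (rule generate.eng[OF generate.incl])
      (use assms in \<open>auto simp: symmetries_iff simp flip: symmetry_group_def\<close>)
  then show ?thesis
    using assms G_subset_U[of L] U_Bij by (auto simp: BijGroup_def)
qed

definition D :: "('v \<Rightarrow> 'v) \<Rightarrow> 'v \<Rightarrow> 'v" where
  "D f x = x - f x"

text \<open>The spanning vectors may lie outside the image of \<open>D f\<close>, so a bound
  survives the addition of a vector in \<open>twist_step\<close>.\<close>

definition rank_le :: "nat \<Rightarrow> ('v \<Rightarrow> 'v) \<Rightarrow> bool" where
  "rank_le n f \<longleftrightarrow> (\<exists>B. finite B \<and> card B \<le> n \<and> B \<subseteq> V \<and> (\<forall>x\<in>V. D f x \<in> span B))"

lemma D_V: "f \<in> U L \<Longrightarrow> x \<in> V \<Longrightarrow> D f x \<in> V"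
  by (simp add: D_def U_V V_closed)

lemma D_add: "f \<in> U L \<Longrightarrow> x \<in> V \<Longrightarrow> y \<in> V \<Longrightarrow> D f (x + y) = D f x + D f y"
  by (simp add: D_def U_add)

lemma D_scale: "f \<in> U L \<Longrightarrow> x \<in> V \<Longrightarrow> D f (scale a x) = scale a (D f x)"
  by (simp add: D_def U_scale scale_right_diff_distrib)

lemma D_diff: "f \<in> U L \<Longrightarrow> x \<in> V \<Longrightarrow> y \<in> V \<Longrightarrow> D f (x - y) = D f x - D f y"
  using D_add[of f L "x - y" y] by (simp add: V_closed)

text \<open>Invariance turns \<open>h (f x) (f y)\<close> into \<open>h x y\<close>. On the diagonal
  this makes \<open>h x (D f x)\<close> an admissible parameter for the symmetry at
  \<open>D f x\<close>.\<close>

lemma form_D_D: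
  "f \<in> U L \<Longrightarrow> x \<in> V \<Longrightarrow> y \<in> V \<Longrightarrow> h (D f x) (D f y) = h x (D f y) + h (D f x) y"
  by (simp add: D_def form_simps V_closed U_V U_form)

lemma form_D_self: "f \<in> U L \<Longrightarrow> x \<in> V \<Longrightarrow> h (D f x) (D f x) = tr bar (h x (D f x))"
  using form_D_D[of f L x x] form_hermitian[of "D f x" x] by (simp add: tr_def D_V)

text \<open>The projection along a suitable b of B onto the orthogonal complement of x kills b and
  fixes every vector orthogonal to x.\<close>

lemma exchange:
  assumes B: "finite B" "card B \<le> Suc n" "B \<subseteq> V" and x: "x \<in> V"
    and s: "s \<in> span B" "h s x \<noteq> 0"
  obtains B' where "finite B'" "card B' \<le> n" "B' \<subseteq> V" "\<And>u. u \<in> span B \<Longrightarrow> h u x = 0 \<Longrightarrow> u \<in> span B'"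
proof -
  have "\<exists>b\<in>B. h b x \<noteq> 0"
  proof (rule ccontr)
    assume *: "\<not> ?thesis"
    have "subspace {u \<in> V. h u x = 0}"
      using x by (auto simp: subspace_def V_closed form_simps)
    then have "span B \<subseteq> {u \<in> V. h u x = 0}"
      using B * by (intro span_minimal) auto
    then show False using s by auto
  qed
  then obtain b where b: "b \<in> B" "h b x \<noteq> 0" by blast
  define p where "p u = u - scale (h u x / h b x) b" for u
  define B' where "B' = p ` (B - {b})"
  have bV: "b \<in> V" using b B by auto
  have "p u \<in> span B'" if "u \<in> span B" for u
  proof -
    have "subspace {u \<in> V. p u \<in> span B'}"
    proof (rule subspaceI)
      show "0 \<in> {u \<in> V. p u \<in> span B'}"
        by (simp add: p_def form_0_left x V_0 span_zero)
      fix u v c assume u: "u \<in> {u \<in> V. p u \<in> span B'}" and v: "v \<in> {u \<in> V. p u \<in> span B'}"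
      have "p (u + v) = p u + p v"
        using u v x by (simp add: p_def form_simps add_divide_distrib scale_left_distrib)
      then show "u + v \<in> {u \<in> V. p u \<in> span B'}" using u v by (simp add: V_closed span_add)
      have "p (scale c u) = scale c (p u)"
        using u x by (simp add: p_def form_simps scale_right_diff_distrib)
      then show "scale c u \<in> {u \<in> V. p u \<in> span B'}" using u by (simp add: V_closed span_scale)
    qed
    moreover have "B \<subseteq> {u \<in> V. p u \<in> span B'}"
    proof
      fix c assume c: "c \<in> B"
      have "p b = 0" using b by (simp add: p_def)
      then show "c \<in> {u \<in> V. p u \<in> span B'}"
        using c B by (cases "c = b") (auto simp: B'_def span_zero intro: span_base)
    qed
    ultimately show ?thesis using that span_minimal by blast
  qed
  then have "u \<in> span B'" if "u \<in> span B" "h u x = 0" for u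
    using that by (metis p_def diff_zero div_0 scale_zero_left)
  moreover have "card B' \<le> n"
    unfolding B'_def using B b by (intro order.trans[OF card_image_le]) auto
  moreover have "B' \<subseteq> V" using B bV by (auto simp: B'_def p_def intro!: V_closed)
  ultimately show thesis using that[of B'] B by (simp add: B'_def)
qed

lemma twist_step:
  assumes f: "f \<in> U L" and L: "L \<subseteq> V"
    and t: "t \<in> V" "\<tau> \<noteq> 0" "h t t = tr bar \<tau>" "Sy t \<tau> \<in> U L"
  obtains g where "g \<in> U L" "g \<in> G L \<Longrightarrow> f \<in> G L"
    "\<And>v. v \<in> V \<Longrightarrow> D g v = D f v + scale (h (f v) t / \<tau>) t"
    "\<And>n. rank_le n f \<Longrightarrow> rank_le (Suc n) g"
proof -
  define g where "g = compose V (Sy t \<tau>) f"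
  have gU: "g \<in> U L" unfolding g_def by (intro U_compose t f L)
  have Dg: "D g v = D f v + scale (h (f v) t / \<tau>) t" if "v \<in> V" for v
    using that f by (simp add: g_def D_def compose_def Sy_apply U_V)
  have "compose V (Sy t (bar \<tau>)) g = f"
  proof
    fix v show "compose V (Sy t (bar \<tau>)) g v = f v"
    proof (cases "v \<in> V")
      case True
      then show ?thesis using f t by (simp add: g_def compose_def Sy_bar_Sy U_V)
    next
      case False
      then show ?thesis using f by (simp add: compose_def U_iff extensional_def)
    qed
  qed
  then have G: "f \<in> G L" if "g \<in> G L"
    using G_compose[of t "bar \<tau>" L g] Sy_bar_U[of t \<tau> L] t that L by (simp add: tr_def add.commute)
  have "rank_le (Suc n) g" if "rank_le n f" for n
  proof -
    obtain B where B: "finite B" "card B \<le> n" "B \<subseteq> V" "\<forall>x\<in>V. D f x \<in> span B"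
      using \<open>rank_le n f\<close> by (auto simp: rank_le_def)
    have "D g v \<in> span (insert t B)" if "v \<in> V" for v
      unfolding Dg[OF that] using B that span_mono[of B "insert t B"]
      by (intro span_add span_scale) (auto intro: span_base)
    moreover have "card (insert t B) \<le> Suc n" using B by (simp add: card_insert_if)
    ultimately show ?thesis unfolding rank_le_def using B t by (intro exI[of _ "insert t B"]) auto
  qed
  with gU G Dg show thesis by (rule that)
qed

text \<open>The symmetry at \<open>D f x\<close> sends x to \<open>f x\<close>, so g, which is f
  followed by the inverse symmetry, fixes x. Hence the image of \<open>D g\<close> is orthogonal to
  x, whereas \<open>D f x\<close> is not, and both lie in the image of \<open>D f\<close>.\<close>

lemma good_step:
  assumes f: "f \<in> U L" and L: "L \<subseteq> V"
    and x: "x \<in> V" "h x (D f x) \<noteq> 0" "Sy (D f x) (h x (D f x)) \<in> U L"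
  obtains g where "g \<in> U L" "g \<in> G L \<Longrightarrow> f \<in> G L"
    "\<And>v. v \<in> V \<Longrightarrow> D g v = D f v - scale (bar (h x (D f v) / h x (D f x))) (D f x)"
    "\<And>n. rank_le (Suc n) f \<Longrightarrow> rank_le n g"
proof -
  define s where "s = D f x"
  define \<sigma> where "\<sigma> = h x s"
  have s: "s \<in> V" "\<sigma> \<noteq> 0" "h s s = tr bar \<sigma>" "Sy s \<sigma> \<in> U L"
    using x form_D_self[OF f] D_V[OF f] by (auto simp: s_def \<sigma>_def)
  have hsx: "h s x = bar \<sigma>" using form_hermitian[of s x] s x by (simp add: \<sigma>_def)
  have s': "bar \<sigma> \<noteq> 0" "h s s = tr bar (bar \<sigma>)" "Sy s (bar \<sigma>) \<in> U L"
    using s Sy_bar_U[of s \<sigma> L] L by (auto simp: tr_def add.commute)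
  obtain g where g: "g \<in> U L" "g \<in> G L \<Longrightarrow> f \<in> G L"
    and Dg: "\<And>v. v \<in> V \<Longrightarrow> D g v = D f v + scale (h (f v) s / bar \<sigma>) s"
    using twist_step[OF f L s(1) s'] by metis
  have fs: "h (f v) s = - bar (h x (D f v))" if "v \<in> V" for v
    using that f x form_hermitian[of x v] form_hermitian[of x "f v"]
    by (simp add: s_def D_def form_simps V_closed U_V U_form)
  have Dg': "D g v = D f v - scale (bar (h x (D f v) / \<sigma>)) s" if "v \<in> V" for v
    using Dg[OF that] fs[OF that] by simp
  have "rank_le n g" if "rank_le (Suc n) f" for n
  proof -
    obtain B where B: "finite B" "card B \<le> Suc n" "B \<subseteq> V" "\<forall>x\<in>V. D f x \<in> span B"
      using \<open>rank_le (Suc n) f\<close> by (auto simp: rank_le_def)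
    have sB: "s \<in> span B" using B x by (simp add: s_def)
    obtain B' where B': "finite B'" "card B' \<le> n" "B' \<subseteq> V"
      "\<And>u. u \<in> span B \<Longrightarrow> h u x = 0 \<Longrightarrow> u \<in> span B'"
      using exchange[OF B(1-3) x(1) sB] hsx s(2) by auto
    have "D g v \<in> span B'" if v: "v \<in> V" for v
    proof (rule B'(4))
      show "D g v \<in> span B"
        unfolding Dg'[OF v] using B v sB by (intro span_diff span_scale) auto
      have "h (D f v) x = bar (h x (D f v))"
        using form_hermitian[of "D f v" x] D_V[OF f v] x by simp
      then show "h (D g v) x = 0"
        using x v s D_V[OF f v] by (simp add: Dg' form_simps V_closed hsx)
    qed
    then show ?thesis unfolding rank_le_def using B' by blast
  qed
  with g Dg' show thesis using that by (simp add: s_def \<sigma>_def)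
qed

lemma rank_0_G:
  assumes "f \<in> U L" "rank_le 0 f"
  shows "f \<in> G L"
proof -
  have "D f x = 0" if "x \<in> V" for x using assms that by (auto simp: rank_le_def)
  then have "f = (\<lambda>x\<in>V. x)"
    using assms by (auto simp: D_def fun_eq_iff U_iff extensional_def)
  then show ?thesis using G_one by simp
qed

lemma rank_exists: "f \<in> U L \<Longrightarrow> \<exists>n. rank_le n f"
  using V_finitely_generated D_V[of f L] unfolding rank_le_def by (metis order_refl span_superset)

end

section \<open>Reduction of an isometry to the identity\<close>

context ramified_involution
begin

text \<open>The a's are the values of \<open>h x (D f y)\<close> at two vectors, the G's those after
  \<open>twist_step\<close> at t; the p's are products with t and the c's values of
  \<open>h t (D f x)\<close>. The second conclusion concerns the Schur complement, the value that a
  good step at the first vector leaves at the second. In the graded ring a11 and a22 vanish and a21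
  equals a12.\<close>

lemma residue_det_regular:
  assumes a: "a11 \<in> F (l + 1)" "a22 \<in> F (l + 1)" "a12 + a21 \<in> F (l + 1)" "has_val l a12"
    and p: "p1 \<in> F l" "p2 \<in> F l" and c: "c1 \<in> F l" "c2 \<in> F l" and \<tau>: "has_val l \<tau>"
    and q: "q1 = bar p1 - c1" "q2 = bar p2 - c2"
    and has_val: "has_val l p1" "has_val l q1" "has_val l (a12 + (p1 * c2 + bar c1 * bar p2) / \<tau>)"
    and G: "G11 = a11 + p1 * q1 / bar \<tau>" "G12 = a12 + p1 * q2 / bar \<tau>"
      "G21 = a21 + p2 * q1 / bar \<tau>" "G22 = a22 + p2 * q2 / bar \<tau>"
  shows "has_val l G11" "has_val l (G22 - G12 / G11 * G21)"
proof -
  have t: "gr_eq l (bar \<tau>) \<tau>" "has_val l (bar \<tau>)" using \<tau> by (auto intro: gr_eq_bar has_val_F)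
  have tn: "\<tau> \<noteq> 0" using \<tau> by (rule has_val_neq_0)
  have qR: "gr_eq l q1 (p1 + c1)" "gr_eq l q2 (p2 + c2)"
    unfolding q diff_conv_add_uminus by (intro gr_eq_add gr_eq_bar gr_eq_neg p c)+
  have pq: "gr_eq l (x * y / bar \<tau>) (x * z / \<tau>)" if "x \<in> F l" "gr_eq l y z" for x y z
    by (rule gr_eq_divide[OF gr_eq_mult[OF gr_eq_refl[OF that(1)] that(2) refl] t]) simp
  have a0: "gr_eq l a11 0" "gr_eq l a22 0" using a by (auto simp: gr_eq_0_iff)
  have a12: "gr_eq l a12 a12" using a by (auto intro: gr_eq_refl has_val_F)
  have "gr_eq l (- a12) a21"
    using a by (intro gr_eq_sym[OF gr_eq_I[of "- a12" l "a12 + a21"]]) (auto intro: has_val_F)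
  then have a21: "gr_eq l a21 a12"
    using gr_eq_neg[of a12 l] a by (meson gr_eq_sym gr_eq_trans has_val_F)
  have RG: "gr_eq l G11 (0 + p1 * (p1 + c1) / \<tau>)" "gr_eq l G22 (0 + p2 * (p2 + c2) / \<tau>)"
    "gr_eq l G12 (a12 + p1 * (p2 + c2) / \<tau>)" "gr_eq l G21 (a12 + p2 * (p1 + c1) / \<tau>)"
    unfolding G by (intro gr_eq_add a0 a12 a21 pq p qR)+
  have "has_val l (p1 * q1 / bar \<tau>)"
    using has_val t by (intro has_val_divide has_val_mult) auto
  then show exG: "has_val l G11"
    unfolding G using has_val_add[of l _ a11] a by (metis add.commute)
  \<comment> \<open>This differs from the third assumed quantity only by conjugations, which the
    grading ignores.\<close>
  define e where "e = a12 + (p1 * c2 + p2 * c1) / \<tau>"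
  have "gr_eq l (a12 + (p1 * c2 + bar c1 * bar p2) / \<tau>) (a12 + (p1 * c2 + c1 * p2) / \<tau>)"
    by (intro gr_eq_add a12 gr_eq_divide[where m = "l + l" and n = l] gr_eq_mult[where m = l and n = l]
        gr_eq_refl gr_eq_bar p c has_val_F \<tau>) auto
  then have exe: "has_val l e" using has_val(3) gr_eq_ex by (auto simp: e_def mult.commute)
  define d where "d = (0 + p1 * (p1 + c1) / \<tau>) * (0 + p2 * (p2 + c2) / \<tau>) -
      (a12 + p1 * (p2 + c2) / \<tau>) * (a12 + p2 * (p1 + c1) / \<tau>)"
  have Rd: "gr_eq (l + l) (G11 * G22 - G12 * G21) d"
    unfolding d_def by (intro gr_eq_diff gr_eq_mult[OF _ _ refl] RG)
  have d: "d = - (a12 * e) + 2 * (- (a12 * p1 * p2 / \<tau>))"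
    using tn by (simp add: d_def e_def field_simps)
  have "has_val (l + l) (- (a12 * e))" using a(4) exe by (auto intro: has_val_mult)
  moreover have "2 * (- (a12 * p1 * p2 / \<tau>)) \<in> F (l + l + 1)"
  proof (rule F_mult[OF F_2, of _ "l + l"])
    have "a12 * p1 * p2 / \<tau> \<in> F (l + l)"
      by (intro F_divide[OF F_mult[OF F_mult[OF has_val_F[OF a(4)] p(1) order_refl] p(2) order_refl] \<tau>])
        auto
    then show "- (a12 * p1 * p2 / \<tau>) \<in> F (l + l)" by simp
  qed simp
  ultimately have "has_val (l + l) d" unfolding d by (rule has_val_add)
  then have "has_val (l + l) (G11 * G22 - G12 * G21)" using Rd gr_eq_ex by blast
  then have "has_val l ((G11 * G22 - G12 * G21) / G11)" using exG by (intro has_val_divide) auto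
  moreover have "(G11 * G22 - G12 * G21) / G11 = G22 - G12 / G11 * G21"
    using has_val_neq_0[OF exG] by (simp add: field_simps)
  ultimately show "has_val l (G22 - G12 / G11 * G21)" by simp
qed

text \<open>With \<tau> of valuation l + 1 the term \<open>p2 * q2 / bar \<tau>\<close> dominates
  G22 at level l - 1, so the first good step is at the second vector. The determinant still has
  valuation 2l, since the condition on \<open>\<tau> + (a11 + q1 + p1)\<close> saves its leading
  term, and the Schur complement moves up to l + 1. The last conclusions control the coefficients of
  the second good step.\<close>

lemma residue_det_irregular:
  assumes a: "a11 \<in> F (l + 1)" "a22 \<in> F (l + 1)" "a12 + a21 \<in> F (l + 1)" "has_val l a21"
    and p: "p1 \<in> F (l + 1)" "gr_eq l p2 a21" and q: "q1 \<in> F (l + 1)" "gr_eq l q2 a21"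
    and \<tau>: "has_val (l + 1) \<tau>" "has_val (l + 1) (\<tau> + (a11 + q1 + p1))"
    and G: "G11 = a11 + p1 * q1 / bar \<tau>" "G12 = a12 + p1 * q2 / bar \<tau>"
      "G21 = a21 + p2 * q1 / bar \<tau>" "G22 = a22 + p2 * q2 / bar \<tau>"
  shows "has_val (l - 1) G22" "has_val (l + 1) (G11 - G21 / G22 * G12)"
    "bar (G21 / G22) \<in> F 1" "bar q1 / \<tau> \<in> F 0" "bar q2 / \<tau> \<in> F (- 1)"
    "1 + bar q1 / \<tau> - bar (G21 / G22) * (bar q2 / \<tau>) \<in> F 1"
proof -
  define b where "b = a21"
  have b: "has_val l b" "b \<in> F l" using a by (auto simp: b_def has_val_F)
  have t: "gr_eq (l + 1) (bar \<tau>) \<tau>" "has_val (l + 1) (bar \<tau>)" using \<tau> by (auto intro: gr_eq_bar has_val_F)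
  have tn: "\<tau> \<noteq> 0" "b \<noteq> 0" using has_val_neq_0[OF \<tau>(1)] has_val_neq_0[OF b(1)] by auto
  have "gr_eq l (- a21) a12"
    using a by (intro gr_eq_sym[OF gr_eq_I[of "- a21" l "a12 + a21"]]) (auto intro: has_val_F)
  then have a12: "gr_eq l a12 b"
    using gr_eq_neg[of a21 l] a unfolding b_def by (meson gr_eq_sym gr_eq_trans has_val_F)
  have a21: "gr_eq l a21 b" using b by (auto simp: b_def intro: gr_eq_refl)
  have p2: "gr_eq l p2 b" and q2: "gr_eq l q2 b" using p q by (auto simp: b_def)
  have pF: "p1 \<in> F l" "q1 \<in> F l" "a11 \<in> F l" "a22 \<in> F l" using F_Suc p q a by blast+
  have exp2: "has_val l p2" "has_val l q2" using p2 q2 b gr_eq_ex by blast+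
  have R22: "gr_eq (l - 1) G22 (b * b / \<tau>)"
  proof -
    have "gr_eq (l - 1) (a22 + p2 * q2 / bar \<tau>) (0 + b * b / \<tau>)"
      by (intro gr_eq_add gr_eq_divide[OF gr_eq_mult[OF p2 q2 refl] t]) (use pF in \<open>auto simp: gr_eq_0_iff\<close>)
    then show ?thesis by (simp add: G)
  qed
  have ebb: "has_val (l - 1) (b * b / \<tau>)"
    using b \<tau> by (intro has_val_divide[OF has_val_mult[OF b(1) b(1) refl] \<tau>(1)]) auto
  then show ex22: "has_val (l - 1) G22" using R22 gr_eq_ex by blast
  define d where "d = 0 - b * b + (a11 * (b * b) + 0 - b * b * q1 - b * b * p1) / \<tau>"
  have exact: "G11 * G22 - G12 * G21 = a11 * a22 - a12 * a21 +
      (a11 * (p2 * q2) + a22 * (p1 * q1) - a12 * p2 * q1 - a21 * q2 * p1) / bar \<tau>"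
    using tn by (simp add: G field_simps)
  have "gr_eq (l + l) (G11 * G22 - G12 * G21) d"
    unfolding d_def exact
  proof (intro gr_eq_add gr_eq_diff gr_eq_divide[OF _ t])
    show "gr_eq (l + l) (a11 * a22) 0"
      unfolding gr_eq_0_iff by (rule F_mult[OF a(1) pF(4)]) simp
    show "gr_eq (l + l) (a12 * a21) (b * b)" by (intro gr_eq_mult[OF a12 a21 refl])
    show "gr_eq (l + l + (l + 1)) (a11 * (p2 * q2)) (a11 * (b * b))"
      by (intro gr_eq_mult[OF gr_eq_refl[OF a(1)] gr_eq_mult[OF p2 q2 refl]]) simp
    show "gr_eq (l + l + (l + 1)) (a22 * (p1 * q1)) 0"
      unfolding gr_eq_0_iff by (rule F_mult[OF a(2) F_mult[OF p(1) q(1) order_refl]]) simp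
    show "gr_eq (l + l + (l + 1)) (a12 * p2 * q1) (b * b * q1)"
      by (intro gr_eq_mult[OF gr_eq_mult[OF a12 p2 refl] gr_eq_refl[OF q(1)]]) simp
    show "gr_eq (l + l + (l + 1)) (a21 * q2 * p1) (b * b * p1)"
      by (intro gr_eq_mult[OF gr_eq_mult[OF a21 q2 refl] gr_eq_refl[OF p(1)]]) simp
  qed simp
  moreover have "has_val (l + l) d"
  proof -
    have "d = - (b * b / \<tau> * (\<tau> + (a11 + q1 + p1))) + 2 * (b * b / \<tau> * a11)"
      using tn by (simp add: d_def field_simps)
    moreover have "has_val (l + l) (- (b * b / \<tau> * (\<tau> + (a11 + q1 + p1))))"
      unfolding has_val_uminus_iff by (rule has_val_mult[OF ebb \<tau>(2)]) simp
    moreover have "2 * (b * b / \<tau> * a11) \<in> F (l + l + 1)"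
      by (rule F_mult[OF F_2 F_mult[OF has_val_F[OF ebb] a(1) order_refl]]) simp
    ultimately show ?thesis using has_val_add by metis
  qed
  ultimately have "has_val (l + l) (G11 * G22 - G12 * G21)" using gr_eq_ex by blast
  then have "has_val (l + 1) ((G11 * G22 - G12 * G21) / G22)" using ex22 by (intro has_val_divide) auto
  moreover have "(G11 * G22 - G12 * G21) / G22 = G11 - G21 / G22 * G12"
    using has_val_neq_0[OF ex22] by (simp add: field_simps)
  ultimately show "has_val (l + 1) (G11 - G21 / G22 * G12)" by simp
  have R21: "gr_eq l G21 (b + b * q1 / \<tau>)"
    unfolding G by (intro gr_eq_add a21 gr_eq_divide[OF gr_eq_mult[OF p2 gr_eq_refl[OF q(1)] refl] t]) simp
  have R2122: "gr_eq 1 (G21 / G22) ((b + b * q1 / \<tau>) / (b * b / \<tau>))"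
    by (rule gr_eq_divide[OF R21 R22 ex22]) simp
  then have F2122: "G21 / G22 \<in> F 1" by (simp add: gr_eq_def)
  then show "bar (G21 / G22) \<in> F 1" by (simp del: bar_divide)
  show "bar q1 / \<tau> \<in> F 0" using q \<tau>(1) by (intro F_divide[where m = "l + 1"]) auto
  show "bar q2 / \<tau> \<in> F (- 1)"
    using q \<tau>(1) by (intro F_divide[where m = l]) (auto simp: gr_eq_def)
  have q1: "gr_eq 0 (bar q1 / \<tau>) (q1 / \<tau>)"
    by (rule gr_eq_divide[OF gr_eq_bar[OF q(1)] gr_eq_refl[OF has_val_F[OF \<tau>(1)]] \<tau>(1)]) simp
  have q2': "gr_eq (- 1) (bar q2 / \<tau>) (b / \<tau>)"
    by (rule gr_eq_divide[OF gr_eq_trans[OF gr_eq_bar q2] gr_eq_refl[OF has_val_F[OF \<tau>(1)]] \<tau>(1)])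
      (use q2 in \<open>auto simp: gr_eq_def\<close>)
  have "gr_eq 0 (bar (G21 / G22) * (bar q2 / \<tau>)) ((b + b * q1 / \<tau>) / (b * b / \<tau>) * (b / \<tau>))"
    by (rule gr_eq_mult[OF gr_eq_trans[OF gr_eq_bar[OF F2122] R2122] q2']) simp
  then have "gr_eq 0 (1 + bar q1 / \<tau> - bar (G21 / G22) * (bar q2 / \<tau>))
      (1 + q1 / \<tau> - (b + b * q1 / \<tau>) / (b * b / \<tau>) * (b / \<tau>))"
    by (intro gr_eq_diff gr_eq_add q1 gr_eq_refl) auto
  moreover have "1 + q1 / \<tau> - (b + b * q1 / \<tau>) / (b * b / \<tau>) * (b / \<tau>) = 0"
    using tn by (simp add: field_simps)
  ultimately show "1 + bar q1 / \<tau> - bar (G21 / G22) * (bar q2 / \<tau>) \<in> F 1"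
    by (metis gr_eq_0_iff add_0)
qed

end

section \<open>Lattices over a residue field with more than two elements\<close>

locale hermitian_lattice =
  integral_hermitian_space w bar \<pi> scale V h + perfect_ramified_involution w bar \<pi>
  for w :: "'e::field \<Rightarrow> int" and bar and \<pi>
    and scale :: "'e \<Rightarrow> 'v::ab_group_add \<Rightarrow> 'v" and V h +
  fixes L :: "'v set"
  assumes lattice: "lattice_in scale (F 0) V L"
    and nondegenerate_V: "nondegenerate h V"
    and nondegenerate_L: "nondegenerate h L"
    and residue_gt_2: "\<exists>u. has_val 0 u \<and> has_val 0 (1 - u)"
begin

lemma L_V [simp]: "x \<in> L \<Longrightarrow> x \<in> V"
  using lattice ospan_V by (auto simp: lattice_in_def)

lemma L_subset: "L \<subseteq> V"
  by auto

lemma L_0 [simp]: "0 \<in> L"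
  using lattice ospan_0 by (auto simp: lattice_in_def)

lemma L_add [simp]: "x \<in> L \<Longrightarrow> y \<in> L \<Longrightarrow> x + y \<in> L"
  using lattice ospan_add by (auto simp: lattice_in_def)

lemma L_diff [simp]: "x \<in> L \<Longrightarrow> y \<in> L \<Longrightarrow> x - y \<in> L"
  using lattice ospan_diff by (auto simp: lattice_in_def)

lemma L_scale [simp]: "x \<in> L \<Longrightarrow> a \<in> F 0 \<Longrightarrow> scale a x \<in> L"
  using lattice ospan_scale by (auto simp: lattice_in_def)

lemma L_pi [simp]: "x \<in> L \<Longrightarrow> scale \<pi> x \<in> L"
  by (rule L_scale) (auto intro: F_mono[OF F_pi])

lemma D_L [simp]: "f \<in> U L \<Longrightarrow> x \<in> L \<Longrightarrow> D f x \<in> L"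
  by (simp add: D_def U_L)

lemma L_bounded: "\<exists>n. \<forall>x\<in>L. \<forall>y\<in>L. h x y \<in> F n"
proof -
  obtain S where S: "finite S" "S \<subseteq> V" "L = ospan S" using lattice by (auto simp: lattice_in_def)
  define n where "n = Min (insert 0 ((\<lambda>(x, y). w (h x y)) ` (S \<times> S)))"
  have 0: "h x y \<in> F n" if "x \<in> S" "y \<in> S" for x y
    unfolding F_def n_def using S(1) that by (auto intro!: Min_le)
  have 1: "h x y \<in> F n" if "x \<in> L" "y \<in> S" for x y
    by (rule form_ospan_F[of x S]) (use S that 0 in auto)
  have 2: "h y x \<in> F n" if "x \<in> L" "y \<in> S" for x y
    using 1[OF that] form_hermitian[of y x] S that by (metis F_bar_iff L_V subsetD)
  have "h x y \<in> F n" if "x \<in> L" "y \<in> L" for x y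
    by (rule form_ospan_F[of x S]) (use S that 2 in auto)
  then show ?thesis by blast
qed

text \<open>The intersection of L with P^l times its dual lattice. At its vectors every symmetry
  with parameter of valuation at most l preserves L.\<close>

definition M :: "int \<Rightarrow> 'v set" where
  "M l = {t \<in> L. \<forall>x\<in>L. h x t \<in> F l}"

lemma M_I: "t \<in> L \<Longrightarrow> (\<And>x. x \<in> L \<Longrightarrow> h x t \<in> F l) \<Longrightarrow> t \<in> M l"
  by (simp add: M_def)

lemma M_L: "t \<in> M l \<Longrightarrow> t \<in> L"
  by (simp add: M_def)

lemma M_form: "t \<in> M l \<Longrightarrow> x \<in> L \<Longrightarrow> h x t \<in> F l"
  by (simp add: M_def)

lemma M_form': "t \<in> M l \<Longrightarrow> x \<in> L \<Longrightarrow> h t x \<in> F l"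
  using form_hermitian[of t x] by (simp add: M_def)

lemma M_add: "s \<in> M l \<Longrightarrow> t \<in> M l \<Longrightarrow> s + t \<in> M l"
  by (auto simp: M_def form_simps)

lemma M_diff: "s \<in> M l \<Longrightarrow> t \<in> M l \<Longrightarrow> s - t \<in> M l"
  by (auto simp: M_def form_simps)

lemma M_scale: "t \<in> M l \<Longrightarrow> a \<in> F 0 \<Longrightarrow> scale a t \<in> M l"
  by (auto simp: M_def form_simps)

lemma M_mono: "t \<in> M l \<Longrightarrow> k \<le> l \<Longrightarrow> t \<in> M k"
  by (auto simp: M_def intro: F_mono)

lemma M_scale_pi:
  assumes "t \<in> M l" "a \<in> F 1"
  shows "scale a t \<in> M (l + 1)"
proof (rule M_I)
  show "scale a t \<in> L"
    using M_L[OF assms(1)] F_mono[OF assms(2), of 0] by simp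
  show "h x (scale a t) \<in> F (l + 1)" if "x \<in> L" for x
    using F_mult[of "bar a" 1 "h x t" l] M_form[OF assms(1) that] M_L[OF assms(1)] assms(2) that
    by (simp add: form_simps)
qed

lemma Sy_U_L:
  assumes "t \<in> V" "\<tau> \<noteq> 0" "h t t = tr bar \<tau>" "\<And>x. x \<in> L \<Longrightarrow> scale (h x t / \<tau>) t \<in> L"
  shows "Sy t \<tau> \<in> U L"
  by (rule Sy_U') (use assms in auto)

lemma Sy_U_M:
  assumes "t \<in> M m" "has_val k \<tau>" "k \<le> m" "h t t = tr bar \<tau>"
  shows "Sy t \<tau> \<in> U L"
  by (rule Sy_U_L) (use assms in \<open>auto simp: has_val_neq_0 M_form M_L intro!: L_scale F_divide[of _ m]\<close>)

text \<open>In a Jordan splitting, components of scale P^i lie in \<open>M (l + 1)\<close> for i > l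
  and meet \<open>M l\<close> inside \<pi> L for i < l; the orthogonality assumption forces the
  latter for the component of s at i = l. No splitting is constructed:
  \<open>residual_splitting\<close> is applied to the pairing of generators of L with L.\<close>

lemma splitting:
  assumes s: "s \<in> M l" "\<And>y. y \<in> M l \<Longrightarrow> h s y \<in> F (l + 1)"
  obtains z where "z \<in> L" "scale \<pi> z \<in> M l" "s - scale \<pi> z \<in> M (l + 1)"
proof -
  obtain S where S: "finite S" "S \<subseteq> V" "L = ospan S" using lattice by (auto simp: lattice_in_def)
  obtain n where n: "\<forall>x\<in>L. \<forall>y\<in>L. h x y \<in> F n" using L_bounded by blast
  have "\<exists>z\<in>ospan S. \<forall>y\<in>L. h (s - scale \<pi> z) y \<in> F (l + 1)"
  proof (rule residual_splitting[OF S(1,2) L_subset])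
    show "h x y \<in> F n" if "x \<in> S" "y \<in> L" for x y
      using n that ospan_base S by blast
    show "h s y \<in> F (l + 1)" if "y \<in> L" "\<And>x. x \<in> S \<Longrightarrow> h x y \<in> F l" for y
      by (rule s(2), rule M_I) (use that form_ospan_F S in auto)
    show "y - scale a z \<in> L" if "y \<in> L" "z \<in> L" "a \<in> F 0" for a y z
      using that by simp
    show "s \<in> ospan S" using M_L[OF s(1)] S by simp
    show "h s y \<in> F l" if "y \<in> L" for y using M_form' s(1) that by simp
  qed
  then obtain z where z: "z \<in> L" "\<And>y. y \<in> L \<Longrightarrow> h (s - scale \<pi> z) y \<in> F (l + 1)"
    using S by blast
  have *: "s - scale \<pi> z \<in> M (l + 1)"
  proof (rule M_I)
    show "h x (s - scale \<pi> z) \<in> F (l + 1)" if "x \<in> L" for x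
      using z(2)[OF that] form_hermitian[of x "s - scale \<pi> z"] M_L[OF s(1)] z(1) that by simp
  qed (use z M_L[OF s(1)] in auto)
  moreover have "scale \<pi> z \<in> M l"
    using M_diff[OF s(1) M_mono[OF *, of l]] by simp
  ultimately show thesis using z that by blast
qed

definition proper_submodule :: "'v set \<Rightarrow> bool" where
  "proper_submodule X \<longleftrightarrow> X \<subset> L \<and> (\<forall>x\<in>X. \<forall>y\<in>X. \<forall>a\<in>F 0. x - scale a y \<in> X)"

lemma proper_submoduleI:
  assumes "\<And>p x y a. p \<in> P \<Longrightarrow> x \<in> L \<Longrightarrow> y \<in> L \<Longrightarrow> a \<in> F 0 \<Longrightarrow>
      p (x - scale a y) = p x - a * p y \<or> p (x - scale a y) = p x - bar a * p y"
    and "p0 \<in> P" "x0 \<in> L" "p0 x0 \<notin> F n"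
  shows "proper_submodule {x \<in> L. \<forall>p\<in>P. p x \<in> F n}"
  unfolding proper_submodule_def
proof (intro conjI ballI)
  fix x y a assume *: "x \<in> {x \<in> L. \<forall>p\<in>P. p x \<in> F n}" "y \<in> {x \<in> L. \<forall>p\<in>P. p x \<in> F n}" "a \<in> F 0"
  have "p (x - scale a y) \<in> F n" if "p \<in> P" for p
    using assms(1)[OF that, of x y a] F_diff[of "p x" n "a * p y"] F_diff[of "p x" n "bar a * p y"]
      F_smult[of a "p y" n] F_smult[of "bar a" "p y" n] * that by auto
  then show "x - scale a y \<in> {x \<in> L. \<forall>p\<in>P. p x \<in> F n}" using * by simp
qed (use assms in auto)

text \<open>If X contains x but not y, the four points \<open>y + scale a x\<close> with a among 0,
  1, u, 1 - u avoid X, and a further submodule containing two of them would contain x. So three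
  further submodules cannot catch all four. The residues of u and 1 - u differ because 2 lies in
  P.\<close>

lemma avoid:
  assumes "length Xs \<le> 4" "\<And>X. X \<in> set Xs \<Longrightarrow> proper_submodule X"
  shows "\<exists>x\<in>L. \<forall>X\<in>set Xs. x \<notin> X"
  using assms
proof (induction Xs)
  case (Cons X Xs)
  then obtain x where x: "x \<in> L" "\<forall>X\<in>set Xs. x \<notin> X" by auto
  show ?case
  proof (cases "x \<in> X")
    case True
    have X: "proper_submodule X" using Cons.prems by simp
    then obtain y where y: "y \<in> L" "y \<notin> X" by (auto simp: proper_submodule_def)
    obtain u where u: "has_val 0 u" "has_val 0 (1 - u)" using residue_gt_2 by blast
    have "has_val 0 (- 1 + 2 * u)"
      by (rule has_val_add) (use F_mult[OF F_2 has_val_F[OF u(1)], of 1] in \<open>auto simp: has_val_def\<close>)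
    then have u': "has_val 0 (u - (1 - u))" "has_val 0 ((1 - u) - u)"
      using has_val_uminus_iff[of 0 "(1 - u) - u"] by (simp_all add: algebra_simps)
    define A where "A = {0, 1, u, 1 - u}"
    have dist: "has_val 0 (a - b)" if "a \<in> A" "b \<in> A" "a \<noteq> b" for a b
      using that u u' has_val_uminus_iff[of 0 "1 - u"] has_val_uminus_iff[of 0 u]
      by (auto simp: A_def has_val_def)
    have "distinct [0, 1, u, 1 - u]"
      using u u' by (auto simp: has_val_def)
    then have cardA: "card A = 4" unfolding A_def using distinct_card by fastforce
    have AF: "a \<in> F 0" if "a \<in> A" for a
      using that u by (auto simp: A_def has_val_F)
    show ?thesis
    proof (rule ccontr)
      assume no: "\<not> ?thesis"
      have "y + scale a x \<notin> X" if "a \<in> A" for a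
      proof
        assume "y + scale a x \<in> X"
        then have "(y + scale a x) - scale a x \<in> X"
          using True X AF[OF that] unfolding proper_submodule_def by blast
        then show False using y by simp
      qed
      then have "\<forall>a\<in>A. \<exists>Y\<in>set Xs. y + scale a x \<in> Y"
        using no x y AF by (metis L_add L_scale set_ConsD)
      then obtain c where c: "\<And>a. a \<in> A \<Longrightarrow> c a \<in> set Xs \<and> y + scale a x \<in> c a" by metis
      have "card (c ` A) \<le> length Xs"
        using c by (intro order.trans[OF card_mono[of "set Xs"] card_length]) auto
      then have "\<not> inj_on c A"
        using Cons.prems(1) cardA by (intro pigeonhole) auto
      then obtain a b where ab: "a \<in> A" "b \<in> A" "a \<noteq> b" "c a = c b" by (auto simp: inj_on_def)
      define Y where "Y = c a"
      have Y: "proper_submodule Y" "Y \<in> set Xs" "y + scale a x \<in> Y" "y + scale b x \<in> Y"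
        using c[OF ab(1)] c[OF ab(2)] ab(4) Cons.prems by (auto simp: Y_def)
      have step: "p - scale k q \<in> Y" if "p \<in> Y" "q \<in> Y" "k \<in> F 0" for p q k
        using Y(1) that by (simp add: proper_submodule_def)
      have "(y + scale a x) - scale 1 (y + scale b x) \<in> Y"
        using Y by (intro step) auto
      then have 1: "scale (a - b) x \<in> Y" by (simp add: scale_left_diff_distrib)
      then have 0: "0 \<in> Y" using step[of "scale (a - b) x" "scale (a - b) x" 1] by simp
      have "0 - scale (- inverse (a - b)) (scale (a - b) x) \<in> Y"
        using has_val_inverse[OF dist[OF ab(1-3)], of 0] by (intro step 0 1) (auto simp: has_val_F)
      then have "x \<in> Y" using ab(3) by simp
      then show False using x Y by blast
    qed
  next
    case False
    with x show ?thesis by (intro bexI[of _ x]) auto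
  qed
next
  case Nil
  show ?case by (intro bexI[of _ 0]) auto
qed


lemma has_valI: "x \<in> F n \<Longrightarrow> x \<notin> F (n + 1) \<Longrightarrow> has_val n x"
  by (simp add: has_val_iff)

lemma good_step_M:
  assumes f: "f \<in> U L" and x: "x \<in> L" "D f x \<in> M m" "has_val m (h x (D f x))"
  obtains g where "g \<in> U L" "g \<in> G L \<Longrightarrow> f \<in> G L"
    "\<And>v. v \<in> V \<Longrightarrow> D g v = D f v - scale (bar (h x (D f v) / h x (D f x))) (D f x)"
    "\<And>n. rank_le (Suc n) f \<Longrightarrow> rank_le n g"
proof (rule good_step[OF f L_subset, of x])
  show "Sy (D f x) (h x (D f x)) \<in> U L"
    using Sy_U_M[OF x(2,3)] form_D_self[OF f] x(1) by simp
qed (use x has_val_neq_0 in auto)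

text \<open>Modulo \<open>P\<^sup>l\<^sup>+\<^sup>1\<close> the form \<open>b x y = h x (D f y)\<close> is alternating, so \<open>f\<close> itself has no good step.
  Multiplying by the symmetry at \<open>t\<close> adds a rank one form to \<open>b\<close> and costs one dimension; two good
  steps, at \<open>x1\<close> and \<open>x2\<close>, then win back two. The Gram determinant of the modified form at \<open>x1, x2\<close>
  is \<open>b x1 x2 * A x1 x2\<close> in the residue field, up to sign.\<close>

lemma case_regular:
  assumes f: "f \<in> U L" and Df: "\<And>y. y \<in> L \<Longrightarrow> D f y \<in> M l"
    and alt: "\<And>x. x \<in> L \<Longrightarrow> h x (D f x) \<in> F (l + 1)"
    and y: "y1 \<in> L" "y2 \<in> L" "h y1 (D f y2) \<notin> F (l + 1)"
    and t: "t \<in> M l" "has_val l \<tau>" "h t t = tr bar \<tau>" and u0: "u0 \<in> L" "h u0 t \<notin> F (l + 1)"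
  obtains g where "g \<in> U L" "g \<in> G L \<Longrightarrow> f \<in> G L" "\<And>n. rank_le (Suc n) f \<Longrightarrow> rank_le n g"
proof -
  note tL = M_L[OF t(1)]
  define b where "b x y = h x (D f y)" for x y
  define A where "A x y = b x y + (h x t * b t y + h (D f x) t * h t y) / \<tau>" for x y
  have bF: "b x y \<in> F l" if "x \<in> L" "y \<in> L" for x y
    unfolding b_def by (rule M_form[OF Df]) (use that in auto)
  have hDt: "h (D f x) t = bar (b t x)" if "x \<in> L" for x
    unfolding b_def by (rule form_hermitian) (use that f tL in auto)
  have htx: "h t x = bar (h x t)" if "x \<in> L" for x
    by (rule form_hermitian) (use that tL in auto)
  have ptF: "h x t \<in> F l" if "x \<in> L" for x
    using M_form[OF t(1) that] .
  have b_left: "b (x - scale a y) z = b x z - a * b y z" if "x \<in> L" "y \<in> L" "z \<in> L" for x y z a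
    using that f by (simp add: b_def form_simps V_closed)
  have b_right: "b z (x - scale a y) = b z x - bar a * b z y" if "x \<in> L" "y \<in> L" "z \<in> L" for x y z a
    using that f by (simp add: b_def form_simps V_closed D_diff D_scale D_V)
  have A_left: "A (x - scale a y) z = A x z - a * A y z" if "x \<in> L" "y \<in> L" "z \<in> L" for x y z a
  proof -
    have *: "h (D f (x - scale a y)) t = h (D f x) t - a * h (D f y) t"
      "h (x - scale a y) t = h x t - a * h y t"
      using that f tL by (simp_all add: form_simps V_closed D_diff D_scale D_V)
    show ?thesis unfolding A_def b_left[OF that] *
      by (simp add: algebra_simps add_divide_distrib diff_divide_distrib)
  qed
  have A_right: "A z (x - scale a y) = A z x - bar a * A z y" if "x \<in> L" "y \<in> L" "z \<in> L" for x y z a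
  proof -
    have *: "h t (x - scale a y) = h t x - bar a * h t y"
      using that tL by (simp add: form_simps V_closed)
    show ?thesis unfolding A_def b_right[OF that(1,2) tL] b_right[OF that] *
      by (simp add: algebra_simps add_divide_distrib diff_divide_distrib)
  qed
  have AF: "A x y \<in> F l" if "x \<in> L" "y \<in> L" for x y
  proof -
    have "h x t * b t y + h (D f x) t * h t y \<in> F (l + l)"
      unfolding htx[OF that(2)] hDt[OF that(1)] using that
      by (intro F_add F_mult[of _ l _ l]) (auto intro: ptF bF tL)
    from F_divide[OF this t(2), of l] show ?thesis
      unfolding A_def by (intro F_add bF that) auto
  qed
  \<comment> \<open>If some \<open>b t y\<close> has valuation l, then (t, y) works: both
    corrections vanish modulo the next ideal, as \<open>h t t\<close> is a trace and b is
    alternating there. Otherwise the corrections vanish for all pairs and A inherits a nonzero value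
    from b.\<close>
  have "\<exists>x\<in>L. \<exists>y\<in>L. A x y \<notin> F (l + 1)"
  proof -
    have A_cong: "A x y \<notin> F (l + 1)" if "x \<in> L" "y \<in> L" "b x y \<notin> F (l + 1)"
      "h x t * b t y \<in> F (l + l + 1)" "h (D f x) t * h t y \<in> F (l + l + 1)" for x y
    proof
      assume "A x y \<in> F (l + 1)"
      moreover have "(h x t * b t y + h (D f x) t * h t y) / \<tau> \<in> F (l + 1)"
        by (rule F_divide[OF F_add[OF that(4,5)] t(2)]) simp
      ultimately have "b x y \<in> F (l + 1)" unfolding A_def
        by (metis F_diff add_diff_cancel_right')
      then show False using that by simp
    qed
    show ?thesis
    proof (cases "\<exists>y\<in>L. b t y \<notin> F (l + 1)")
      case True
      then obtain y where y: "y \<in> L" "b t y \<notin> F (l + 1)" by blast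
      have "h t t \<in> F (l + 1)" unfolding t(3) by (rule F_tr[OF has_val_F[OF t(2)]])
      then have "h t t * b t y \<in> F (l + l + 1)"
        by (rule F_mult[OF _ bF[OF tL y(1)]]) simp
      moreover have "h (D f t) t \<in> F (l + 1)" using alt[OF tL] by (simp add: hDt[OF tL] b_def)
      then have "h (D f t) t * h t y \<in> F (l + l + 1)"
        by (rule F_mult[of _ _ _ l]) (use htx[OF y(1)] ptF[OF y(1)] in auto)
      ultimately show ?thesis using A_cong[OF tL y] tL y by blast
    next
      case False
      have "h y1 t * b t y2 \<in> F (l + l + 1)"
        by (rule F_mult[of _ l _ "l + 1"]) (use False y ptF in auto)
      moreover have "h (D f y1) t * h t y2 \<in> F (l + l + 1)"
        by (rule F_mult[of _ "l + 1" _ l]) (use False y ptF htx hDt in auto)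
      ultimately show ?thesis using A_cong[OF y(1,2) y(3)[folded b_def]] y by blast
    qed
  qed
  then obtain z1 z2 where z: "z1 \<in> L" "z2 \<in> L" "A z1 z2 \<notin> F (l + 1)" by blast
  \<comment> \<open>Surjectivity of f on L makes the condition on \<open>h (f x) t\<close> define a
    proper submodule as well.\<close>
  obtain u1 where u1: "u1 \<in> L" "f u1 = u0" using U_surj[OF f u0(1)] by blast
  define K where "K P = {x \<in> L. \<forall>p\<in>P. p x \<in> F (l + 1)}" for P :: "('v \<Rightarrow> 'e) set"
  \<comment> \<open>Four conditions, as many as \<open>avoid\<close> permits: two make the first
    diagonal entry of the Gram matrix have valuation l after the twist, two leave room for
    x2.\<close>
  have "\<exists>x\<in>L. \<forall>X\<in>set [K {\<lambda>x. h x t}, K {\<lambda>x. h (f x) t}, K ((\<lambda>y x. b x y) ` L),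
      K ((\<lambda>y x. A x y) ` L)]. x \<notin> X"
  proof (rule avoid)
    have "proper_submodule (K {\<lambda>x. h x t})" unfolding K_def
      by (rule proper_submoduleI[of _ "\<lambda>x. h x t" u0]) (use u0 tL in \<open>auto simp: form_simps V_closed\<close>)
    moreover have "proper_submodule (K {\<lambda>x. h (f x) t})" unfolding K_def
    proof (rule proper_submoduleI[of _ "\<lambda>x. h (f x) t" u1])
      fix p x y a assume "p \<in> {\<lambda>x. h (f x) t}" "x \<in> L" "y \<in> L"
      moreover have "f (x - scale a y) = f x - scale a (f y)" if "x \<in> L" "y \<in> L"
        using D_diff[OF f, of x "scale a y"] D_scale[OF f, of y a] that
        by (simp add: D_def V_closed scale_right_diff_distrib algebra_simps)
      ultimately show "p (x - scale a y) = p x - a * p y \<or> p (x - scale a y) = p x - bar a * p y"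
        using f tL by (auto simp: form_simps V_closed U_V)
    qed (use u1 u0 in auto)
    moreover have "proper_submodule (K ((\<lambda>y x. b x y) ` L))" unfolding K_def
      by (rule proper_submoduleI[of _ "\<lambda>x. b x y2" y1]) (use y(1,2) y(3)[folded b_def] in \<open>auto simp: b_left\<close>)
    moreover have "proper_submodule (K ((\<lambda>y x. A x y) ` L))" unfolding K_def
      by (rule proper_submoduleI[of _ "\<lambda>x. A x z2" z1]) (use z in \<open>auto simp: A_left\<close>)
    ultimately show "proper_submodule X" if "X \<in> set [K {\<lambda>x. h x t}, K {\<lambda>x. h (f x) t},
        K ((\<lambda>y x. b x y) ` L), K ((\<lambda>y x. A x y) ` L)]" for X
      using that by auto
  qed simp
  then obtain x1 where x1: "x1 \<in> L" "h x1 t \<notin> F (l + 1)" "h (f x1) t \<notin> F (l + 1)"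
    "\<exists>y\<in>L. b x1 y \<notin> F (l + 1)" "\<exists>y\<in>L. A x1 y \<notin> F (l + 1)"
    by (auto simp: K_def)
  have "\<exists>x\<in>L. \<forall>X\<in>set [K {b x1}, K {A x1}]. x \<notin> X"
  proof (rule avoid)
    have "proper_submodule (K {b x1})"
      using x1(4) unfolding K_def
      by (elim bexE, intro proper_submoduleI[of _ "b x1"]) (use x1(1) in \<open>auto simp: b_right\<close>)
    moreover have "proper_submodule (K {A x1})"
      using x1(5) unfolding K_def
      by (elim bexE, intro proper_submoduleI[of _ "A x1"]) (use x1(1) in \<open>auto simp: A_right\<close>)
    ultimately show "proper_submodule X" if "X \<in> set [K {b x1}, K {A x1}]" for X using that by auto
  qed simp
  then obtain x2 where x2: "x2 \<in> L" "b x1 x2 \<notin> F (l + 1)" "A x1 x2 \<notin> F (l + 1)"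
    by (auto simp: K_def)
  have SyU: "Sy t \<tau> \<in> U L" using Sy_U_M[OF t(1,2) order_refl t(3)] .
  obtain g where g: "g \<in> U L" "g \<in> G L \<Longrightarrow> f \<in> G L"
    "\<And>v. v \<in> V \<Longrightarrow> D g v = D f v + scale (h (f v) t / \<tau>) t"
    "\<And>n. rank_le n f \<Longrightarrow> rank_le (Suc n) g"
    using twist_step[OF f L_subset _ has_val_neq_0[OF t(2)] t(3) SyU] tL by auto
  have DgM: "D g v \<in> M l" if "v \<in> L" for v
  proof -
    have "h (f v) t / \<tau> \<in> F 0"
      by (rule F_divide[OF ptF[OF U_L[OF f that]] t(2)]) simp
    then show ?thesis using that g(3) by (auto intro: M_add Df M_scale t(1))
  qed
  have Gv: "h x (D g v) = b x v + h x t * h t (f v) / bar \<tau>" if "x \<in> L" "v \<in> L" for x v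
    using that f tL htx[OF U_L[OF f that(2)]]
    by (simp add: g(3) form_simps V_closed b_def D_V)
  have q: "h t (f x) = bar (h x t) - b t x" if "x \<in> L" for x
    using that f tL htx[OF that] by (simp add: b_def D_def form_simps V_closed U_V)
  have alt2: "b x1 x2 + b x2 x1 \<in> F (l + 1)"
  proof -
    have "h (x1 + x2) (D f (x1 + x2)) - h x1 (D f x1) - h x2 (D f x2) \<in> F (l + 1)"
      using x1(1) x2(1) by (intro F_diff alt) auto
    then show ?thesis using x1(1) x2(1) f
      by (simp add: D_add form_simps V_closed D_V b_def add.commute)
  qed
  note det = residue_det_regular[where ?a11.0 = "b x1 x1" and ?a22.0 = "b x2 x2" and l = l
      and ?a12.0 = "b x1 x2" and ?a21.0 = "b x2 x1" and ?p1.0 = "h x1 t" and ?p2.0 = "h x2 t"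
      and ?c1.0 = "b t x1" and ?c2.0 = "b t x2" and \<tau> = \<tau>
      and ?q1.0 = "h t (f x1)" and ?q2.0 = "h t (f x2)"]
  have ex_q: "has_val l (h t (f x1))"
    using x1(1,3) htx[OF U_L[OF f x1(1)]] ptF[OF U_L[OF f x1(1)]] by (simp add: has_val_iff)
  have ex_A: "has_val l (b x1 x2 + (h x1 t * b t x2 + bar (b t x1) * bar (h x2 t)) / \<tau>)"
    using x2 AF[of x1 x2] x1(1) by (simp add: has_val_iff A_def hDt htx)
  have det1: "has_val l (h x1 (D g x1))"
    by (rule det(1)) (use x1 x2 alt alt2 bF ptF tL ex_q ex_A t in
        \<open>auto simp: Gv q has_valI simp flip: b_def\<close>)
  have det2: "has_val l (h x2 (D g x2) - h x1 (D g x2) / h x1 (D g x1) * h x2 (D g x1))"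
    by (rule det(2)) (use x1 x2 alt alt2 bF ptF tL ex_q ex_A t in
        \<open>auto simp: Gv q has_valI simp flip: b_def\<close>)
  obtain g1 where g1: "g1 \<in> U L" "g1 \<in> G L \<Longrightarrow> g \<in> G L"
    "\<And>v. v \<in> V \<Longrightarrow> D g1 v = D g v - scale (bar (h x1 (D g v) / h x1 (D g x1))) (D g x1)"
    "\<And>n. rank_le (Suc n) g \<Longrightarrow> rank_le n g1"
    using good_step_M[OF g(1) x1(1) DgM[OF x1(1)] det1] by metis
  have "bar (h x1 (D g x2) / h x1 (D g x1)) \<in> F 0"
    unfolding F_bar_iff
    by (rule F_divide[OF M_form[OF DgM[OF x2(1)] x1(1)] det1]) simp
  then have Dg1M: "D g1 x2 \<in> M l"
    using x1(1) x2(1) by (simp add: g1(3) M_diff M_scale DgM del: bar_divide)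
  have "h x2 (D g1 x2) = h x2 (D g x2) - h x1 (D g x2) / h x1 (D g x1) * h x2 (D g x1)"
    using x1(1) x2(1) g(1) by (simp add: g1(3) form_simps V_closed D_V)
  then have ex2: "has_val l (h x2 (D g1 x2))" using det2 by simp
  obtain g2 where g2: "g2 \<in> U L" "g2 \<in> G L \<Longrightarrow> g1 \<in> G L" "\<And>n. rank_le (Suc n) g1 \<Longrightarrow> rank_le n g2"
    using good_step_M[OF g1(1) x2(1) Dg1M ex2] by metis
  show thesis
    by (rule that[of g2]) (use g g1 g2 in blast)+
qed

text \<open>Adding fixed multiples of \<theta> keeps the trace. Each of the two conditions excludes
  at most one residue of the multiplier, so three residues suffice.\<close>

lemma pick_trace:
  assumes F: "\<tau>0 \<in> F m" "e \<in> F m" and \<theta>: "tr bar \<theta> = 0" "has_val m \<theta>"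
  obtains \<tau> where "tr bar \<tau> = tr bar \<tau>0" "has_val m \<tau>" "has_val m (\<tau> + e)"
proof -
  obtain u where u: "has_val 0 u" "has_val 0 (1 - u)" using residue_gt_2 by blast
  \<comment> \<open>The multiplier must be fixed by \<open>bar\<close>, which u need not be. Its
    norm is, and 1 minus this norm reduces to (1 - u)(1 + u).\<close>
  define c where "c = u * bar u"
  have c: "has_val 0 c" "bar c = c" using u by (auto simp: c_def intro: has_val_mult)
  have "has_val 0 (1 - u + 2 * u)"
    by (rule has_val_add[OF u(2)]) (use F_mult[OF F_2 has_val_F[OF u(1)], of 1] in auto)
  then have "has_val 0 ((1 - u) * (1 - u + 2 * u))" using u by (auto intro: has_val_mult)
  then have "has_val 0 (1 - u * u)" by (simp add: algebra_simps)
  moreover have "gr_eq 0 (1 - c) (1 - u * u)"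
    unfolding c_def by (intro gr_eq_diff gr_eq_refl gr_eq_mult[of 0 _ _ 0] gr_eq_bar F_1 has_val_F[OF u(1)]) auto
  ultimately have c1: "has_val 0 (1 - c)" using gr_eq_ex by blast
  define p where "p a x \<longleftrightarrow> x + a * \<theta> \<in> F (m + 1)" for a x
  have p: "\<not> (p a x \<and> p a' x)" if "has_val 0 (a - a')" for a a' x
  proof
    assume "p a x \<and> p a' x"
    then have "(x + a * \<theta>) - (x + a' * \<theta>) \<in> F (m + 1)" unfolding p_def by blast
    then have "(a - a') * \<theta> \<in> F (m + 1)" by (simp add: algebra_simps)
    moreover have "has_val m ((a - a') * \<theta>)" using that \<theta> by (auto intro: has_val_mult)
    ultimately show False by (simp add: has_val_iff)
  qed
  have e1: "has_val 0 (1 - 0)" "has_val 0 (c - 0)" "has_val 0 (1 - c)" using c c1 by (auto simp: has_val_def)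
  have "\<exists>a\<in>{0, 1, c}. \<not> p a \<tau>0 \<and> \<not> p a (\<tau>0 + e)"
    using p[OF e1(1)] p[OF e1(2)] p[OF e1(3)] by blast
  then obtain a where a: "a \<in> {0, 1, c}" "\<not> p a \<tau>0" "\<not> p a (\<tau>0 + e)" by blast
  have ab: "bar a = a" "a \<in> F 0" using a c by (auto simp: has_val_F)
  have "a * \<theta> \<in> F m" using ab has_val_F[OF \<theta>(2)] by auto
  then have "\<tau>0 + a * \<theta> \<in> F m" "\<tau>0 + a * \<theta> + e \<in> F m" using F by auto
  moreover have "bar \<theta> = - \<theta>" using \<theta>(1) by (simp add: tr_def add_eq_0_iff)
  then have "tr bar (\<tau>0 + a * \<theta>) = tr bar \<tau>0" using ab by (simp add: tr_def)
  moreover have "\<tau>0 + a * \<theta> \<notin> F (m + 1)" "\<tau>0 + a * \<theta> + e \<notin> F (m + 1)"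
    using a(2,3) by (simp_all add: p_def add.assoc add.commute[of e])
  ultimately show thesis using that[of "\<tau>0 + a * \<theta>"] by (simp add: has_val_iff)
qed

text \<open>Here no symmetry is available at level \<open>l\<close>, but there is one at the vector \<open>\<pi> z\<close> with \<open>\<tau>\<close> of
  valuation \<open>l + 1\<close>. After multiplying by it the good steps are at \<open>x2\<close>, on level \<open>l - 1\<close>, and at
  \<open>x1\<close>, on level \<open>l + 1\<close>.\<close>

lemma case_irregular:
  assumes f: "f \<in> U L" and Df: "\<And>y. y \<in> L \<Longrightarrow> D f y \<in> M l"
    and alt: "\<And>x. x \<in> L \<Longrightarrow> h x (D f x) \<in> F (l + 1)"
    and x: "x1 \<in> L" "x2 \<in> L" "has_val l (h x2 (D f x1))"
    and z: "z \<in> L" "scale \<pi> z \<in> M l" "D f x1 - scale \<pi> z \<in> M (l + 1)"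
    and tr: "h (scale \<pi> z) (scale \<pi> z) = tr bar \<tau>0" "\<tau>0 \<in> F (l + 1)"
    and \<theta>: "tr bar \<theta> = 0" "has_val (l + 1) \<theta>"
  obtains g where "g \<in> U L" "g \<in> G L \<Longrightarrow> f \<in> G L" "\<And>n. rank_le (Suc n) f \<Longrightarrow> rank_le n g"
proof -
  define r where "r = scale \<pi> z"
  have r: "r \<in> L" "r \<in> M l" "D f x1 - r \<in> M (l + 1)" using z by (auto simp: r_def)
  have hrx: "h r v = bar (h v r)" if "v \<in> L" for v
    by (rule form_hermitian) (use that r in auto)
  have hrD: "h r (D f v) \<in> F (l + 1)" if "v \<in> L" for v
  proof -
    have "h r (D f v) = \<pi> * h z (D f v)" using that z f by (simp add: r_def form_simps)
    then show ?thesis using F_mult[OF F_pi M_form[OF Df[OF that] z(1)], of "l + 1"] by simp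
  qed
  have q: "h r (f v) = bar (h v r) - h r (D f v)" if "v \<in> L" for v
    using that f r(1) hrx[OF that] by (simp add: D_def form_simps U_V)
  have qb: "h (f v) r = bar (h r (f v))" if "v \<in> L" for v
    by (rule form_hermitian) (use that f r in \<open>auto simp: U_V\<close>)
  have "h x1 r = h x1 (D f x1) - h x1 (D f x1 - r)"
    using x r f by (simp add: form_simps V_closed D_V)
  then have p1: "h x1 r \<in> F (l + 1)"
    using alt[OF x(1)] M_form[OF r(3) x(1)] by auto
  have "h x2 r = h x2 (D f x1) + - h x2 (D f x1 - r)"
    using x r f by (simp add: form_simps V_closed D_V)
  then have p2: "gr_eq l (h x2 r) (h x2 (D f x1))"
    using has_val_F[OF x(3)] M_form[OF r(3) x(2)] by (intro gr_eq_I) auto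
  have q1: "h r (f x1) \<in> F (l + 1)"
    unfolding q[OF x(1)] using p1 hrD[OF x(1)] by auto
  have "gr_eq l (h r (f x2)) (bar (h x2 r))"
    by (rule gr_eq_I[where y = "- h r (D f x2)"])
      (use M_form[OF r(2) x(2)] hrD[OF x(2)] q[OF x(2)] in auto)
  then have q2: "gr_eq l (h r (f x2)) (h x2 (D f x1))"
    using gr_eq_trans gr_eq_bar M_form[OF r(2) x(2)] p2 by metis
  have e: "h x1 (D f x1) + h r (f x1) + h x1 r \<in> F (l + 1)"
    using alt[OF x(1)] q1 p1 by auto
  obtain \<tau> where \<tau>: "tr bar \<tau> = tr bar \<tau>0" "has_val (l + 1) \<tau>"
    "has_val (l + 1) (\<tau> + (h x1 (D f x1) + h r (f x1) + h x1 r))"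
    using pick_trace[OF tr(2) e \<theta>] by metis
  have t0: "\<tau> \<noteq> 0" using \<tau>(2) by (rule has_val_neq_0)
  have hrr: "h r r = tr bar \<tau>" using tr \<tau> by (simp add: r_def)
  \<comment> \<open>Membership of r in \<open>M l\<close> is one level short of \<tau>; the missing
    factor is the \<pi> in \<open>r = scale \<pi> z\<close>.\<close>
  have SyU: "Sy r \<tau> \<in> U L"
  proof (rule Sy_U_L)
    fix v assume v: "v \<in> L"
    have "h v r * \<pi> / \<tau> \<in> F 0"
      by (rule F_divide[OF F_mult[OF M_form[OF r(2) v] F_pi order_refl] \<tau>(2)]) simp
    then have "scale (h v r * \<pi> / \<tau>) z \<in> L" using z(1) by simp
    then show "scale (h v r / \<tau>) r \<in> L" by (simp add: r_def)
  qed (use r t0 hrr in auto)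
  obtain g where g: "g \<in> U L" "g \<in> G L \<Longrightarrow> f \<in> G L"
    "\<And>v. v \<in> V \<Longrightarrow> D g v = D f v + scale (h (f v) r / \<tau>) r"
    "\<And>n. rank_le n f \<Longrightarrow> rank_le (Suc n) g"
    using twist_step[OF f L_subset _ t0 hrr SyU] r by auto
  have Gv: "h v (D g v') = h v (D f v') + h v r * h r (f v') / bar \<tau>" if "v \<in> L" "v' \<in> L" for v v'
    using that f r by (simp add: g(3) form_simps V_closed D_V qb)
  have alt2: "h x1 (D f x2) + h x2 (D f x1) \<in> F (l + 1)"
  proof -
    have "h (x1 + x2) (D f (x1 + x2)) - h x1 (D f x1) - h x2 (D f x2) \<in> F (l + 1)"
      using x by (intro F_diff alt) auto
    then show ?thesis using x f
      by (simp add: D_add form_simps V_closed D_V add.commute)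
  qed
  note det = residue_det_irregular[where ?a11.0 = "h x1 (D f x1)" and ?a22.0 = "h x2 (D f x2)" and l = l
      and ?a12.0 = "h x1 (D f x2)" and ?a21.0 = "h x2 (D f x1)" and ?p1.0 = "h x1 r"
      and ?p2.0 = "h x2 r" and \<tau> = \<tau> and ?q1.0 = "h r (f x1)" and ?q2.0 = "h r (f x2)",
      OF alt[OF x(1)] alt[OF x(2)] alt2 x(3) p1 p2 q1 q2 \<tau>(2,3)
      Gv[OF x(1,1)] Gv[OF x(1,2)] Gv[OF x(2,1)] Gv[OF x(2,2)]]
  define k1 where "k1 = bar (h r (f x1)) / \<tau>"
  define k2 where "k2 = bar (h r (f x2)) / \<tau>"
  define c where "c = bar (h x2 (D g x1) / h x2 (D g x2))"
  have Dg1: "D g x1 = D f x1 + scale k1 r" and Dg2: "D g x2 = D f x2 + scale k2 r"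
    using x by (simp_all add: g(3) qb k1_def k2_def)
  \<comment> \<open>The coefficient k2 has at most a simple pole, again compensated by the \<pi> in
    r.\<close>
  have k2r: "scale k2 r \<in> M (l - 1)"
  proof (rule M_I)
    have "k2 * \<pi> \<in> F 0" using F_mult[OF det(5) F_pi, of 0] by (simp add: k2_def)
    then have "scale (k2 * \<pi>) z \<in> L" using z(1) by simp
    then show "scale k2 r \<in> L" by (simp add: r_def)
    fix v assume v: "v \<in> L"
    have "bar k2 * h v r \<in> F (l - 1)"
      by (rule F_mult[of _ "- 1" _ l]) (use det(5) M_form[OF r(2) v] in \<open>auto simp: k2_def simp del: bar_divide\<close>)
    then show "h v (scale k2 r) \<in> F (l - 1)" using v r by (simp add: form_simps)
  qed
  have DgM: "D g x2 \<in> M (l - 1)"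
    unfolding Dg2 by (rule M_add[OF M_mono[OF Df[OF x(2)]] k2r]) simp
  obtain g1 where g1: "g1 \<in> U L" "g1 \<in> G L \<Longrightarrow> g \<in> G L"
    "\<And>v. v \<in> V \<Longrightarrow> D g1 v = D g v - scale (bar (h x2 (D g v) / h x2 (D g x2))) (D g x2)"
    "\<And>n. rank_le (Suc n) g \<Longrightarrow> rank_le n g1"
    using good_step_M[OF g(1) x(2) DgM det(1)] by metis
  have Dg1x1: "D g1 x1 = D g x1 - scale c (D g x2)"
    using g1(3) x by (simp add: c_def)
  \<comment> \<open>Regrouped so that every summand gains a level: the first by the choice of z, the
    others because their coefficients lie in P.\<close>
  also have "\<dots> = (D f x1 - r) + scale (1 + k1 - c * k2) r - scale c (D f x2)"
    by (simp add: Dg1 Dg2 scale_left_distrib scale_left_diff_distrib scale_right_distrib algebra_simps)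
  also have "\<dots> \<in> M (l + 1)"
    using det(3,6) by (intro M_add M_diff M_scale_pi r Df x) (auto simp: c_def k1_def k2_def)
  finally have Dg1M: "D g1 x1 \<in> M (l + 1)" .
  have "h x1 (D g1 x1) = h x1 (D g x1) - bar c * h x1 (D g x2)"
    unfolding Dg1x1 using x g(1) by (simp add: form_simps V_closed D_V)
  then have ex2: "has_val (l + 1) (h x1 (D g1 x1))" using det(2) by (simp add: c_def)
  obtain g2 where g2: "g2 \<in> U L" "g2 \<in> G L \<Longrightarrow> g1 \<in> G L" "\<And>n. rank_le (Suc n) g1 \<Longrightarrow> rank_le n g2"
    using good_step_M[OF g1(1) x(1) Dg1M ex2] by metis
  show thesis
    by (rule that[of g2]) (use g g1 g2 in blast)+
qed


text \<open>\<open>splitting\<close> approximates \<open>D f x1\<close> by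
  \<open>scale \<pi> z\<close>, but the norm of \<open>scale \<pi> z\<close> must also be a trace
  from \<open>F (l + 1)\<close>. The obstruction is the residue of one coefficient c, along a vector
  g, and a suitable choice of x1 makes it vanish.\<close>

lemma irregular_data:
  assumes f: "f \<in> U L" and Df: "\<And>y. y \<in> L \<Longrightarrow> D f y \<in> M l"
    and alt: "\<And>x. x \<in> L \<Longrightarrow> h x (D f x) \<in> F (l + 1)"
    and y: "y1 \<in> L" "y2 \<in> L" "h y1 (D f y2) \<notin> F (l + 1)"
    and irr: "\<nexists>t \<tau>. t \<in> M l \<and> has_val l \<tau> \<and> h t t = tr bar \<tau>"
  obtains x1 x2 z \<tau>0 where "x1 \<in> L" "x2 \<in> L" "has_val l (h x2 (D f x1))"
    "z \<in> L" "scale \<pi> z \<in> M l" "D f x1 - scale \<pi> z \<in> M (l + 1)"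
    "h (scale \<pi> z) (scale \<pi> z) = tr bar \<tau>0" "\<tau>0 \<in> F (l + 1)"
proof -
  note result = that
  \<comment> \<open>\<open>N\<close> is isotropic modulo \<open>P\<^sup>l\<^sup>+\<^sup>1\<close>, since its vectors admit no symmetry of level \<open>l\<close>, and has
      corank at most one in \<open>M l\<close>, since the norms of \<open>M l\<close> are, modulo traces, norms from the
      extension times the norm of a single vector \<open>g\<close>.\<close>
  define N where "N = {t \<in> M l. h t t \<in> TrF l}"
  have N_M: "t \<in> M l" if "t \<in> N" for t using that by (simp add: N_def)
  have M_in_L: "t \<in> L" if "t \<in> M l" for t using that by (rule M_L)
  have N_tr: "\<exists>\<tau>\<in>F (l + 1). h t t = tr bar \<tau>" if "t \<in> N" for t
  proof -
    obtain \<tau> where "\<tau> \<in> F l" "h t t = tr bar \<tau>" using \<open>t \<in> N\<close> by (auto simp: N_def TrF_def)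
    then show ?thesis using irr N_M[OF that] by (metis has_val_iff)
  qed
  have swap: "h s t = bar (h t s)" if "s \<in> M l" "t \<in> M l" for s t
    by (rule form_hermitian) (use that M_in_L in auto)
  have MM: "h s t \<in> F l" if "s \<in> M l" "t \<in> M l" for s t
    using M_form[OF that(2) M_in_L[OF that(1)]] .
  \<comment> \<open>Otherwise the norm of \<open>s + t\<close> would be the trace of an element of
    valuation l, which \<open>irr\<close> excludes.\<close>
  have N_orth: "h s t \<in> F (l + 1)" if st: "s \<in> N" "t \<in> N" for s t
  proof (rule ccontr)
    assume *: "h s t \<notin> F (l + 1)"
    obtain \<tau> \<tau>' where \<tau>: "\<tau> \<in> F (l + 1)" "h s s = tr bar \<tau>" "\<tau>' \<in> F (l + 1)" "h t t = tr bar \<tau>'"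
      using N_tr st by metis
    have "has_val l (h s t)" using * MM st N_M by (simp add: has_val_iff)
    then have "has_val l (h s t + (\<tau> + \<tau>'))" using \<tau> by (intro has_val_add) auto
    moreover have "h (s + t) (s + t) = tr bar (h s t + (\<tau> + \<tau>'))"
      using st N_M M_in_L \<tau> swap[of t s] by (simp add: form_simps V_closed tr_add) (simp add: tr_def)
    ultimately show False using irr M_add st N_M by metis
  qed
  have N_diff: "s - scale a t \<in> N" if st: "s \<in> N" "t \<in> N" "a \<in> F 0" for s t a
  proof -
    have eq: "h (s - scale a t) (s - scale a t) = h s s + (a * bar a) * h t t + - tr bar (a * h t s)"
      using st N_M M_in_L swap[of s t] by (simp add: form_simps V_closed tr_def algebra_simps)
    have st_tr: "h s s \<in> TrF l" "h t t \<in> TrF l" using st by (auto simp: N_def)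
    have "a * h t s \<in> F l" using st MM N_M by auto
    moreover have "(a * bar a) * h t t \<in> TrF l"
      by (rule TrF_smult[OF st_tr(2)]) (use st(3) in \<open>auto simp: mult.commute\<close>)
    ultimately have "h (s - scale a t) (s - scale a t) \<in> TrF l"
      unfolding eq using st_tr by (intro TrF_add TrF_uminus TrF_I)
    then show ?thesis using st(3) N_M[OF st(1)] N_M[OF st(2)] by (simp add: N_def M_diff M_scale)
  qed
  have "\<exists>g\<in>M l. \<forall>t\<in>M l. \<exists>c\<in>F 0. t - scale c g \<in> N"
  proof (cases "M l \<subseteq> N")
    case True
    have "0 \<in> M l" by (rule M_I) (auto simp: form_0_right)
    then show ?thesis using True by (intro bexI[of _ 0] ballI bexI[of _ 0]) auto
  next
    case False
    then obtain g0 where g0: "g0 \<in> M l \<and> g0 \<notin> N" by blast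
    \<comment> \<open>The norm of g must have least valuation, since \<open>norm_approx\<close> with
      \<open>e = h g g\<close> reaches only elements of \<open>F (w e)\<close>.\<close>
    define m where "m t = nat (w (h t t) - l)" for t
    obtain g where g: "g \<in> M l" "g \<notin> N" and min: "\<And>t. t \<in> M l \<and> t \<notin> N \<Longrightarrow> m g \<le> m t"
      using arg_min_nat_lemma[of "\<lambda>t. t \<in> M l \<and> t \<notin> N" g0 m] g0 by blast
    have N0: "h t t \<noteq> 0" if "t \<in> M l" "t \<notin> N" for t
      using that TrF_I[of 0 l] by (auto simp: N_def tr_def)
    have e: "bar (h g g) = h g g" "h g g \<in> F l" "h g g \<noteq> 0"
      using g M_in_L form_self_fixed MM N0 by auto
    have "\<exists>c\<in>F 0. t - scale c g \<in> N" if t: "t \<in> M l" for t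
    proof (cases "t \<in> N")
      case True
      then show ?thesis by (intro bexI[of _ 0]) auto
    next
      case False
      have "l \<le> w (h t t)" "l \<le> w (h g g)"
        using MM[OF t t] N0[OF t False] e by (auto simp: F_def)
      then have "w (h g g) \<le> w (h t t)" using min[of t] t False by (simp add: m_def)
      then have "h t t \<in> F (w (h g g))" by (simp add: F_def)
      moreover have "bar (h t t) = h t t" using t M_in_L form_self_fixed by auto
      ultimately obtain c where c: "c \<in> F 0" "h t t + c * bar c * h g g \<in> TrF l"
        using norm_approx[OF e] by blast
      have "h (t + scale c g) (t + scale c g) = h t t + c * bar c * h g g + tr bar (c * h g t)"
        using t g M_in_L swap[of t g] by (simp add: form_simps V_closed tr_def algebra_simps)
      moreover have "c * h g t \<in> F l" using c MM g t by auto
      ultimately have "h (t + scale c g) (t + scale c g) \<in> TrF l"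
        using c(2) by (simp add: TrF_add TrF_I)
      then have "t - scale (- c) g \<in> N"
        using t g c by (simp add: N_def M_add M_scale)
      then show ?thesis using c by (intro bexI[of _ "- c"]) auto
    qed
    then show ?thesis using g by blast
  qed
  then obtain g where g: "g \<in> M l" "\<And>t. t \<in> M l \<Longrightarrow> \<exists>c\<in>F 0. t - scale c g \<in> N" by blast
  have DfN: "D f x \<in> N" if "x \<in> L" for x
    using Df[OF that] form_D_self[OF f, of x] F_Suc[OF alt[OF that]] that
    by (simp add: N_def TrF_I)
  \<comment> \<open>Since \<open>h x (D f y)\<close> is alternating modulo \<open>P^(l+1)\<close>,
    the two members of such a pair may be exchanged, and x1 may be changed by multiples of
    x2.\<close>
  define good where "good x1 x2 \<longleftrightarrow> x1 \<in> L \<and> x2 \<in> L \<and> has_val l (h x2 (D f x1))" for x1 x2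
  have good_sym: "good x2 x1" if "good x1 x2" for x1 x2
  proof -
    have x: "x1 \<in> L" "x2 \<in> L" "has_val l (h x2 (D f x1))" using that by (auto simp: good_def)
    have "h (x1 + x2) (D f (x1 + x2)) - h x1 (D f x1) - h x2 (D f x2) \<in> F (l + 1)"
      using x by (intro F_diff alt) auto
    then have "h x1 (D f x2) + h x2 (D f x1) \<in> F (l + 1)" using x f
      by (simp add: D_add form_simps V_closed D_V add.commute)
    then have "has_val l (- h x2 (D f x1) + (h x1 (D f x2) + h x2 (D f x1)))"
      using x by (intro has_val_add) auto
    then show ?thesis using x by (simp add: good_def)
  qed
  have good_diff: "good (x1 - scale a x2) x2" if "good x1 x2" "a \<in> F 0" for x1 x2 a
  proof -
    have x: "x1 \<in> L" "x2 \<in> L" "has_val l (h x2 (D f x1))" using that by (auto simp: good_def)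
    have "has_val l (h x2 (D f x1) + - (bar a * h x2 (D f x2)))"
      using x that(2) F_smult[of "bar a" _ "l + 1"] alt by (intro has_val_add) auto
    then show ?thesis using x that f
      by (simp add: good_def D_diff D_scale D_V V_closed form_simps)
  qed
  \<comment> \<open>A coefficient c in P is harmless: \<open>c / \<pi>\<close> is integral, and
    \<open>scale c g\<close> already lies in \<open>M (l + 1)\<close>.\<close>
  have finish: thesis if x: "good x1 x2" and z: "z \<in> L" "D f x1 - scale \<pi> z \<in> M (l + 1)"
    and c: "c \<in> F 1" "scale \<pi> z - scale c g \<in> N" for x1 x2 z c
  proof -
    define z' where "z' = z - scale (c / \<pi>) g"
    have z': "scale \<pi> z' = scale \<pi> z - scale c g"
      by (simp add: z'_def scale_right_diff_distrib)
    have "c / \<pi> \<in> F 0" using F_pi_iff[of c 0] c by simp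
    then have zL: "z' \<in> L" using z M_in_L[OF g(1)] by (simp add: z'_def)
    obtain \<tau> where \<tau>: "h (scale \<pi> z') (scale \<pi> z') = tr bar \<tau>" "\<tau> \<in> F (l + 1)"
      using N_tr c z' by metis
    have eq: "D f x1 - scale \<pi> z' = (D f x1 - scale \<pi> z) + scale c g" by (simp add: z')
    have "D f x1 - scale \<pi> z' \<in> M (l + 1)"
      unfolding eq by (rule M_add[OF z(2) M_scale_pi[OF g(1) c(1)]])
    then show thesis using result[of x1 x2 z' \<tau>] x zL \<tau> N_M c z' by (simp add: good_def)
  qed
  have y21: "good y2 y1" using y M_form[OF Df] by (simp add: good_def has_val_iff)
  show thesis
  proof (cases "\<forall>s\<in>M l. \<forall>t\<in>M l. h s t \<in> F (l + 1)")
    case True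
    \<comment> \<open>Here \<open>splitting\<close> applies to both \<open>D f y1\<close> and
      \<open>D f y2\<close>. If both coefficients along g are units, a combination of the two
      vectors cancels them.\<close>
    have "\<exists>z c. z \<in> L \<and> D f x - scale \<pi> z \<in> M (l + 1) \<and> c \<in> F 0 \<and> scale \<pi> z - scale c g \<in> N"
      if xL: "x \<in> L" for x
    proof -
      obtain z where "z \<in> L" "scale \<pi> z \<in> M l" "D f x - scale \<pi> z \<in> M (l + 1)"
        using splitting[OF Df[OF xL]] True Df[OF xL] by metis
      then show ?thesis using g(2) by blast
    qed
    then obtain z1 c1 z2 c2 where
      z1: "z1 \<in> L" "D f y2 - scale \<pi> z1 \<in> M (l + 1)" "c1 \<in> F 0" "scale \<pi> z1 - scale c1 g \<in> N" and
      z2: "z2 \<in> L" "D f y1 - scale \<pi> z2 \<in> M (l + 1)" "c2 \<in> F 0" "scale \<pi> z2 - scale c2 g \<in> N"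
      using y by meson
    consider "c1 \<in> F 1" | "c2 \<in> F 1" | "has_val 0 c1" "has_val 0 c2"
      using z1 z2 by (auto simp: has_val_iff)
    then show thesis
    proof cases
      case 1
      then show thesis using finish[OF y21 z1(1,2) _ z1(4)] by simp
    next
      case 2
      then show thesis using finish[OF good_sym[OF y21] z2(1,2) _ z2(4)] by simp
    next
      case 3
      define a where "a = c1 / c2"
      have a: "a \<in> F 0" unfolding a_def by (rule F_divide[OF z1(3) 3(2)]) simp
      show thesis
      proof (rule finish[OF good_diff[OF y21 a]])
        show "z1 - scale a z2 \<in> L" using z1 z2 a by simp
        have "D f (y2 - scale a y1) - scale \<pi> (z1 - scale a z2) =
            (D f y2 - scale \<pi> z1) - scale a (D f y1 - scale \<pi> z2)"
          using y f by (simp add: D_diff D_scale V_closed scale_right_diff_distrib algebra_simps)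
        then show "D f (y2 - scale a y1) - scale \<pi> (z1 - scale a z2) \<in> M (l + 1)"
          using z1 z2 a by (simp add: M_diff M_scale)
        have "scale \<pi> (z1 - scale a z2) =
            (scale \<pi> z1 - scale c1 g) - scale a (scale \<pi> z2 - scale c2 g)"
          using 3 by (simp add: a_def has_val_def scale_right_diff_distrib mult.commute)
        then show "scale \<pi> (z1 - scale a z2) - scale 0 g \<in> N"
          using z1 z2 a by (simp add: N_diff)
      qed auto
    qed
  next
    case False
    \<comment> \<open>\<open>D f x1\<close> is orthogonal to N modulo \<open>P^(l+1)\<close>; being
      orthogonal to g as well makes it orthogonal to \<open>M l\<close>, as \<open>splitting\<close>
      requires.\<close>
    have "\<exists>x1 x2. good x1 x2 \<and> h (D f x1) g \<in> F (l + 1)"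
    proof -
      have F: "h (D f x) g \<in> F l" if "x \<in> L" for x using MM Df[OF that] g by simp
      consider "h (D f y2) g \<in> F (l + 1)" | "h (D f y1) g \<in> F (l + 1)" |
        "has_val l (h (D f y1) g)" using F y by (auto simp: has_val_iff)
      then show ?thesis
      proof cases
        case 3
        define a where "a = h (D f y2) g / h (D f y1) g"
        have a: "a \<in> F 0" unfolding a_def by (rule F_divide[OF F[OF y(2)] 3]) simp
        have "h (D f (y2 - scale a y1)) g = 0"
          using y f M_in_L[OF g(1)] has_val_neq_0[OF 3]
          by (simp add: D_diff D_scale D_V V_closed form_simps a_def)
        then show ?thesis using good_diff[OF y21 a] by (intro exI) auto
      qed (use y21 good_sym in blast)+
    qed
    then obtain x1 x2 where x: "good x1 x2" "h (D f x1) g \<in> F (l + 1)" by blast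
    have x1: "x1 \<in> L" using x by (simp add: good_def)
    have orth: "h t s \<in> F (l + 1)" if "t \<in> M l" "s \<in> M l" "h t g \<in> F (l + 1)"
      "\<And>u. u \<in> N \<Longrightarrow> h t u \<in> F (l + 1)" for t s
    proof -
      obtain c where c: "c \<in> F 0" "s - scale c g \<in> N" using g(2) \<open>s \<in> M l\<close> by blast
      have "h t s = h t (s - scale c g) + bar c * h t g"
        using that g M_in_L by (simp add: form_simps V_closed)
      then show ?thesis using that c F_smult[of "bar c"] by auto
    qed
    obtain z where z: "z \<in> L" "scale \<pi> z \<in> M l" "D f x1 - scale \<pi> z \<in> M (l + 1)"
      by (rule splitting[OF Df[OF x1]])
        (use orth[OF Df[OF x1]] x(2) N_orth[OF DfN[OF x1]] in auto)
    obtain c where c: "c \<in> F 0" "scale \<pi> z - scale c g \<in> N" using g(2) z by blast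
    \<comment> \<open>Were c a unit, g would be a combination of r, which is orthogonal to
      \<open>M l\<close> modulo \<open>P^(l+1)\<close>, and of n in N. Then n, hence g, hence all of
      \<open>M l\<close> would be orthogonal to \<open>M l\<close>, against the case
      assumption.\<close>
    have "c \<in> F 1"
    proof (rule ccontr)
      assume "c \<notin> F 1"
      then have exc: "has_val 0 c" using c by (simp add: has_val_iff)
      define r where "r = scale \<pi> z"
      define n where "n = r - scale c g"
      have n: "n \<in> N" using c by (simp add: n_def r_def)
      have r: "r \<in> M l" "h r s \<in> F (l + 1)" if "s \<in> M l" for s
      proof -
        show "r \<in> M l" using z by (simp add: r_def)
        have "h r s = \<pi> * h z s" using z that M_in_L by (simp add: r_def form_simps)
        then show "h r s \<in> F (l + 1)"
          using F_mult[OF F_pi M_form[OF that z(1)], of "l + 1"] by simp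
      qed
      have gs: "h g s \<in> F (l + 1)" if s: "s \<in> M l" "h n s \<in> F (l + 1)" for s
      proof -
        have "g = scale (inverse c) (r - n)" using has_val_neq_0[OF exc] by (simp add: n_def)
        then have "h g s = inverse c * (h r s - h n s)"
          using s n N_M r M_in_L by (simp add: form_simps V_closed)
        moreover have "inverse c \<in> F 0" by (rule has_val_F[OF has_val_inverse[OF exc]]) simp
        ultimately show ?thesis using r(2)[OF s(1)] s(2) by auto
      qed
      have nM: "h n s \<in> F (l + 1)" if "s \<in> M l" for s
      proof (rule orth[OF N_M[OF n] that])
        have "h g n \<in> F (l + 1)" using gs[OF N_M[OF n]] N_orth[OF n n] by simp
        then show "h n g \<in> F (l + 1)" using swap[OF N_M[OF n] g(1)] by simp
      qed (use N_orth[OF n] in auto)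
      have gM: "h s g \<in> F (l + 1)" if "s \<in> M l" for s
        using gs[OF that nM[OF that]] swap[OF that g(1)] by simp
      have "h s t \<in> F (l + 1)" if s: "s \<in> M l" and t: "t \<in> M l" for s t
      proof (rule orth[OF s t gM[OF s]])
        fix u assume u: "u \<in> N"
        have "h u s \<in> F (l + 1)"
          by (rule orth[OF N_M[OF u] s gM[OF N_M[OF u]] N_orth[OF u]])
        then show "h s u \<in> F (l + 1)" using swap[OF s N_M[OF u]] by simp
      qed
      then show False using False by blast
    qed
    then show thesis using finish[OF x(1) z(1,3)] c by blast
  qed
qed

section \<open>Descent on the dimension of the image of \<open>D f\<close>\<close>

lemma reduce_L:
  assumes f: "f \<in> U L" and x0: "x0 \<in> L" "D f x0 \<noteq> 0"
  obtains g where "g \<in> U L" "g \<in> G L \<Longrightarrow> f \<in> G L" "\<And>n. rank_le (Suc n) f \<Longrightarrow> rank_le n g"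
proof -
  obtain n where n: "\<And>x y. x \<in> L \<Longrightarrow> y \<in> L \<Longrightarrow> h x y \<in> F n" using L_bounded by blast
  obtain y0 where y0: "y0 \<in> L" "h (D f x0) y0 \<noteq> 0"
    using nondegenerate_L x0 D_L[OF f x0(1)] unfolding nondegenerate_def by blast
  define Q where "Q p \<longleftrightarrow> fst p \<in> L \<and> snd p \<in> L \<and> h (fst p) (D f (snd p)) \<noteq> 0" for p
  define m where "m p = nat (w (h (fst p) (D f (snd p))) - n)" for p
  have "h y0 (D f x0) \<noteq> 0"
    using y0 form_hermitian[of y0 "D f x0"] x0 f by auto
  then have "Q (y0, x0)" using y0 x0 by (simp add: Q_def)
  then obtain p where p: "Q p" "\<And>q. Q q \<Longrightarrow> m p \<le> m q"
    using arg_min_nat_lemma[of Q "(y0, x0)" m] by blast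
  obtain y1 y2 where yp: "p = (y1, y2)" by fastforce
  define l where "l = w (h y1 (D f y2))"
  have y: "y1 \<in> L" "y2 \<in> L" "h y1 (D f y2) \<noteq> 0" using p yp by (auto simp: Q_def)
  then have exy: "has_val l (h y1 (D f y2))" by (simp add: has_val_def l_def)
  have ynF: "h y1 (D f y2) \<notin> F (l + 1)" using exy by (simp add: has_val_iff)
  have "h x (D f v) \<in> F l" if "x \<in> L" "v \<in> L" for x v
  proof (cases "h x (D f v) = 0")
    case False
    have "n \<le> w (h x (D f v))" "n \<le> w (h y1 (D f y2))"
      using n[of x "D f v"] n[of y1 "D f y2"] that y f False by (auto simp: F_def)
    then show ?thesis
      using p(2)[of "(x, v)"] that False by (auto simp: Q_def m_def yp l_def F_def)
  qed simp
  then have Df: "D f v \<in> M l" if "v \<in> L" for v using that f by (simp add: M_def)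
  show thesis
  proof (cases "\<forall>x\<in>L. h x (D f x) \<in> F (l + 1)")
    case False
    then obtain x where "x \<in> L" "has_val l (h x (D f x))" using M_form[OF Df] by (auto simp: has_val_iff)
    then show thesis using good_step_M[OF f _ Df] that by metis
  next
    case alt: True
    show thesis
    proof (cases "\<exists>t \<tau>. t \<in> M l \<and> has_val l \<tau> \<and> h t t = tr bar \<tau>")
      case True
      then obtain t \<tau> where t: "t \<in> M l" "has_val l \<tau>" "h t t = tr bar \<tau>" by blast
      show thesis
      proof (cases "\<exists>u\<in>L. h u t \<notin> F (l + 1)")
        case True
        then show thesis using case_regular[OF f Df _ y(1,2) ynF t] alt that by metis
      next
        case False
        \<comment> \<open>If t is orthogonal to L modulo \<open>P^(l+1)\<close>, then
          \<open>case_regular\<close> cannot use it. Adding \<open>D f y2\<close> repairs this, and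
          the extra terms of the parameter lie in \<open>F (l + 1)\<close>.\<close>
        define s where "s = D f y2"
        define \<tau>' where "\<tau>' = \<tau> + (h t s + h y2 s)"
        have s: "s \<in> M l" "s \<in> L" "t \<in> L" using Df y t M_L by (auto simp: s_def)
        have ts: "h t s = bar (h s t)" by (rule form_hermitian) (use s in auto)
        have "h t s \<in> F (l + 1)" using False s(2) by (simp add: ts)
        moreover have "h y2 s \<in> F (l + 1)" using alt y by (simp add: s_def)
        ultimately have "has_val l \<tau>'" unfolding \<tau>'_def using t(2) by (intro has_val_add F_add)
        moreover have "h (t + s) (t + s) = tr bar \<tau>'"
          using s t y form_D_self[OF f, of y2] ts
          by (simp add: form_simps V_closed \<tau>'_def tr_add flip: s_def) (simp add: tr_def)
        moreover have "h y1 (t + s) \<notin> F (l + 1)"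
        proof
          assume "h y1 (t + s) \<in> F (l + 1)"
          moreover have "h y1 (t + s) = h y1 t + h y1 s" using y s by (simp add: form_simps)
          ultimately have "h y1 s \<in> F (l + 1)"
            using False y(1) F_diff[of "h y1 t + h y1 s" "l + 1" "h y1 t"] by simp
          then show False using ynF by (simp add: s_def)
        qed
        ultimately show thesis
          using case_regular[OF f Df _ y(1,2) ynF M_add[OF t(1) s(1)]] alt y(1) that by metis
      qed
    next
      case False
      \<comment> \<open>The zero vector together with an element of trace zero and valuation l would
        be a regular datum. So there is no such element, and by parity there is one of valuation l +
        1.\<close>
      have M0: "0 \<in> M l" by (rule M_I) (auto simp: form_0_right)
      have "\<nexists>\<theta>. tr bar \<theta> = 0 \<and> has_val l \<theta>"
        using False M0 form_0_left[OF V_0] by metis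
      then obtain \<theta> where \<theta>: "tr bar \<theta> = 0" "has_val (l + 1) \<theta>" using trace_zero' by blast
      obtain x1 x2 z \<tau>0 where x: "x1 \<in> L" "x2 \<in> L" "has_val l (h x2 (D f x1))"
        "z \<in> L" "scale \<pi> z \<in> M l" "D f x1 - scale \<pi> z \<in> M (l + 1)"
        "h (scale \<pi> z) (scale \<pi> z) = tr bar \<tau>0" "\<tau>0 \<in> F (l + 1)"
        using irregular_data[OF f Df _ y(1,2) ynF False] alt by metis
      show thesis using case_irregular[OF f Df _ x \<theta>] alt that by metis
    qed
  qed
qed

text \<open>L need not span V. Once f is the identity on L, every \<open>D f x\<close> is orthogonal
  to L, so its symmetry fixes L pointwise and integrality imposes nothing.\<close>

lemma reduce_V:
  assumes f: "f \<in> U L" and fL: "\<And>x. x \<in> L \<Longrightarrow> D f x = 0" and v0: "v0 \<in> V" "D f v0 \<noteq> 0"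
  obtains g where "g \<in> U L" "g \<in> G L \<Longrightarrow> f \<in> G L" "\<And>n. rank_le (Suc n) f \<Longrightarrow> rank_le n g"
proof (cases "\<exists>x\<in>V. h x (D f x) \<noteq> 0")
  case True
  then obtain x where x: "x \<in> V" "h x (D f x) \<noteq> 0" by blast
  have "Sy (D f x) (h x (D f x)) \<in> U L"
  proof (rule Sy_U_L)
    fix v assume v: "v \<in> L"
    have "h v (D f x) = 0"
      using v f x U_form[OF f, of v x] fL[OF v] by (simp add: D_def form_simps U_V)
    then show "scale (h v (D f x) / h x (D f x)) (D f x) \<in> L" by simp
  qed (use x f form_D_self D_V in auto)
  then show thesis using good_step[OF f L_subset x] that by metis
next
  case False
  have "h x (D f y) = 0" if "x \<in> V" "y \<in> V" for x y
  proof -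
    have add: "h u (D f v) + h v (D f u) = 0" if "u \<in> V" "v \<in> V" for u v
    proof -
      have "h (u + v) (D f (u + v)) = 0" "h u (D f u) = 0" "h v (D f v) = 0"
        using False that by (auto simp: V_closed)
      then show ?thesis using that f by (simp add: D_add form_simps V_closed D_V add.commute)
    qed
    have 1: "h y (D f x) = - h x (D f y)" using add[OF that] by (simp add: add_eq_0_iff)
    \<comment> \<open>An alternating sesquilinear form over the field vanishes: scaling one argument
      by \<pi> leaves the nonzero factor \<open>\<pi> - bar \<pi>\<close>. Only reductions of it can
      be alternating and nonzero.\<close>
    have "\<pi> * h x (D f y) + bar \<pi> * h y (D f x) = 0"
      using add[of "scale \<pi> x" y] that f by (simp add: D_scale form_simps V_closed D_V)
    then have "\<delta> * h x (D f y) = 0"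
      unfolding 1 by (simp add: \<delta>_def algebra_simps)
    then show ?thesis by simp
  qed
  then have "h (D f v0) x = 0" if "x \<in> V" for x
    using form_hermitian[of "D f v0" x] that v0 f by (simp add: D_V)
  then have "D f v0 = 0" using nondegenerate_V v0 f D_V by (auto simp: nondegenerate_def)
  then show thesis using v0 by simp
qed

lemma U_imp_G: "f \<in> U L \<Longrightarrow> rank_le n f \<Longrightarrow> f \<in> G L"
proof (induction n arbitrary: f)
  case 0
  then show ?case by (rule rank_0_G)
next
  case (Suc n)
  show ?case
  proof (cases "\<forall>v\<in>V. D f v = 0")
    case True
    then have "rank_le 0 f" unfolding rank_le_def by (intro exI[of _ "{}"]) auto
    then show ?thesis using rank_0_G Suc by blast
  next
    case False
    then obtain v where v: "v \<in> V" "D f v \<noteq> 0" by blast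
    have "\<exists>g\<in>U L. (g \<in> G L \<longrightarrow> f \<in> G L) \<and> rank_le n g"
    proof (cases "\<exists>x\<in>L. D f x \<noteq> 0")
      case True
      then show ?thesis using reduce_L[OF Suc.prems(1)] Suc.prems(2) by metis
    next
      case False
      then show ?thesis using reduce_V[OF Suc.prems(1) _ v] Suc.prems(2) by metis
    qed
    then show ?thesis using Suc.IH by blast
  qed
qed

theorem U_eq_G: "U L = G L"
  using U_imp_G rank_exists G_subset_U[OF L_subset] by blast

end

section \<open>The residue field with two elements\<close>

context ramified_involution
begin

declare One_nat_def [simp del]

definition V4 :: "(nat \<Rightarrow> 'e) set" where
  "V4 = {x. \<forall>i\<ge>4. x i = 0}"

text \<open>On the diagonal this is the trace of \<alpha> times
  \<open>x 0 * bar (x 1) + x 2 * bar (x 3)\<close>, which reduces to the quadratic form by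
  \<open>tr_alpha_mult\<close>.\<close>

definition h4 :: "(nat \<Rightarrow> 'e) \<Rightarrow> (nat \<Rightarrow> 'e) \<Rightarrow> 'e" where
  "h4 x y = \<alpha> * x 0 * bar (y 1) + bar \<alpha> * x 1 * bar (y 0) +
    \<alpha> * x 2 * bar (y 3) + bar \<alpha> * x 3 * bar (y 2)"

definition L4 :: "(nat \<Rightarrow> 'e) set" where
  "L4 = {x \<in> V4. \<forall>i. x i \<in> F 0}"

definition unit_vec :: "nat \<Rightarrow> nat \<Rightarrow> 'e" where
  "unit_vec j i = (if i = j then 1 else 0)"

abbreviation B4 :: "(nat \<Rightarrow> 'e) set" where
  "B4 \<equiv> unit_vec ` {..<4}"

lemma less_4: "i < (4::nat) \<longleftrightarrow> i = 0 \<or> i = 1 \<or> i = 2 \<or> i = 3"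
  by auto

lemma V4_expand:
  assumes "x \<in> V4"
  shows "x = seq_scale (x 0) (unit_vec 0) + seq_scale (x 1) (unit_vec 1) +
    seq_scale (x 2) (unit_vec 2) + seq_scale (x 3) (unit_vec 3)"
proof
  fix i show "x i = (seq_scale (x 0) (unit_vec 0) + seq_scale (x 1) (unit_vec 1) +
    seq_scale (x 2) (unit_vec 2) + seq_scale (x 3) (unit_vec 3)) i"
  proof (cases "i < 4")
    case True
    then show ?thesis by (auto simp: less_4 seq_scale_def unit_vec_def)
  qed (use assms in \<open>auto simp: V4_def seq_scale_def unit_vec_def\<close>)
qed

lemma hermitian_space_V4: "hermitian_space seq_scale bar V4 h4"
proof -
  interpret vector_space "seq_scale :: 'e \<Rightarrow> _" by (rule vector_space_seq_scale)
  have sub: "subspace V4"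
    by (auto simp: subspace_def V4_def seq_scale_def)
  have "span B4 = V4"
  proof
    show "span B4 \<subseteq> V4"
      by (rule span_minimal[OF _ sub]) (auto simp: V4_def unit_vec_def)
    show "V4 \<subseteq> span B4"
    proof
      fix x assume "x \<in> V4"
      from V4_expand[OF this] show "x \<in> span B4"
        by (rule ssubst) (intro span_add span_scale span_base, auto)
    qed
  qed
  then have "\<exists>B. finite B \<and> span B = V4" by (intro exI[of _ B4]) auto
  with sub show ?thesis
    by unfold_locales (auto simp: h4_def seq_scale_def algebra_simps)
qed

interpretation Q: integral_hermitian_space w bar \<pi> seq_scale V4 h4
  using hermitian_space_V4 ramified_involution_axioms by (rule integral_hermitian_space.intro[rotated])

lemma unit_vec_L4: "j < 4 \<Longrightarrow> unit_vec j \<in> L4"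
  by (auto simp: L4_def V4_def unit_vec_def)

lemma lattice_L4: "lattice_in seq_scale (F 0) V4 L4"
proof -
  have "Q.ospan B4 = L4"
  proof (intro equalityI subsetI)
    fix x assume "x \<in> Q.ospan B4"
    then show "x \<in> L4"
    proof (induction rule: Q.ospan_induct)
      case (step a s y)
      then show ?case by (auto simp: L4_def V4_def unit_vec_def seq_scale_def)
    qed (simp add: L4_def V4_def)
  next
    fix x assume x: "x \<in> L4"
    then have xV: "x \<in> V4" by (simp add: L4_def)
    show "x \<in> Q.ospan B4"
      by (rule ssubst[OF V4_expand[OF xV]], intro Q.ospan_add Q.ospan_scale Q.ospan_base)
        (use x in \<open>auto simp: L4_def\<close>)
  qed
  then show ?thesis unfolding lattice_in_def
    by (intro exI[of _ B4]) (auto simp: V4_def unit_vec_def)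
qed

lemma nondegenerate_h4:
  assumes "W \<subseteq> V4" "L4 \<subseteq> W"
  shows "nondegenerate h4 W"
  unfolding nondegenerate_def
proof (intro ballI impI)
  fix x assume x: "x \<in> W" "\<forall>y\<in>W. h4 x y = 0"
  have "h4 x (unit_vec j) = 0" if "j < 4" for j
    using x(2) unit_vec_L4[OF that] assms(2) by auto
  then have "h4 x (unit_vec 0) = 0" "h4 x (unit_vec 1) = 0" "h4 x (unit_vec 2) = 0" "h4 x (unit_vec 3) = 0"
    by simp_all
  then have "x 0 = 0" "x 1 = 0" "x 2 = 0" "x 3 = 0"
    by (auto simp: h4_def unit_vec_def)
  moreover have "x \<in> V4" using x assms by auto
  ultimately show "x = 0" using V4_expand[of x] by (simp add: seq_scale_def fun_eq_iff)
qed

definition swap4 :: "(nat \<Rightarrow> 'e) \<Rightarrow> nat \<Rightarrow> 'e" where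
  "swap4 = (\<lambda>x\<in>V4. \<lambda>i. if i < 2 then x (i + 2) else if i < 4 then x (i - 2) else 0)"

lemma swap4_apply:
  "x \<in> V4 \<Longrightarrow> swap4 x 0 = x 2" "x \<in> V4 \<Longrightarrow> swap4 x 1 = x 3"
  "x \<in> V4 \<Longrightarrow> swap4 x 2 = x 0" "x \<in> V4 \<Longrightarrow> swap4 x 3 = x 1"
  "x \<in> V4 \<Longrightarrow> i \<ge> 4 \<Longrightarrow> swap4 x i = 0"
  by (simp_all add: swap4_def) (simp_all only: numeral_2_eq_2 One_nat_def)

lemma V4_eqI:
  assumes "x \<in> V4" "y \<in> V4" "x 0 = y 0" "x 1 = y 1" "x 2 = y 2" "x 3 = y 3"
  shows "x = y"
  using V4_expand[OF assms(1)] V4_expand[OF assms(2)] assms(3-6) by simp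

lemma swap4_V4: "x \<in> V4 \<Longrightarrow> swap4 x \<in> V4"
  by (simp add: V4_def swap4_apply)

lemma swap4_L4: "x \<in> L4 \<Longrightarrow> swap4 x \<in> L4"
  by (auto simp: L4_def swap4_V4) (simp add: swap4_def)

lemma swap4_swap4: "x \<in> V4 \<Longrightarrow> swap4 (swap4 x) = x"
  by (rule V4_eqI) (auto simp: swap4_V4 swap4_apply)

lemma swap4_U: "swap4 \<in> Q.U L4"
  unfolding Q.U_iff
proof (intro conjI ballI allI)
  show "swap4 \<in> extensional V4" by (simp add: swap4_def)
  show "bij_betw swap4 V4 V4"
    by (rule bij_betwI[where g = swap4]) (auto simp: swap4_V4 swap4_swap4)
  have "L4 \<subseteq> V4" by (auto simp: L4_def)
  then show "swap4 ` L4 = L4" using swap4_L4 swap4_swap4 by force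
  fix x y assume x: "x \<in> V4" "y \<in> V4"
  then show "swap4 (x + y) = swap4 x + swap4 y"
    using Q.V_add[OF x] by (auto simp: swap4_def)
  show "h4 (swap4 x) (swap4 y) = h4 x y"
    using x by (simp add: h4_def swap4_apply)
next
  fix a x assume x: "x \<in> V4"
  then show "swap4 (seq_scale a x) = seq_scale a (swap4 x)"
    using Q.V_scale[OF x] by (auto simp: swap4_def seq_scale_def)
qed

text \<open>Residues as truth values: sums become exclusive disjunctions and products conjunctions,
  so that identities over the field with two elements are decided propositionally.\<close>

definition res_bit :: "'e \<Rightarrow> bool" where "res_bit x \<longleftrightarrow> x \<notin> F 1"

text \<open>One of the two anisotropic planes spanned by the six vectors \<open>s\<close> with \<open>s\<^sub>0s\<^sub>1 + s\<^sub>2s\<^sub>3 = 1\<close> over the field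
  with two elements: the other three vectors are orthogonal to it.\<close>

definition plane :: "(nat \<Rightarrow> 'e) set" where
  "plane = {x \<in> L4. res_bit (x 2) = res_bit (x 3) \<and> res_bit (x 2) = (res_bit (x 0) \<noteq> res_bit (x 1))}"

context
  assumes residue_2: "\<And>x. x \<in> F 0 \<Longrightarrow> x \<in> F 1 \<or> x - 1 \<in> F 1"
begin

lemma res_bit_R: "gr_eq 0 x y \<Longrightarrow> res_bit x = res_bit y"
  using gr_eq_ex[of 0 x y] by (auto simp: gr_eq_def has_val_iff res_bit_def)

lemma res_bit_1: "res_bit 1"
  by (simp add: res_bit_def F_def)

lemma res_bit_R_1: "x \<in> F 0 \<Longrightarrow> res_bit x \<Longrightarrow> gr_eq 0 x 1"
  using residue_2[of x] by (auto simp: res_bit_def gr_eq_def)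

lemma res_bit_R_0: "\<not> res_bit x \<Longrightarrow> gr_eq 0 x 0"
  by (simp add: res_bit_def gr_eq_0_iff)

lemma res_bit_mult: "x \<in> F 0 \<Longrightarrow> y \<in> F 0 \<Longrightarrow> res_bit (x * y) \<longleftrightarrow> res_bit x \<and> res_bit y"
  by (auto simp: res_bit_def has_val_iff[of 0, simplified] intro: F_mult[of x 1 y 0] F_mult[of x 0 y 1])
    (metis add.right_neutral add_0 has_val_iff has_val_mult)

lemma res_bit_add: "x \<in> F 0 \<Longrightarrow> y \<in> F 0 \<Longrightarrow> res_bit (x + y) \<longleftrightarrow> res_bit x \<noteq> res_bit y"
proof -
  assume x: "x \<in> F 0" "y \<in> F 0"
  consider "\<not> res_bit x" | "\<not> res_bit y" | "res_bit x" "res_bit y" by blast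
  then show ?thesis
  proof cases
    case 1
    then have "gr_eq 0 (x + y) (0 + y)" using x by (intro gr_eq_add res_bit_R_0 gr_eq_refl)
    then show ?thesis using 1 res_bit_R by auto
  next
    case 2
    then have "gr_eq 0 (x + y) (x + 0)" using x by (intro gr_eq_add res_bit_R_0 gr_eq_refl)
    then show ?thesis using 2 res_bit_R by auto
  next
    case 3
    then have "gr_eq 0 (x + y) (1 + 1)" using x by (intro gr_eq_add res_bit_R_1)
    moreover have "\<not> res_bit (1 + 1)" using F_2 by (simp add: res_bit_def)
    ultimately show ?thesis using 3 res_bit_R by auto
  qed
qed

lemma res_bit_diff: "x \<in> F 0 \<Longrightarrow> y \<in> F 0 \<Longrightarrow> res_bit (x - y) \<longleftrightarrow> res_bit x \<noteq> res_bit y"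
  using res_bit_add[of x "- y"] by (simp add: res_bit_def)

text \<open>For nonzero t, scaled to a primitive vector s, integrality bounds the valuation of the
  parameter by \<open>w \<alpha>\<close>. Below this bound the symmetry reduces to the identity. At
  the bound it reduces to the reflection in a vector where the quadratic form is 1; such a vector
  lies in the plane or is orthogonal to it.\<close>

lemma Sy_plane:
  assumes t: "t \<in> V4" "\<tau> \<noteq> 0" "h4 t t = tr bar \<tau>" and U: "Q.Sy t \<tau> \<in> Q.U L4"
    and x: "x \<in> plane"
  shows "Q.Sy t \<tau> x \<in> plane"
proof (cases "t = 0")
  case True
  then show ?thesis using x by (auto simp: Q.Sy_apply plane_def L4_def)
next
  case False
  then obtain j0 where j0: "t j0 \<noteq> 0" by (auto simp: fun_eq_iff)
  then have j04: "j0 < 4" using t(1) by (auto simp: V4_def not_le[symmetric])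
  define wm where "wm = Min ((\<lambda>i. w (t i)) ` {i. i < 4 \<and> t i \<noteq> 0})"
  have fin: "finite ((\<lambda>i. w (t i)) ` {i. i < 4 \<and> t i \<noteq> 0})" by simp
  have "wm \<in> (\<lambda>i. w (t i)) ` {i. i < 4 \<and> t i \<noteq> 0}"
    unfolding wm_def using j0 j04 by (intro Min_in) auto
  then obtain j where j: "j < 4" "t j \<noteq> 0" "wm = w (t j)" by auto
  have min: "w (t j) \<le> w (t i)" if "i < 4" "t i \<noteq> 0" for i
    using Min_le[OF fin, of "w (t i)"] that j(3) by (auto simp flip: wm_def)
  define c where "c = t j"
  have c: "c \<noteq> 0" using j by (simp add: c_def)
  define s where "s i = t i / c" for i
  define \<sigma> where "\<sigma> = \<tau> / (c * bar c)"
  have sj: "s j = 1" using c by (simp add: s_def flip: c_def)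
  have sF: "s i \<in> F 0" for i
  proof (cases "t i = 0")
    case False
    then have "i < 4" using t(1) by (auto simp: V4_def not_le[symmetric])
    then show ?thesis using min[OF _ False] False c by (simp add: s_def F_def val_divide c_def)
  qed (simp add: s_def)
  have tc: "t i = c * s i" for i using c by (simp add: s_def)
  have \<sigma>: "\<sigma> \<noteq> 0" "\<tau> = \<sigma> * (c * bar c)" using t(2) c by (auto simp: \<sigma>_def)
  have ht: "h4 y t = bar c * h4 y s" for y
    by (simp add: h4_def tc algebra_simps)
  have hss: "h4 s s = tr bar \<sigma>"
  proof -
    have "h4 t t = c * bar c * h4 s s" by (simp add: h4_def tc algebra_simps)
    moreover have "tr bar \<tau> = c * bar c * tr bar \<sigma>"
      unfolding \<sigma>(2) by (simp add: tr_def algebra_simps)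
    ultimately show ?thesis using t(3) c by simp
  qed
  define k where "k y = h4 y s / \<sigma>" for y
  have Sy: "Q.Sy t \<tau> y i = y i - k y * s i" if "y \<in> V4" for y i
  proof -
    have "Q.Sy t \<tau> y i = y i - (bar c * h4 y s) / (\<sigma> * (c * bar c)) * (c * s i)"
      using that by (simp add: Q.Sy_apply seq_scale_def ht \<sigma>(2) tc)
    also have "(bar c * h4 y s) / (\<sigma> * (c * bar c)) * (c * s i) = k y * s i"
      using c by (simp add: k_def)
    finally show ?thesis .
  qed
  have SyL: "Q.Sy t \<tau> y \<in> L4" if "y \<in> L4" for y using Q.U_L[OF U that] .
  \<comment> \<open>The index paired with j in \<open>h4\<close>. The j-th coordinate of the image
    of this basis vector must be integral, which bounds \<sigma>.\<close>
  define p where "p = (if j = 0 then 1 else if j = 1 then 0 else if j = 2 then 3 else (2::nat))"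
  have p: "p < 4" "p \<noteq> j" using j by (auto simp: p_def)
  have kp: "k (unit_vec p) = \<alpha> / \<sigma> \<or> k (unit_vec p) = bar \<alpha> / \<sigma>"
    using j(1) sj by (auto simp: less_4 p_def k_def h4_def unit_vec_def)
  have "unit_vec p \<in> V4" using unit_vec_L4[OF p(1)] by (simp add: L4_def)
  then have "Q.Sy t \<tau> (unit_vec p) j = - k (unit_vec p)"
    using Sy[of "unit_vec p" j] p sj by (simp add: unit_vec_def)
  moreover have "Q.Sy t \<tau> (unit_vec p) j \<in> F 0"
    using SyL[OF unit_vec_L4[OF p(1)]] by (simp add: L4_def)
  ultimately have "- k (unit_vec p) \<in> F 0" by simp
  then have "\<alpha> / \<sigma> \<in> F 0 \<or> bar \<alpha> / \<sigma> \<in> F 0" using kp by (metis F_uminus_iff)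
  then have w\<sigma>: "w \<sigma> \<le> w \<alpha>" using \<sigma>(1) by (auto simp: F_def val_divide)
  have xL: "x \<in> L4" "x \<in> V4" using x by (auto simp: plane_def L4_def)
  have xF: "x i \<in> F 0" for i using xL by (simp add: L4_def)
  define y where "y = Q.Sy t \<tau> x"
  have y: "y \<in> L4" "y i = x i - k x * s i" for i using SyL xL Sy by (auto simp: y_def)
  have \<alpha>F: "\<alpha> \<in> F (w \<alpha>)" "bar \<alpha> \<in> F (w \<alpha>)" by (auto simp: F_def)
  have hF: "h4 x s \<in> F (w \<alpha>)"
    unfolding h4_def using xF sF by (intro F_add F_mult[OF F_mult[OF \<alpha>F(1)] ] F_mult[OF F_mult[OF \<alpha>F(2)]])
      (auto intro: order_refl)
  have kF: "k x \<in> F (w \<alpha> - w \<sigma>)"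
    unfolding k_def by (rule F_divide[OF hF, of "w \<sigma>"]) (auto simp: has_val_def \<sigma>)
  have kF0: "k x \<in> F 0" using kF w\<sigma> by (auto intro: F_mono)
  have bity: "res_bit (y i) = (res_bit (x i) \<noteq> (res_bit (k x) \<and> res_bit (s i)))" for i
    unfolding y(2) using res_bit_diff[of "x i" "k x * s i"] res_bit_mult[of "k x" "s i"] xF sF kF0 by auto
  show ?thesis
  proof (cases "w \<sigma> < w \<alpha>")
    case True
    then have "\<not> res_bit (k x)" using kF by (auto simp: res_bit_def intro: F_mono)
    then show ?thesis using x y(1) bity unfolding plane_def y_def[symmetric] by auto
  next
    case False
    define u where "u = \<sigma> / \<alpha>"
    have u: "has_val 0 u" "\<sigma> = \<alpha> * u" using False w\<sigma> \<sigma> by (auto simp: u_def has_val_def val_divide)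
    define n where "n = s 0 * bar (s 1) + s 2 * bar (s 3)"
    have nF: "n \<in> F 0" unfolding n_def by (intro F_add F_smult) (simp_all add: sF)
    \<comment> \<open>Multiplied by \<alpha>, the elements u and n have the same trace, so they
      agree modulo P. As u is a unit, the quadratic form takes the value 1 at s.\<close>
    have "h4 s s = tr bar (\<alpha> * n)" by (simp add: h4_def n_def tr_def algebra_simps)
    then have "tr bar (\<alpha> * u) = tr bar (\<alpha> * n)" using hss u by simp
    then have "(tr bar (\<alpha> * n) - n) - (tr bar (\<alpha> * u) - u) = u - n" by simp
    moreover have "(tr bar (\<alpha> * n) - n) - (tr bar (\<alpha> * u) - u) \<in> F 1"
      using nF u by (intro F_diff tr_alpha_mult) (auto simp: has_val_F)
    ultimately have "gr_eq 0 u n" using nF has_val_F[OF u(1)] by (simp add: gr_eq_def)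
    moreover have bu: "res_bit u" using u by (simp add: has_val_iff res_bit_def)
    ultimately have bn: "res_bit n" using res_bit_R by blast
    have bbar: "res_bit (bar a) = res_bit a" for a by (simp add: res_bit_def)
    have q: "(res_bit (s 0) \<and> res_bit (s 1)) \<noteq> (res_bit (s 2) \<and> res_bit (s 3))"
      using bn sF by (simp add: n_def res_bit_add res_bit_mult bbar F_smult)
    define r where "r = bar \<alpha> / \<alpha>"
    have "r = 1 + (r - 1)" by simp
    have rF: "r - 1 \<in> F 1" using bar_alpha_cong by (simp add: r_def)
    then have rF0: "r \<in> F 0" using F_add[of "r - 1" 0 1] F_mono[of "r - 1" 1 0] by simp
    then have br: "res_bit r" using res_bit_R[of r 1] res_bit_1 rF by (simp add: gr_eq_def)
    have "k x * u = x 0 * bar (s 1) + r * x 1 * bar (s 0) + x 2 * bar (s 3) + r * x 3 * bar (s 2)"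
      using u has_val_neq_0[OF u(1)] by (simp add: k_def h4_def r_def field_simps)
    moreover have "res_bit (k x * u) = res_bit (k x)" using res_bit_mult[OF kF0 has_val_F[OF u(1)]] bu by simp
    ultimately have "res_bit (k x) = ((((res_bit (x 0) \<and> res_bit (s 1)) \<noteq> (res_bit (x 1) \<and> res_bit (s 0))) \<noteq>
        (res_bit (x 2) \<and> res_bit (s 3))) \<noteq> (res_bit (x 3) \<and> res_bit (s 2)))"
      using xF sF rF0 br by (simp add: res_bit_add res_bit_mult bbar F_smult F_add)
    then show ?thesis
      using x y(1) bity q unfolding plane_def y_def[symmetric] by auto
  qed
qed

lemma G_plane: "f \<in> Q.G L4 \<Longrightarrow> x \<in> plane \<Longrightarrow> f x \<in> plane"
  unfolding symmetry_group_def
proof (induction arbitrary: x rule: generate.induct)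
  case one
  then show ?case by (auto simp: BijGroup_def plane_def L4_def)
next
  case (incl f)
  then obtain t \<tau> where t: "f = Q.Sy t \<tau>" "t \<in> V4" "\<tau> \<noteq> 0" "h4 t t = tr bar \<tau>"
    by (auto simp: Q.symmetries_iff)
  then show ?case using Sy_plane[OF t(2-4)] incl by simp
next
  case (inv f)
  then obtain t \<tau> where t: "f = Q.Sy t \<tau>" "t \<in> V4" "\<tau> \<noteq> 0" "h4 t t = tr bar \<tau>"
    by (auto simp: Q.symmetries_iff)
  have LV: "L4 \<subseteq> V4" by (auto simp: L4_def)
  have "Q.Sy t \<tau> \<in> Q.U L4" using inv t by simp
  then show ?case
    using Q.inv_Sy[OF t(2-4) _ LV] Sy_plane[OF t(2), of "bar \<tau>"] Q.Sy_bar_U[OF t(2-4) _ LV] inv.prems t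
    by (simp add: tr_def add.commute)
next
  case (eng f g)
  have LV: "L4 \<subseteq> V4" by (auto simp: L4_def)
  have "f \<in> Q.G L4" "g \<in> Q.G L4" using eng by (auto simp: symmetry_group_def)
  then have "f \<in> Bij V4" "g \<in> Bij V4" using Q.G_subset_U[OF LV] Q.U_Bij by blast+
  moreover have "x \<in> V4" using eng by (auto simp: plane_def L4_def)
  ultimately show ?case using eng by (simp add: BijGroup_def compose_def)
qed

lemma swap4_not_G: "swap4 \<notin> Q.G L4"
proof
  assume "swap4 \<in> Q.G L4"
  \<comment> \<open>A vector of the plane whose image, the sum of the other two basis vectors,
    reduces to a vector outside it.\<close>
  define x where "x = unit_vec 0 + unit_vec 1"
  have x: "x 0 = 1" "x 1 = 1" "x 2 = 0" "x 3 = 0" by (auto simp: x_def unit_vec_def)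
  have xL: "x \<in> L4" by (auto simp: x_def L4_def V4_def unit_vec_def)
  have b: "res_bit 1" "\<not> res_bit 0" using res_bit_1 by (auto simp: res_bit_def)
  have "x \<in> plane" using x xL b by (simp add: plane_def)
  with \<open>swap4 \<in> Q.G L4\<close> have "swap4 x \<in> plane" by (rule G_plane)
  then show False using xL x b by (simp add: plane_def swap4_apply L4_def)
qed

end

lemma counterexample:
  assumes "\<And>x. x \<in> F 0 \<Longrightarrow> x \<in> F 1 \<or> x - 1 \<in> F 1"
  shows "\<exists>(V :: (nat \<Rightarrow> 'e) set) h L. hermitian_space seq_scale bar V h \<and> nondegenerate h V \<and>
    lattice_in seq_scale (F 0) V L \<and> nondegenerate h L \<and>
    lattice_unitary_group seq_scale V h L \<noteq> symmetry_group seq_scale bar V h L"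
proof -
  have LV: "L4 \<subseteq> V4" by (auto simp: L4_def)
  show ?thesis
    using hermitian_space_V4 lattice_L4 nondegenerate_h4[OF order_refl LV]
      nondegenerate_h4[OF LV order_refl] swap4_U swap4_not_G[OF assms] by blast
qed

end

section \<open>Ramified quadratic extensions of dyadic local fields\<close>

context discrete_valuation
begin

lemma valuation_ring_F: "valuation_ring v = F 0"
  by (simp add: valuation_ring_def F_def)

lemma nonunits_F: "nonunits (F 0) = F 1"
proof -
  have "(\<exists>y\<in>F 0. x * y = 1) \<longleftrightarrow> x \<notin> F 1" if x: "x \<in> F 0" for x
  proof
    assume "\<exists>y\<in>F 0. x * y = 1"
    then obtain y where "y \<in> F 0" "x * y = 1" by blast
    then show "x \<notin> F 1" using F_mult[of x 1 y 0 1] by (auto simp: F_def)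
  next
    assume "x \<notin> F 1"
    then have "has_val 0 x" using x by (simp add: has_val_iff)
    then show "\<exists>y\<in>F 0. x * y = 1"
      by (intro bexI[of _ "inverse x"]) (auto simp: has_val_neq_0 intro: has_val_F[OF has_val_inverse[of 0 x 0]])
  qed
  moreover have "F 1 \<subseteq> F 0" by (auto intro: F_mono)
  ultimately show ?thesis unfolding nonunits_def by blast
qed

definition residue_rel :: "('k \<times> 'k) set" where
  "residue_rel = {(x, y) \<in> F 0 \<times> F 0. x - y \<in> F 1}"

lemma residue_field_F: "residue_field (F 0) = F 0 // residue_rel"
  by (simp add: residue_field_def nonunits_F residue_rel_def)

lemma residue_rel_equiv: "equiv (F 0) residue_rel"
proof (rule equivI)
  show "sym residue_rel" by (auto simp: sym_def residue_rel_def F_minus_commute)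
  show "trans residue_rel"
  proof (rule transI)
    fix x y z assume "(x, y) \<in> residue_rel" "(y, z) \<in> residue_rel"
    then show "(x, z) \<in> residue_rel"
      using F_add[of "x - y" 1 "y - z"] by (auto simp: residue_rel_def)
  qed
qed (auto simp: refl_on_def residue_rel_def)

lemma residue_class_eq:
  "x \<in> F 0 \<Longrightarrow> y \<in> F 0 \<Longrightarrow> residue_rel `` {x} = residue_rel `` {y} \<longleftrightarrow> x - y \<in> F 1"
  using eq_equiv_class_iff[OF residue_rel_equiv] by (simp add: residue_rel_def)

lemma card_residue_field_2:
  "card (residue_field (F 0)) = 2 \<longleftrightarrow> (\<forall>x\<in>F 0. x \<in> F 1 \<or> x - 1 \<in> F 1)"
proof -
  define c where "c x = residue_rel `` {x}" for x
  have ceq: "c x = c y \<longleftrightarrow> x - y \<in> F 1" if "x \<in> F 0" "y \<in> F 0" for x y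
    using residue_class_eq that by (simp add: c_def)
  have RF: "residue_field (F 0) = c ` F 0"
    unfolding residue_field_F quotient_def c_def by blast
  have ne: "c 0 \<noteq> c 1" using ceq[of 0 1] by (simp add: F_def)
  have "card (c ` F 0) = 2 \<longleftrightarrow> c ` F 0 = {c 0, c 1}"
  proof
    assume 2: "card (c ` F 0) = 2"
    \<comment> \<open>Infinite sets have \<open>card\<close> 0, so the equation includes
      finiteness.\<close>
    then have "finite (c ` F 0)" by (simp add: card_ge_0_finite)
    then have "{c 0, c 1} = c ` F 0" by (rule card_seteq) (use 2 ne in auto)
    then show "c ` F 0 = {c 0, c 1}" by simp
  qed (use ne in simp)
  also have "\<dots> \<longleftrightarrow> (\<forall>x\<in>F 0. c x = c 0 \<or> c x = c 1)" by auto
  also have "\<dots> \<longleftrightarrow> (\<forall>x\<in>F 0. x \<in> F 1 \<or> x - 1 \<in> F 1)"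
    using ceq by auto
  finally show ?thesis by (simp add: RF)
qed

text \<open>Squaring is injective on the residue field, so \<open>a\<close> recurs among its iterated squares.\<close>

lemma residue_square:
  assumes fin: "finite (residue_field (F 0))" and two: "2 \<in> F 1" and a: "a \<in> F 0"
  shows "\<exists>c\<in>F 0. c * c - a \<in> F 1"
proof -
  have inj: "x - y \<in> F 1" if xy: "x \<in> F 0" "y \<in> F 0" "x\<^sup>2 - y\<^sup>2 \<in> F 1" for x y
  proof -
    have "2 * (y * (x - y)) \<in> F 1"
      by (rule F_mult[OF two, of _ 0]) (use xy in auto)
    with xy(3) have "x\<^sup>2 - y\<^sup>2 - 2 * (y * (x - y)) \<in> F 1" by (rule F_diff)
    then have "(x - y) * (x - y) \<in> F 1" by (simp add: power2_eq_square algebra_simps)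
    then show ?thesis using val_mult[of "x - y" "x - y"] by (cases "x = y") (auto simp: F_def)
  qed
  have pF: "a ^ n \<in> F 0" for n using a by (induction n) auto
  have "\<not> inj (\<lambda>n. residue_rel `` {a ^ 2 ^ n})"
  proof
    assume "inj (\<lambda>n. residue_rel `` {a ^ 2 ^ n})"
    moreover have "finite (range (\<lambda>n. residue_rel `` {a ^ 2 ^ n}))"
      by (rule finite_subset[OF _ fin]) (auto simp: residue_field_F intro: quotientI pF)
    ultimately show False using finite_imageD by blast
  qed
  then obtain m n where mn: "m < n" "residue_rel `` {a ^ 2 ^ n} = residue_rel `` {a ^ 2 ^ m}"
    by (auto simp: inj_def) (metis nat_neq_iff)
  define d where "d = n - m - 1"
  have n: "n = m + Suc d" using mn by (simp add: d_def)
  have "a ^ 2 ^ (m + Suc d) - a ^ 2 ^ m \<in> F 1"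
    using mn residue_class_eq pF by (simp add: n)
  then have "a ^ 2 ^ Suc d - a \<in> F 1"
  proof (induction m)
    case (Suc m)
    have "(a ^ 2 ^ (m + Suc d))\<^sup>2 - (a ^ 2 ^ m)\<^sup>2 \<in> F 1"
      using Suc.prems by (simp add: power_mult[symmetric] mult.commute)
    then show ?case using inj[OF pF pF] Suc.IH by blast
  qed simp
  moreover have "a ^ 2 ^ Suc d = a ^ 2 ^ d * a ^ 2 ^ d"
    by (simp add: power_add[symmetric] mult_2)
  ultimately show ?thesis using pF by metis
qed

end

context nonarch_local_field
begin

text \<open>A case of Hensel's lemma: the root is a fixed point of the map y -> c + y^2, which
  contracts P because differences of values gain the factor \<open>Y (Suc n) + Y n\<close>.\<close>

lemma quadratic_root:
  assumes c: "c \<in> F 1"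
  obtains y where "y * y - y + c = 0"
proof -
  define Y where "Y n = ((\<lambda>y. c + y * y) ^^ n) 0" for n
  have Y_Suc: "Y (Suc n) = c + Y n * Y n" for n by (simp add: Y_def)
  have YF: "Y n \<in> F 1" for n
  proof (induction n)
    case (Suc n)
    have "Y n * Y n \<in> F 1" by (rule F_mult[OF Suc Suc]) simp
    then show ?case using c by (auto simp: Y_Suc)
  qed (simp add: Y_def)
  have step: "Y (Suc n) - Y n \<in> F (int n)" for n
  proof (induction n)
    case 0
    then show ?case using YF[of 1] YF[of 0] F_mono by auto
  next
    case (Suc n)
    have "Y (Suc (Suc n)) - Y (Suc n) = (Y (Suc n) - Y n) * (Y (Suc n) + Y n)"
      by (simp add: Y_Suc algebra_simps)
    also have "\<dots> \<in> F (int (Suc n))" by (rule F_mult[OF Suc F_add[OF YF YF]]) simp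
    finally show ?case .
  qed
  have far: "Y (n + k) - Y n \<in> F (int n)" for n k
  proof (induction k)
    case (Suc k)
    have "Y (Suc (n + k)) - Y (n + k) \<in> F (int n)" by (rule F_mono[OF step]) simp
    from F_add[OF this Suc] show ?case by simp
  qed simp
  have "val_Cauchy v Y"
    unfolding val_Cauchy_def
  proof (intro allI exI impI)
    fix N and m n assume mn: "nat N \<le> m" "nat N \<le> n"
    have "Y m - Y (nat N) \<in> F (int (nat N))" "Y n - Y (nat N) \<in> F (int (nat N))"
      using far[of "nat N" "m - nat N"] far[of "nat N" "n - nat N"] mn by simp_all
    then have "Y m - Y (nat N) - (Y n - Y (nat N)) \<in> F (int (nat N))" by (rule F_diff)
    then have "Y m - Y n \<in> F N" by (auto intro: F_mono)
    then show "Y m = Y n \<or> N \<le> v (Y m - Y n)" by (auto simp: F_def)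
  qed
  then obtain l where "val_converges v Y l" using complete by blast
  then have conv: "\<exists>K. \<forall>n\<ge>K. Y n - l \<in> F N" for N
    unfolding val_converges_def F_def by (metis (mono_tags, lifting) mem_Collect_eq right_minus_eq)
  obtain K where "\<forall>n\<ge>K. Y n - l \<in> F 1" using conv by blast
  then have "Y K - l \<in> F 1" by blast
  then have lF: "l \<in> F 0"
    using F_diff[OF YF[of K], of "Y K - l"] by (auto intro: F_mono)
  have "l * l - l + c \<in> F N" for N
  proof -
    obtain K where K: "\<forall>n\<ge>K. Y n - l \<in> F N" using conv by blast
    have "(Y K - l) * (Y K + l) \<in> F N"
      by (rule F_mult[of _ N _ 0]) (use K lF YF[of K] F_mono[of "Y K" 1 0] in auto)
    moreover have "Y (Suc K) - l \<in> F N" using K by auto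
    ultimately have "(Y (Suc K) - l) - (Y K - l) * (Y K + l) \<in> F N" by blast
    then show ?thesis by (simp add: Y_Suc algebra_simps)
  qed
  from this[of "v (l * l - l + c) + 1"] have "l * l - l + c = 0" by (auto simp: F_def)
  then show thesis by (rule that)
qed

end

context field_embedding
begin

lemma emb_0: "\<iota> 0 = 0"
  using emb_add[of 0 0] by (metis add.right_neutral add_cancel_left_right)

lemma emb_uminus: "\<iota> (- x) = - \<iota> x"
  by (metis add.right_inverse add_eq_0_iff emb_0 emb_add)

lemma emb_diff: "\<iota> (x - y) = \<iota> x - \<iota> y"
  using emb_add[of x "- y"] by (simp add: emb_uminus)

lemma emb_eq_0_iff: "\<iota> x = 0 \<longleftrightarrow> x = 0"
  using emb_mult[of x "inverse x"] emb_one emb_0 by (cases "x = 0") auto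

lemma emb_eq_iff: "\<iota> x = \<iota> y \<longleftrightarrow> x = y"
  using emb_eq_0_iff[of "x - y"] by (simp add: emb_diff)

lemma emb_divide: "\<iota> (x / y) = \<iota> x / \<iota> y"
proof (cases "y = 0")
  case False
  then have "\<iota> (x / y) * \<iota> y = \<iota> x" by (simp flip: emb_mult)
  then show ?thesis using False by (metis emb_eq_0_iff nonzero_eq_divide_eq)
qed (simp add: emb_0)

lemma emb_power: "\<iota> (x ^ n) = \<iota> x ^ n"
  by (induction n) (auto simp: emb_one emb_mult)

lemmas emb_simps = emb_0 emb_one emb_add emb_uminus emb_diff emb_mult emb_divide emb_power
  emb_eq_0_iff emb_eq_iff

end

text \<open>In the coordinates of a basis with two elements, 1 and x0 have determinant d, whose
  vanishing would put x0 into the base field. Cramer's rule does the rest.\<close>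

lemma (in quadratic_extension) generated_by_1:
  assumes x0: "x0 \<notin> range \<iota>"
  shows "\<exists>a b. x = \<iota> a + \<iota> b * x0"
proof -
  interpret vs: vector_space "\<lambda>a x. \<iota> a * x"
    by unfold_locales (auto simp: emb_simps algebra_simps)
  obtain B where B: "vs.span B = UNIV" "card B = 2"
    using vs.basis_exists[of UNIV] degree_two by (metis top.extremum_unique)
  then obtain b1 b2 where b: "B = {b1, b2}" by (auto simp: card_2_iff)
  have rep: "\<exists>p q. y = \<iota> p * b1 + \<iota> q * b2" for y
  proof -
    have "y \<in> vs.span {b1, b2}" using B b by auto
    then obtain p where "y - \<iota> p * b1 \<in> vs.span {b2}" using vs.span_breakdown_eq by blast
    then obtain q where "y - \<iota> p * b1 - \<iota> q * b2 \<in> vs.span {}" using vs.span_breakdown_eq by blast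
    then have "y - \<iota> p * b1 - \<iota> q * b2 = 0" by simp
    then have "y = \<iota> p * b1 + \<iota> q * b2" by (simp add: algebra_simps)
    then show ?thesis by blast
  qed
  obtain p q where pq: "1 = \<iota> p * b1 + \<iota> q * b2" using rep by blast
  obtain r s where rs: "x0 = \<iota> r * b1 + \<iota> s * b2" using rep by blast
  define d where "d = p * s - q * r"
  have e1: "\<iota> s - \<iota> q * x0 = \<iota> d * b1"
  proof -
    have "\<iota> s * 1 - \<iota> q * x0 = \<iota> d * b1" unfolding pq rs by (simp add: d_def emb_simps algebra_simps)
    then show ?thesis by simp
  qed
  have e2: "\<iota> p * x0 - \<iota> r = \<iota> d * b2"
  proof -
    have "\<iota> p * x0 - \<iota> r * 1 = \<iota> d * b2" unfolding pq rs by (simp add: d_def emb_simps algebra_simps)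
    then show ?thesis by simp
  qed
  have "d \<noteq> 0"
  proof
    assume d: "d = 0"
    show False
    proof (cases "q = 0")
      case False
      then have "x0 = \<iota> (s / q)" using e1 d by (simp add: emb_simps field_simps)
      then show False using x0 by blast
    next
      case True
      then have "p \<noteq> 0" using pq by (auto simp: emb_simps)
      then have "x0 = \<iota> (r / p)" using e2 d by (simp add: emb_simps field_simps)
      then show False using x0 by blast
    qed
  qed
  then have b12: "b1 = \<iota> (s / d) - \<iota> (q / d) * x0" "b2 = \<iota> (p / d) * x0 - \<iota> (r / d)"
    using e1 e2 by (simp_all add: emb_simps field_simps)
  obtain m n where mn: "x = \<iota> m * b1 + \<iota> n * b2" using rep by blast
  have "x = \<iota> (m * (s / d) - n * (r / d)) + \<iota> (n * (p / d) - m * (q / d)) * x0"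
    unfolding mn b12 by (simp add: emb_simps algebra_simps)
  then show ?thesis by blast
qed

section \<open>The valuation of the extension\<close>

locale ramified_dyadic_extension =
  nonarch_local_field v + base: quadratic_extension \<iota> + aut: nontrivial_automorphism \<iota> bar
  for v :: "'k::field_char_0 \<Rightarrow> int" and \<iota> :: "'k \<Rightarrow> 'e::field" and bar :: "'e \<Rightarrow> 'e" +
  assumes dyadic: "dyadic v" and ramified: "ramified v \<iota>"
begin

lemma F_2_base: "2 \<in> F 1"
  using dyadic by (simp add: dyadic_def valuation_ring_F nonunits_F)

text \<open>That \<open>bar\<close> is an involution has to be derived. It permutes the roots of the
  quadratic equation of a moved element x0, so \<open>bar x0\<close> is the second root
  \<open>\<iota> t - x0\<close>.\<close>

lemma generic_element:
  obtains x0 where "x0 \<notin> range \<iota>" "bar x0 \<noteq> x0" "bar (bar x0) = x0"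
proof -
  obtain x0 where x0: "bar x0 \<noteq> x0" using aut.bar_nontrivial by (auto simp: fun_eq_iff)
  then have x0K: "x0 \<notin> range \<iota>" using aut.bar_fixes_base by auto
  obtain n t where nt: "x0 * x0 = \<iota> n + \<iota> t * x0" using base.generated_by_1[OF x0K] by blast
  have "bar x0 * bar x0 = \<iota> n + \<iota> t * bar x0"
    using arg_cong[OF nt, of bar] by (simp add: aut.emb_simps aut.bar_fixes_base)
  then have "(bar x0 - x0) * (bar x0 + x0 - \<iota> t) = 0"
    using nt by (simp add: algebra_simps)
  then have "bar x0 + x0 - \<iota> t = 0" using x0 by simp
  then have t: "bar x0 = \<iota> t - x0" by (simp add: algebra_simps)
  then have "bar (bar x0) = x0" by (simp add: aut.emb_simps aut.bar_fixes_base)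
  then show thesis using that x0 x0K by blast
qed

lemma bar_bar: "bar (bar x) = x"
proof -
  obtain x0 where x0: "x0 \<notin> range \<iota>" "bar (bar x0) = x0" using generic_element by blast
  obtain a b where "x = \<iota> a + \<iota> b * x0" using base.generated_by_1[OF x0(1)] by blast
  then show ?thesis by (simp add: aut.emb_simps aut.bar_fixes_base x0)
qed

lemma fixed_range: "bar x = x \<Longrightarrow> x \<in> range \<iota>"
proof -
  assume x: "bar x = x"
  obtain x0 where x0: "x0 \<notin> range \<iota>" "bar x0 \<noteq> x0" using generic_element by blast
  obtain a b where ab: "x = \<iota> a + \<iota> b * x0" using base.generated_by_1[OF x0(1)] by blast
  then have "\<iota> b * (bar x0 - x0) = 0"
    using x by (simp add: aut.emb_simps aut.bar_fixes_base algebra_simps)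
  then have "b = 0" using x0 by (simp add: base.emb_simps)
  then show ?thesis using ab by (simp add: base.emb_simps)
qed

definition nm :: "'e \<Rightarrow> 'k" where "nm x = inv_into UNIV \<iota> (x * bar x)"

lemma nm: "\<iota> (nm x) = x * bar x"
  unfolding nm_def by (rule f_inv_into_f[OF fixed_range]) (simp add: aut.emb_simps bar_bar mult.commute)

definition tc :: "'e \<Rightarrow> 'k" where "tc x = inv_into UNIV \<iota> (x + bar x)"

lemma tc: "\<iota> (tc x) = x + bar x"
  unfolding tc_def by (rule f_inv_into_f[OF fixed_range]) (simp add: aut.emb_simps bar_bar add.commute)

lemma nm_eqI: "x * bar x = \<iota> a \<Longrightarrow> nm x = a"
  using nm[of x] by (simp add: base.emb_simps)

lemma nm_mult: "nm (x * y) = nm x * nm y"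
  by (rule nm_eqI) (simp add: base.emb_simps aut.emb_simps nm)

lemma nm_base: "nm (\<iota> a) = a * a"
  by (rule nm_eqI) (simp add: base.emb_simps aut.bar_fixes_base)

lemma nm_bar: "nm (bar x) = nm x"
  by (rule nm_eqI) (simp add: bar_bar nm mult.commute)

lemma nm_eq_0_iff: "nm x = 0 \<longleftrightarrow> x = 0"
  using nm[of x] by (metis aut.emb_eq_0_iff base.emb_eq_0_iff mult_eq_0_iff)

text \<open>Normalized so as to restrict to \<open>2 * v\<close> on the base field; ramification
  makes 1 a value.\<close>

definition w :: "'e \<Rightarrow> int" where "w x = v (nm x)"

lemma w_base: "a \<noteq> 0 \<Longrightarrow> w (\<iota> a) = 2 * v a"
  by (simp add: w_def nm_base val_mult)

lemma w_mult: "x \<noteq> 0 \<Longrightarrow> y \<noteq> 0 \<Longrightarrow> w (x * y) = w x + w y"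
  by (simp add: w_def nm_mult val_mult nm_eq_0_iff)

text \<open>Otherwise \<open>X\<^sup>2 - tc x X + nm x\<close> would split over the base field, by \<open>quadratic_root\<close>.\<close>

lemma trace_integral:
  assumes n: "nm x \<in> F 0"
  shows "tc x \<in> F 0"
proof (rule ccontr)
  assume T: "tc x \<notin> F 0"
  define t where "t = tc x"
  have t: "t \<noteq> 0" "v t < 0" using T by (auto simp: F_def t_def)
  \<comment> \<open>Substituting X = t y and dividing by t^2 gives the shape of
    \<open>quadratic_root\<close>, with constant term in P because t has negative valuation.\<close>
  have "nm x / (t * t) \<in> F 1"
    by (rule F_divide[OF n]) (use t in \<open>auto simp: has_val_def val_mult\<close>)
  then obtain y where "y * y - y + nm x / (t * t) = 0" using quadratic_root by blast
  then have "(t * t) * (y * y - y + nm x / (t * t)) = 0" by simp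
  then have "(t * y) * (t * y) - t * (t * y) + nm x = 0"
    using t by (simp add: algebra_simps)
  then have "\<iota> ((t * y) * (t * y) - t * (t * y) + nm x) = 0" by (simp add: base.emb_simps)
  then have "(\<iota> (t * y) - x) * (\<iota> (t * y) - bar x) = 0"
    using tc[of x] nm[of x] by (simp add: base.emb_simps t_def algebra_simps)
  then have "x = \<iota> (t * y) \<or> bar x = \<iota> (t * y)" by auto
  then obtain a where x: "x = \<iota> a" using bar_bar[of x] aut.bar_fixes_base by metis
  then have "\<iota> t = \<iota> (a + a)"
    unfolding base.emb_add t_def tc[of x] by (simp add: x aut.bar_fixes_base)
  then have "t = a + a" by (simp only: base.emb_eq_iff)
  moreover have "a * a \<in> F 0" using n x by (simp add: nm_base)
  then have "a \<in> F 0" using val_mult[of a a] by (cases "a = 0") (auto simp: F_def)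
  ultimately show False using T F_add[of a 0 a] by (simp add: t_def)
qed

text \<open>The norm of \<open>1 + z\<close> is \<open>1 + tc z + nm z\<close>, so the ultrametric
  inequality comes down to integrality of traces.\<close>

lemma w_add_1:
  assumes "z \<noteq> 0" "1 + z \<noteq> 0" "0 \<le> w z"
  shows "0 \<le> w (1 + z)"
proof -
  have n: "nm z \<in> F 0" using assms by (simp add: w_def F_def)
  have "nm (1 + z) = 1 + tc z + nm z"
    by (rule nm_eqI) (simp add: base.emb_simps aut.emb_simps tc nm algebra_simps)
  then have "nm (1 + z) \<in> F 0" using n trace_integral[OF n] by auto
  then show ?thesis using nm_eq_0_iff[of "1 + z"] assms by (simp add: F_def w_def)
qed

lemma w_add:
  assumes "x \<noteq> 0" "y \<noteq> 0" "x + y \<noteq> 0"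
  shows "min (w x) (w y) \<le> w (x + y)"
proof -
  have *: "w x \<le> w (x + y)" if xy: "x \<noteq> 0" "y \<noteq> 0" "x + y \<noteq> 0" "w x \<le> w y" for x y
  proof -
    define z where "z = y / x"
    have z: "y = x * z" "z \<noteq> 0" using xy by (auto simp: z_def)
    have z1: "x + y = x * (1 + z)" using z by (simp add: algebra_simps)
    have "1 + z \<noteq> 0" using z1 xy by auto
    moreover have "0 \<le> w z" using xy z w_mult[of x z] by simp
    ultimately show ?thesis unfolding z1 using w_add_1[of z] z xy w_mult[of x "1 + z"] by simp
  qed
  show ?thesis using *[of x y] *[of y x] assms by (cases "w x \<le> w y") (auto simp: add.commute)
qed

text \<open>The ideals of w, at a stage where w is not yet known to be a discrete valuation: its
  normalization rests on ramification, whose definition refers to the ideals.\<close>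

definition P_ext :: "int \<Rightarrow> 'e set" where "P_ext n = {x. x = 0 \<or> n \<le> w x}"

lemma P_ext_add: "x \<in> P_ext n \<Longrightarrow> y \<in> P_ext n \<Longrightarrow> x + y \<in> P_ext n"
  using w_add[of x y] by (cases "x = 0 \<or> y = 0 \<or> x + y = 0") (auto simp: P_ext_def)

lemma P_ext_0 [simp]: "0 \<in> P_ext n"
  by (simp add: P_ext_def)

lemma P_ext_sum: "(\<And>i. i \<in> A \<Longrightarrow> f i \<in> P_ext n) \<Longrightarrow> sum f A \<in> P_ext n"
  by (induction A rule: infinite_finite_induct) (auto intro: P_ext_add)

lemma P_ext_mult: "x \<in> P_ext m \<Longrightarrow> y \<in> P_ext n \<Longrightarrow> k \<le> m + n \<Longrightarrow> x * y \<in> P_ext k"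
  using w_mult[of x y] by (cases "x = 0 \<or> y = 0") (auto simp: P_ext_def)

lemma P_ext_base: "a \<in> F n \<Longrightarrow> \<iota> a \<in> P_ext (2 * n)"
  using w_base[of a] by (cases "a = 0") (auto simp: F_def P_ext_def base.emb_simps)

lemma w_1: "w 1 = 0"
  using w_base[of 1] by (simp add: base.emb_simps)

lemma w_inverse: "x \<noteq> 0 \<Longrightarrow> w (inverse x) = - w x"
  using w_mult[of x "inverse x"] by (simp add: w_1)

lemma w_power: "x \<noteq> 0 \<Longrightarrow> w (x ^ n) = int n * w x"
  by (induction n) (auto simp: w_1 w_mult algebra_simps)

text \<open>An element of integral norm has integral trace, so its characteristic polynomial is
  integral. Conversely, if \<open>w x < 0\<close>, the leading term of a monic integral equation has
  smaller valuation than all other terms.\<close>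

lemma ring_of_integers_P_ext: "ring_of_integers v \<iota> = P_ext 0"
proof (intro equalityI subsetI)
  fix x assume "x \<in> P_ext 0"
  then have n: "nm x \<in> F 0" using nm_eq_0_iff[of x] by (auto simp: P_ext_def F_def w_def)
  define p where "p = [:nm x, - tc x, 1:]"
  have "lead_coeff p = 1" by (simp add: p_def)
  moreover have "coeff p i \<in> valuation_ring v" for i
    using n trace_integral[OF n] by (auto simp: p_def valuation_ring_F coeff_pCons split: nat.split)
  moreover have "poly (map_poly \<iota> p) x = 0"
    by (simp add: p_def map_poly_pCons base.emb_simps nm tc algebra_simps)
  ultimately show "x \<in> ring_of_integers v \<iota>" unfolding ring_of_integers_def by blast
next
  fix x assume "x \<in> ring_of_integers v \<iota>"
  then obtain p where p: "lead_coeff p = 1" "\<And>i. coeff p i \<in> F 0" "poly (map_poly \<iota> p) x = 0"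
    by (auto simp: ring_of_integers_def valuation_ring_F)
  show "x \<in> P_ext 0"
  proof (rule ccontr)
    assume "x \<notin> P_ext 0"
    then have x: "x \<noteq> 0" "w x < 0" by (auto simp: P_ext_def)
    define n where "n = degree p"
    have deg: "degree (map_poly \<iota> p) = n"
      unfolding n_def by (rule degree_map_poly) (use p(1) in \<open>auto simp: base.emb_simps\<close>)
    have "0 = (\<Sum>i\<le>n. \<iota> (coeff p i) * x ^ i)"
      using p(3) deg by (simp add: poly_altdef coeff_map_poly base.emb_simps)
    also have "\<dots> = (\<Sum>i<n. \<iota> (coeff p i) * x ^ i) + x ^ n"
      using p(1) by (simp add: n_def base.emb_simps flip: lessThan_Suc_atMost)
    finally have "x ^ n = - (\<Sum>i<n. \<iota> (coeff p i) * x ^ i)"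
      by (metis add.commute add_eq_0_iff)
    also have "\<dots> = (\<Sum>i<n. \<iota> (- coeff p i) * x ^ i)"
      by (simp add: base.emb_simps sum_negf)
    also have "\<dots> \<in> P_ext (int n * w x + 1)"
    proof (rule P_ext_sum)
      fix i assume "i \<in> {..<n}"
      then have "int i + 1 \<le> int n" by simp
      then have "int n * w x \<le> (int i + 1) * w x"
        using x(2) by (intro mult_right_mono_neg) auto
      then have "int n * w x + 1 \<le> int i * w x" using x(2) by (simp add: algebra_simps)
      then have "x ^ i \<in> P_ext (int n * w x + 1)" using x by (simp add: P_ext_def w_power)
      moreover have "\<iota> (- coeff p i) \<in> P_ext (2 * 0)" using p(2) by (intro P_ext_base) simp
      ultimately show "\<iota> (- coeff p i) * x ^ i \<in> P_ext (int n * w x + 1)"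
        by (intro P_ext_mult[of _ "2 * 0" _ "int n * w x + 1"]) auto
    qed
    finally show False using x by (simp add: P_ext_def w_power)
  qed
qed

lemma nonunits_P_ext: "nonunits (P_ext 0) = P_ext 1"
proof -
  have "(\<exists>y\<in>P_ext 0. x * y = 1) \<longleftrightarrow> x \<notin> P_ext 1" if x: "x \<in> P_ext 0" for x
  proof
    assume "\<exists>y\<in>P_ext 0. x * y = 1"
    then obtain y where "y \<in> P_ext 0" "x * y = 1" by blast
    then show "x \<notin> P_ext 1" using P_ext_mult[of x 1 y 0 1] w_1 by (auto simp: P_ext_def)
  next
    assume "x \<notin> P_ext 1"
    then have "x \<noteq> 0" "w x = 0" using x by (auto simp: P_ext_def)
    then show "\<exists>y\<in>P_ext 0. x * y = 1"
      by (intro bexI[of _ "inverse x"]) (auto simp: P_ext_def w_inverse)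
  qed
  moreover have "P_ext 1 \<subseteq> P_ext 0" by (auto simp: P_ext_def)
  ultimately show ?thesis unfolding nonunits_def by blast
qed

text \<open>If w took only even values, a uniformizer p of the base would divide every nonunit and
  generate the maximal ideal, against \<open>ramified\<close>. A power of p moves an odd value to
  1.\<close>

lemma uniformizer_ext: "\<exists>\<pi>. \<pi> \<noteq> 0 \<and> w \<pi> = 1"
proof -
  obtain p where p: "p \<noteq> 0" "v p = 1" using val_normalized by blast
  have "\<exists>x. x \<noteq> 0 \<and> odd (w x)"
  proof (rule ccontr)
    assume "\<not> ?thesis"
    then have even: "even (w x)" if "x \<noteq> 0" for x using that by blast
    have "span_over (*) (P_ext 0) (\<iota> ` F 1) = P_ext 1"
    proof (intro equalityI subsetI)
      fix x assume "x \<in> span_over (*) (P_ext 0) (\<iota> ` F 1)"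
      then obtain T r where T: "T \<subseteq> \<iota> ` F 1" "\<forall>s\<in>T. r s \<in> P_ext 0" "x = (\<Sum>s\<in>T. r s * s)"
        by (auto simp: span_over_def)
      show "x \<in> P_ext 1"
        unfolding T(3)
      proof (rule P_ext_sum)
        fix s assume s: "s \<in> T"
        then have "s \<in> P_ext (2 * 1)" using T P_ext_base by blast
        then show "r s * s \<in> P_ext 1" using T s by (intro P_ext_mult[of _ 0 _ "2 * 1"]) auto
      qed
    next
      fix x assume x: "x \<in> P_ext 1"
      show "x \<in> span_over (*) (P_ext 0) (\<iota> ` F 1)"
      proof (cases "x = 0")
        case True
        then show ?thesis unfolding span_over_def by (intro CollectI exI[of _ "{}"]) auto
      next
        case False
        then have "1 \<le> w x" "even (w x)" using x even by (auto simp: P_ext_def)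
        then have 2: "2 \<le> w x" by presburger
        have ip: "\<iota> p \<noteq> 0" using p by (simp add: base.emb_simps)
        have "w x = w (x / \<iota> p) + w (\<iota> p)" using w_mult[of "x / \<iota> p" "\<iota> p"] ip False by simp
        then have "x / \<iota> p \<in> P_ext 0" using 2 p by (simp add: P_ext_def w_base)
        moreover have "p \<in> F 1" using p by (simp add: F_def)
        ultimately show ?thesis unfolding span_over_def
          by (intro CollectI exI[of _ "{\<iota> p}"] exI[of _ "\<lambda>_. x / \<iota> p"]) (use ip in auto)
      qed
    qed
    then show False using ramified
      by (simp add: ramified_def ring_of_integers_P_ext nonunits_P_ext valuation_ring_F nonunits_F)
  qed
  then obtain x where x: "x \<noteq> 0" "odd (w x)" by blast
  define j where "j = (1 - w x) div 2"
  have j: "w x + 2 * j = 1" using x by (simp add: j_def)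
  have pj: "p powi j \<noteq> 0" "v (p powi j) = j" using p by (simp_all add: val_powi)
  have "w (x * \<iota> (p powi j)) = 1"
    using x pj j by (simp add: w_mult w_base base.emb_simps)
  then show ?thesis using x pj by (intro exI[of _ "x * \<iota> (p powi j)"]) (simp add: base.emb_simps)
qed

lemma perfect_ramified_involution: "\<exists>\<pi>. perfect_ramified_involution w bar \<pi>"
proof -
  obtain \<pi> where \<pi>: "\<pi> \<noteq> 0" "w \<pi> = 1" using uniformizer_ext by blast
  interpret W: discrete_valuation w
    using uniformizer_ext by unfold_locales (auto simp: w_mult w_add)
  have WF: "W.F n = P_ext n" for n by (simp add: W.F_def P_ext_def)
  have two: "(2 :: 'e) = \<iota> 2"
    using base.emb_add[of 1 1] by (simp add: base.emb_simps)
  have "perfect_ramified_involution w bar \<pi>"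
  proof
    fix x y
    show "bar (x + y) = bar x + bar y" "bar (x * y) = bar x * bar y" "bar (bar x) = x"
      by (simp_all add: aut.emb_simps bar_bar)
    show "w (bar x) = w x" by (simp add: w_def nm_bar)
    show "w \<pi> = 1" "\<pi> \<noteq> 0" using \<pi> by auto
    show "(2 :: 'e) \<noteq> 0" unfolding two by (simp add: base.emb_simps del: two)
    show "0 < w 2" unfolding two using F_2_base by (simp add: w_base F_def)
  next
    fix x assume x: "bar x = x" "x \<noteq> 0"
    then obtain a where "x = \<iota> a" using fixed_range by blast
    then show "even (w x)" using x w_base[of a] by (auto simp: base.emb_simps)
  next
    fix a assume a: "bar a = a" "w a = 0"
    then obtain b where b: "a = \<iota> b" using fixed_range by blast
    show "\<exists>c. w c = 0 \<and> c * bar c - a \<in> W.F 1"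
    proof (cases "b = 0")
      \<comment> \<open>The junk value \<open>w 0\<close> might be 0, so \<open>a = 0\<close> has to
        be covered.\<close>
      case True
      then show ?thesis using a b
        by (intro exI[of _ 0]) (auto simp: WF P_ext_def base.emb_simps aut.emb_simps)
    next
      case False
      then have v: "v b = 0" using a b w_base[of b] by simp
      then have "b \<in> F 0" by (simp add: F_def)
      \<comment> \<open>A square root of b modulo the maximal ideal is taken in the base field,
        where the norm is squaring.\<close>
      then obtain c where c: "c \<in> F 0" "c * c - b \<in> F 1"
        using residue_square[OF _ F_2_base] finite_residue_field by (auto simp: valuation_ring_F)
      have "\<iota> c * bar (\<iota> c) - a = \<iota> (c * c - b)"
        by (simp add: b aut.bar_fixes_base base.emb_simps)
      then have "\<iota> c * bar (\<iota> c) - a \<in> P_ext 1"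
        using P_ext_base[OF c(2)] by (auto simp: P_ext_def)
      moreover have "w (\<iota> c) = 0"
      proof -
        have "has_val 0 b" using False v by (simp add: has_val_def)
        then have "has_val 0 (b + (c * c - b))" using c by (intro has_val_add) auto
        then have "c \<noteq> 0" "v (c * c) = 0" by (auto simp: has_val_def)
        then show ?thesis by (simp add: w_base val_mult)
      qed
      ultimately show ?thesis by (auto simp: WF)
    qed
  qed
  then show ?thesis by blast
qed

end

theorem theoremA1:
  fixes v :: "'k::field_char_0 \<Rightarrow> int"
    and \<iota> :: "'k \<Rightarrow> 'e::field"
    and bar :: "'e \<Rightarrow> 'e"
  assumes "nonarch_local_field v"
    and "dyadic v"
    and "quadratic_extension \<iota>"
    and "ramified v \<iota>"
    and "nontrivial_automorphism \<iota> bar"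
  shows "(\<forall>(V :: (nat \<Rightarrow> 'e) set) h L.
            hermitian_space seq_scale bar V h \<and> nondegenerate h V \<and>
            lattice_in seq_scale (ring_of_integers v \<iota>) V L \<and> nondegenerate h L \<longrightarrow>
            lattice_unitary_group seq_scale V h L = symmetry_group seq_scale bar V h L)
         \<longleftrightarrow> card (residue_field (ring_of_integers v \<iota>)) \<noteq> 2"
proof -
  interpret E: ramified_dyadic_extension v \<iota> bar
    using assms by (intro ramified_dyadic_extension.intro ramified_dyadic_extension_axioms.intro)
  obtain \<pi> where "perfect_ramified_involution E.w bar \<pi>"
    using E.perfect_ramified_involution by blast
  then interpret W: perfect_ramified_involution E.w bar \<pi> .
  have O: "ring_of_integers v \<iota> = W.F 0"
    by (simp add: E.ring_of_integers_P_ext E.P_ext_def W.F_def)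
  show ?thesis
    unfolding O W.card_residue_field_2
  proof (intro iffI notI)
    assume *: "\<forall>(V :: (nat \<Rightarrow> 'e) set) h L.
            hermitian_space seq_scale bar V h \<and> nondegenerate h V \<and>
            lattice_in seq_scale (W.F 0) V L \<and> nondegenerate h L \<longrightarrow>
            lattice_unitary_group seq_scale V h L = symmetry_group seq_scale bar V h L"
      and "\<forall>x\<in>W.F 0. x \<in> W.F 1 \<or> x - 1 \<in> W.F 1"
    then show False using W.counterexample by blast
  next
    assume "\<not> (\<forall>x\<in>W.F 0. x \<in> W.F 1 \<or> x - 1 \<in> W.F 1)"
    then obtain u where u: "u \<in> W.F 0" "u \<notin> W.F 1" "u - 1 \<notin> W.F 1" by blast
    then have "W.has_val 0 u" "W.has_val 0 (1 - u)"
      using W.F_minus_commute[of u 1 1] by (auto simp: W.has_val_iff)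
    then have u': "\<exists>u. W.has_val 0 u \<and> W.has_val 0 (1 - u)" by blast
    show "\<forall>(V :: (nat \<Rightarrow> 'e) set) h L.
            hermitian_space seq_scale bar V h \<and> nondegenerate h V \<and>
            lattice_in seq_scale (W.F 0) V L \<and> nondegenerate h L \<longrightarrow>
            lattice_unitary_group seq_scale V h L = symmetry_group seq_scale bar V h L"
    proof (intro allI impI)
      fix V :: "(nat \<Rightarrow> 'e) set" and h L
      assume a: "hermitian_space seq_scale bar V h \<and> nondegenerate h V \<and>
        lattice_in seq_scale (W.F 0) V L \<and> nondegenerate h L"
      then interpret H: hermitian_space seq_scale bar V h by simp
      interpret H: hermitian_lattice E.w bar \<pi> seq_scale V h L
        by unfold_locales (use a u' in auto)
      show "lattice_unitary_group seq_scale V h L = symmetry_group seq_scale bar V h L"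
        by (rule H.U_eq_G)
    qed
  qed
qed

end
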